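(* For each $d\in\{1,\dots,n\}$, $C_\delta\ge1$ and $\gamma\in(0,1)$, we can find $C_1=C_1(d,C_\delta,\gamma)>0$ (small enough) such that the following holds. Let $\mu$ be a Radon measure on $\mathbb{R}^n$ with support $\Sigma$ that is doubling with constant $C_\delta$, and let $B=B(x,r)$ be a ball centered on $\Sigma$ such that $$\int_{B(x,2r)}\int_0^{2r}\alpha_d(y,t)\,\frac{dt\,d\mu(y)}{t}\le C_1\,\mu(B).$$ Then there is a Borel set $A\subset B$ such that $\mu(B\setminus A)\le\gamma\,\mu(B)$, $A$ is contained in a $\gamma$-Lipschitz graph of dimension $d$, and $$(1-\gamma)\frac{\mathcal{H}^d(Z)}{r^d}\le\frac{\mu(Z)}{\mu(B)}\le(1+\gamma)\frac{\mathcal{H}^d(Z)}{r^d}\qquad\text{for every Borel set }Z\subset A.$$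
   Context: $B(x,r)$ is the open ball, $\mathbb{B}=B(0,1)\subset\mathbb{R}^n$. The support of a Radon measure $\mu$ (locally finite positive Borel measure) is $\Sigma=\{x:\mu(B(x,r))>0\ \forall r>0\}$; $\mu$ is doubling with constant $C_\delta$ if $\mu(B(x,2r))\le C_\delta\,\mu(B(x,r))$ for all $x\in\Sigma$, $r>0$. $\mathcal{H}^d$ is $d$-dimensional Hausdorff measure normalized so that $\mathcal{H}^d(\mathbb{R}^d\cap B(0,1))=1$. For measures $\mu,\nu$ on $\mathbb{R}^n$ whose restrictions to $\mathbb{B}$ are probability measures, $\mathbb{W}_1(\mu,\nu)=\sup_\psi\left|\int\psi\,d\mu-\int\psi\,d\nu\right|$, the supremum over all $1$-Lipschitz $\psi:\mathbb{R}^n\to\mathbb{R}$ supported on $\mathbb{B}$ (vanishing outside $\mathbb{B}$). For $x\in\Sigma$, $r>0$, $\mu_{x,r}(A)=\mu(x+rA)/\mu(B(x,r))$ for Borel $A\subset\mathbb{R}^n$. $A'(d,n)$ is the set of $d$-dimensional affine planes of $\mathbb{R}^n$ meeting $B(0,1/2)$. For $V\in A'(d,n)$, $\nu_V=c_V\mathcal{H}^d|_V$ with $c_V=\mathcal{H}^d(V\cap\mathbb{B})^{-1}$. Then $\alpha_d(x,r)=\inf\{\mathbb{W}_1(\mu_{x,r},\nu_V):V\in A'(d,n)\}$ for $x\in\Sigma$, $r>0$. A $\gamma$-Lipschitz graph of dimension $d$ is a set $\{x+f(x):x\in V\}$, where $V$ is a $d$-dimensional vector subspace of $\mathbb{R}^n$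 and $f:V\to V^\perp$ is $\gamma$-Lipschitz. *)

theory Defs
  imports "HOL-Analysis.Analysis"
begin

text \<open>
  The dimension \<open>n\<close> has to be quantified inside the statement, because the constant found there
  depends on \<open>d\<close>, the doubling constant and \<open>\<gamma>\<close> only. So \<open>\<real>\<^sup>n\<close> cannot be a type
  such as \<open>real ^ 'n\<close>. Instead all the spaces \<open>\<real>\<^sup>n\<close> live in one inner product space, that of the
  finitely supported real sequences with the Euclidean inner product, and \<open>\<real>\<^sup>n\<close> is the subspace
  \<open>Rn n\<close> of the sequences that vanish from index \<open>n\<close> on. Lemma \<open>Rn_isometric_vec\<close> below
  identifies \<open>Rn CARD('n)\<close> with \<open>real ^ 'n\<close>.
  (The library type \<open>nat \<Rightarrow>\<^sub>0 real\<close> is no option: it carries the \<open>l\<^sup>1\<close> norm.)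
\<close>

typedef fin_seq = "{f :: nat \<Rightarrow> real. finite {i. f i \<noteq> 0}}"
  morphisms coord Abs_fin_seq
  by (rule exI[of _ "\<lambda>_. 0"]) simp

setup_lifting type_definition_fin_seq

lemma finite_coord [simp]: "finite {i. coord x i \<noteq> 0}"
  using coord[of x] by simp

lemma fin_seq_eqI: "(\<And>i. coord x i = coord y i) \<Longrightarrow> x = y"
  using coord_inject[of x y] by blast

instantiation fin_seq :: real_inner
begin

lift_definition zero_fin_seq :: fin_seq is "\<lambda>_. 0" by simp

lift_definition plus_fin_seq :: "fin_seq \<Rightarrow> fin_seq \<Rightarrow> fin_seq" is "\<lambda>x y i. x i + y i"
  subgoal for x y
    by (rule finite_subset[of _ "{i. x i \<noteq> 0} \<union> {i. y i \<noteq> 0}"]) auto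
  done

lift_definition minus_fin_seq :: "fin_seq \<Rightarrow> fin_seq \<Rightarrow> fin_seq" is "\<lambda>x y i. x i - y i"
  subgoal for x y
    by (rule finite_subset[of _ "{i. x i \<noteq> 0} \<union> {i. y i \<noteq> 0}"]) auto
  done

lift_definition uminus_fin_seq :: "fin_seq \<Rightarrow> fin_seq" is "\<lambda>x i. - x i" by simp

lift_definition scaleR_fin_seq :: "real \<Rightarrow> fin_seq \<Rightarrow> fin_seq" is "\<lambda>c x i. c * x i"
  subgoal for c x
    by (rule finite_subset[of _ "{i. x i \<noteq> 0}"]) auto
  done

definition inner_fin_seq :: "fin_seq \<Rightarrow> fin_seq \<Rightarrow> real" where
  "inner_fin_seq x y = (\<Sum>i | coord x i \<noteq> 0. coord x i * coord y i)"

definition norm_fin_seq :: "fin_seq \<Rightarrow> real" where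
  "norm_fin_seq x = sqrt (inner x x)"

definition dist_fin_seq :: "fin_seq \<Rightarrow> fin_seq \<Rightarrow> real" where
  "dist_fin_seq x y = norm (x - y)"

definition sgn_fin_seq :: "fin_seq \<Rightarrow> fin_seq" where
  "sgn_fin_seq x = scaleR (inverse (norm x)) x"

definition uniformity_fin_seq :: "(fin_seq \<times> fin_seq) filter" where
  "uniformity_fin_seq = (INF e\<in>{0 <..}. principal {(x, y). dist x y < e})"

definition open_fin_seq :: "fin_seq set \<Rightarrow> bool" where
  "open_fin_seq U \<longleftrightarrow> (\<forall>x\<in>U. eventually (\<lambda>(x', y). x' = x \<longrightarrow> y \<in> U) uniformity)"

lemmas coord_simps =
  zero_fin_seq.rep_eq plus_fin_seq.rep_eq minus_fin_seq.rep_eq uminus_fin_seq.rep_eq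
  scaleR_fin_seq.rep_eq

lemma inner_fin_seq_superset:
  assumes "finite I" "{i. coord x i \<noteq> 0} \<subseteq> I"
  shows "inner x y = (\<Sum>i\<in>I. coord x i * coord y i)"
  unfolding inner_fin_seq_def by (rule sum.mono_neutral_left) (use assms in auto)

instance
proof
  fix x y z :: fin_seq and a b :: real
  let ?S = "\<lambda>x. {i. coord x i \<noteq> 0}"
  let ?I = "?S x \<union> ?S y"
  show "x + y + z = x + (y + z)" "x + y = y + x" "0 + x = x" "- x + x = 0" "x - y = x + - y"
    "a *\<^sub>R (x + y) = a *\<^sub>R x + a *\<^sub>R y" "(a + b) *\<^sub>R x = a *\<^sub>R x + b *\<^sub>R x"
    "a *\<^sub>R b *\<^sub>R x = (a * b) *\<^sub>R x" "1 *\<^sub>R x = x"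
    by (auto intro!: fin_seq_eqI simp: coord_simps algebra_simps)
  have fin: "finite ?I" by simp
  show "inner x y = inner y x"
    using inner_fin_seq_superset[OF fin, of x y] inner_fin_seq_superset[OF fin, of y x]
    by (simp add: mult.commute)
  have "inner (x + y) z = (\<Sum>i\<in>?I. coord (x + y) i * coord z i)"
    by (rule inner_fin_seq_superset[OF fin]) (auto simp: coord_simps)
  also have "\<dots> = inner x z + inner y z"
    using inner_fin_seq_superset[OF fin, of x z] inner_fin_seq_superset[OF fin, of y z]
    by (simp add: coord_simps distrib_right sum.distrib)
  finally show "inner (x + y) z = inner x z + inner y z" .
  have "inner (a *\<^sub>R x) y = (\<Sum>i\<in>?S x. coord (a *\<^sub>R x) i * coord y i)"
    by (rule inner_fin_seq_superset) (auto simp: coord_simps)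
  then show "inner (a *\<^sub>R x) y = a * inner x y"
    by (simp add: inner_fin_seq_def coord_simps sum_distrib_left mult.assoc)
  show "0 \<le> inner x x"
    by (simp add: inner_fin_seq_def sum_nonneg)
  have "inner x x = 0 \<longleftrightarrow> (\<forall>i\<in>?S x. coord x i * coord x i = 0)"
    unfolding inner_fin_seq_def by (rule sum_nonneg_eq_0_iff) auto
  also have "\<dots> \<longleftrightarrow> x = 0"
    by (auto intro: fin_seq_eqI simp: coord_simps)
  finally show "inner x x = 0 \<longleftrightarrow> x = 0" .
qed (fact norm_fin_seq_def dist_fin_seq_def sgn_fin_seq_def uniformity_fin_seq_def
      open_fin_seq_def)+

end

definition Rn :: "nat \<Rightarrow> fin_seq set" where
  "Rn n = {x. \<forall>i\<ge>n. coord x i = 0}"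

definition Rn_ball :: "nat \<Rightarrow> fin_seq \<Rightarrow> real \<Rightarrow> fin_seq set" where
  "Rn_ball n x r = ball x r \<inter> Rn n"

lemma subspace_Rn: "subspace (Rn n)"
  by (auto simp: subspace_def Rn_def coord_simps)

lemma norm_Rn: "x \<in> Rn n \<Longrightarrow> norm x = sqrt (\<Sum>i<n. (coord x i)\<^sup>2)"
  unfolding norm_fin_seq_def
  by (subst inner_fin_seq_superset[of "{..<n}"])
    (auto simp: Rn_def power2_eq_square intro: leI)

lemma Rn_isometric_vec:
  "\<exists>f :: real ^ 'n \<Rightarrow> fin_seq.
     linear f \<and> (\<forall>x. norm (f x) = norm x) \<and> bij_betw f UNIV (Rn CARD('n))"
proof -
  let ?N = "CARD('n)"
  obtain h :: "'n \<Rightarrow> nat" where h: "bij_betw h UNIV {..<?N}"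
    using ex_bij_betw_finite_nat[of "UNIV :: 'n set"] by (auto simp: atLeast0LessThan)
  define g where "g = inv_into UNIV h"
  have g: "bij_betw g {..<?N} UNIV"
    unfolding g_def by (rule bij_betw_inv_into[OF h])
  have gh: "g (h j) = j" for j
    unfolding g_def using h by (simp add: bij_betw_def)
  have hN: "h j < ?N" for j
    using h by (auto simp: bij_betw_def)
  have hg: "h (g i) = i" if "i < ?N" for i
    unfolding g_def using h that by (simp add: bij_betw_def f_inv_into_f)
  define f :: "real ^ 'n \<Rightarrow> fin_seq"
    where "f x = Abs_fin_seq (\<lambda>i. if i < ?N then x $ g i else 0)" for x
  have "finite {i. (if i < ?N then x $ g i else 0) \<noteq> 0}" for x :: "real ^ 'n"
    by (rule finite_subset[of _ "{..<?N}"]) auto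
  then have cf: "coord (f x) i = (if i < ?N then x $ g i else 0)" for x i
    by (simp add: f_def Abs_fin_seq_inverse)
  have fR: "f x \<in> Rn ?N" for x
    by (simp add: Rn_def cf)
  have lin: "linear f"
    by (rule linearI) (auto intro!: fin_seq_eqI simp: cf coord_simps)
  have "norm (f x) = norm x" for x
  proof -
    have "(\<Sum>i<?N. (coord (f x) i)\<^sup>2) = (\<Sum>i<?N. (x $ g i)\<^sup>2)"
      by (simp add: cf)
    also have "\<dots> = (\<Sum>j\<in>UNIV. (x $ j)\<^sup>2)"
      by (rule sum.reindex_bij_betw[OF g])
    finally show ?thesis
      by (simp add: norm_Rn[OF fR] norm_vec_def L2_set_def)
  qed
  moreover have "bij_betw f UNIV (Rn ?N)"
  proof (rule bij_betwI[where g = "\<lambda>y. \<chi> j. coord y (h j)"])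
    show "f (\<chi> j. coord y (h j)) = y" if "y \<in> Rn ?N" for y
      using that by (auto intro!: fin_seq_eqI simp: cf hg Rn_def)
  qed (auto simp: fR vec_eq_iff cf hN gh)
  ultimately show ?thesis using lin by blast
qed

definition radon_measure :: "nat \<Rightarrow> fin_seq measure \<Rightarrow> bool" where
  "radon_measure n \<mu> \<longleftrightarrow>
     space \<mu> = Rn n \<and> sets \<mu> = sets (restrict_space borel (Rn n)) \<and>
     (\<forall>x\<in>Rn n. \<exists>r>0. emeasure \<mu> (Rn_ball n x r) < \<infinity>)"

definition msupport :: "nat \<Rightarrow> fin_seq measure \<Rightarrow> fin_seq set" where
  "msupport n \<mu> = {x \<in> Rn n. \<forall>r>0. emeasure \<mu> (Rn_ball n x r) > 0}"

definition doubling :: "nat \<Rightarrow> real \<Rightarrow> fin_seq measure \<Rightarrow> bool" where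
  "doubling n C \<mu> \<longleftrightarrow>
     (\<forall>x\<in>msupport n \<mu>. \<forall>r>0.
        emeasure \<mu> (Rn_ball n x (2 * r)) \<le> ennreal C * emeasure \<mu> (Rn_ball n x r))"

definition hausdorff_delta :: "real \<Rightarrow> nat \<Rightarrow> fin_seq set \<Rightarrow> ennreal" where
  "hausdorff_delta \<delta> d A =
     (INF U \<in> {U :: nat \<Rightarrow> fin_seq set.
                 A \<subseteq> (\<Union>i. U i) \<and> (\<forall>i. bounded (U i) \<and> diameter (U i) \<le> \<delta>)}.
        \<Sum>i. ennreal (diameter (U i) ^ d))"

definition hausdorff_unnormalized :: "nat \<Rightarrow> fin_seq set \<Rightarrow> ennreal" where
  "hausdorff_unnormalized d A = (SUP \<delta>\<in>{0<..}. hausdorff_delta \<delta> d A)"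

text \<open>
  Normalized so that the unit ball of \<open>\<real>\<^sup>d\<close> has measure 1. Only used for \<open>d \<ge> 1\<close>
  (for \<open>d = 0\<close> the convention \<open>0 ^ 0 = 1\<close> would count empty covering sets).
\<close>
definition hausdorff :: "nat \<Rightarrow> fin_seq set \<Rightarrow> ennreal" where
  "hausdorff d A = hausdorff_unnormalized d A / hausdorff_unnormalized d (Rn_ball d 0 1)"

text \<open>
  \<open>W1\<close> is the supremum over test functions that are 1-Lipschitz on \<open>\<real>\<^sup>n\<close>
  and vanish on \<open>\<real>\<^sup>n\<close> outside the unit ball; the values of \<open>\<psi>\<close> off \<open>Rn n\<close> play no role.
\<close>
definition W1 :: "nat \<Rightarrow> fin_seq measure \<Rightarrow> fin_seq measure \<Rightarrow> ennreal" where
  "W1 n \<mu> \<nu> =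
     (SUP \<psi> \<in> {\<psi> :: fin_seq \<Rightarrow> real.
                 1-lipschitz_on (Rn n) \<psi> \<and> (\<forall>x \<in> Rn n - Rn_ball n 0 1. \<psi> x = 0)}.
        ennreal \<bar>(\<integral>x. \<psi> x \<partial>\<mu>) - (\<integral>x. \<psi> x \<partial>\<nu>)\<bar>)"

text \<open>\<open>\<mu>\<^bsub>x,r\<^esub>(A) = \<mu>(x + r A) / \<mu>(B(x,r))\<close>: the set \<open>x + r A\<close> is the preimage of \<open>A\<close>
  under \<open>y \<mapsto> (y - x) / r\<close>.\<close>
definition rescaled :: "nat \<Rightarrow> fin_seq measure \<Rightarrow> fin_seq \<Rightarrow> real \<Rightarrow> fin_seq measure" where
  "rescaled n \<mu> x r =
     scale_measure (inverse (emeasure \<mu> (Rn_ball n x r))) (distr \<mu> \<mu> (\<lambda>y. (y - x) /\<^sub>R r))"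

lemma emeasure_rescaled:
  assumes "radon_measure n \<mu>" "x \<in> Rn n" "r > 0" "A \<in> sets \<mu>"
  shows "emeasure (rescaled n \<mu> x r) A =
           emeasure \<mu> ((\<lambda>a. x + r *\<^sub>R a) ` A) / emeasure \<mu> (Rn_ball n x r)"
proof -
  have sp: "space \<mu> = Rn n" and st: "sets \<mu> = sets (restrict_space borel (Rn n))"
    using assms(1) by (auto simp: radon_measure_def)
  have A: "A \<subseteq> Rn n"
    using sets.sets_into_space[OF assms(4)] sp by simp
  have inR: "(y - x) /\<^sub>R r \<in> Rn n" if "y \<in> Rn n" for y
    using that assms(2) by (auto simp: Rn_def coord_simps)
  have "continuous_on (Rn n) (\<lambda>y. (y - x) /\<^sub>R r)"
    by (intro continuous_intros)
  then have "(\<lambda>y. (y - x) /\<^sub>R r) \<in> restrict_space borel (Rn n) \<rightarrow>\<^sub>M restrict_space borel (Rn n)"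
    by (intro measurable_restrict_space2 borel_measurable_continuous_on_restrict)
      (auto simp: inR space_restrict_space)
  then have meas: "(\<lambda>y. (y - x) /\<^sub>R r) \<in> \<mu> \<rightarrow>\<^sub>M \<mu>"
    using measurable_cong_sets[OF st st] by blast
  have inR': "x + r *\<^sub>R a \<in> Rn n" if "a \<in> A" for a
    using that A assms(2) by (auto simp: Rn_def coord_simps)
  have "(\<lambda>y. (y - x) /\<^sub>R r) -` A \<inter> space \<mu> = (\<lambda>a. x + r *\<^sub>R a) ` A"
  proof (intro set_eqI iffI)
    fix y assume y: "y \<in> (\<lambda>y. (y - x) /\<^sub>R r) -` A \<inter> space \<mu>"
    have "y = x + r *\<^sub>R ((y - x) /\<^sub>R r)" using assms(3) by simp
    then show "y \<in> (\<lambda>a. x + r *\<^sub>R a) ` A" using y by blast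
  qed (use assms(3) sp inR' in auto)
  then show ?thesis
    using meas assms(4)
    by (simp add: rescaled_def emeasure_distr divide_ennreal_def mult.commute)
qed

text \<open>The set \<open>A'(d,n)\<close>.\<close>
definition planes :: "nat \<Rightarrow> nat \<Rightarrow> fin_seq set set" where
  "planes d n =
     {V. (\<exists>a W. subspace W \<and> dim W = d \<and> V = (+) a ` W) \<and>
         V \<subseteq> Rn n \<and> V \<inter> Rn_ball n 0 (1/2) \<noteq> {}}"

text \<open>\<open>\<nu>\<^sub>V = c\<^sub>V H\<^sup>d|\<^sub>V\<close>. Since \<open>H\<^sup>d\<close> is countably additive on Borel sets,
  \<open>measure_of\<close> does not fall back to the zero measure here.\<close>
definition plane_measure :: "nat \<Rightarrow> nat \<Rightarrow> fin_seq set \<Rightarrow> fin_seq measure" where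
  "plane_measure d n V =
     scale_measure (inverse (hausdorff d (V \<inter> Rn_ball n 0 1)))
       (measure_of (Rn n) (sets (restrict_space borel (Rn n))) (\<lambda>A. hausdorff d (A \<inter> V)))"

definition alpha :: "nat \<Rightarrow> nat \<Rightarrow> fin_seq measure \<Rightarrow> fin_seq \<Rightarrow> real \<Rightarrow> ennreal" where
  "alpha d n \<mu> x r = (INF V \<in> planes d n. W1 n (rescaled n \<mu> x r) (plane_measure d n V))"

definition lipschitz_graph :: "nat \<Rightarrow> nat \<Rightarrow> real \<Rightarrow> fin_seq set \<Rightarrow> bool" where
  "lipschitz_graph d n \<gamma> G \<longleftrightarrow>
     (\<exists>V f. subspace V \<and> V \<subseteq> Rn n \<and> dim V = d \<and>
            f ` V \<subseteq> V\<^sup>\<bottom> \<inter> Rn n \<and> \<gamma>-lipschitz_on V f \<and> G = (\<lambda>x. x + f x) ` V)"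

end

theory Submission
  imports Defs
begin

text \<open>
  The set \<open>A\<close> consists of the support points \<open>y\<close> of the ball for which the sum over dyadic scales of
  the coefficients is small; by Chebyshev's inequality it misses little mass. At such a point the
  measure is close, on each \<open>B(y, 2\<^sup>-\<^sup>k r)\<close>, to a flat measure \<open>c\<^sub>k H\<^sup>d\<close> on a plane \<open>P\<^sub>k\<close>. Two flat measures
  that are close when tested against Lipschitz functions have planes and densities which are close
  to first order in the error, so the changes from one scale to the next are summable: all \<open>P\<^sub>k\<close>
  are almost parallel to one plane, and all \<open>c\<^sub>k\<close> are almost equal to the density of the ball. The
  first fact places \<open>A\<close> in the graph of a map with small Lipschitz constant over part of a plane.
  The extension to the whole plane uses Kirszbraun's theorem, since a coordinatewise
  extension would cost a factor depending on \<open>n\<close>. The second fact makes the densities of \<open>\<mu>\<close>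
  and of \<open>H\<^sup>d\<close> on the graph nearly proportional at small scales around points of \<open>A\<close>, and a Vitali covering
  argument turns this into the comparison of both measures on subsets of \<open>A\<close>.
\<close>

text \<open>All points of \<open>A\<close> have to be compared with one plane and one density. Both
  come from a single ball centred near \<open>x\<close> with radius between \<open>3 * r / 2\<close>
  and \<open>2 * r\<close>. It contains every \<open>B(y, r / 4)\<close> with \<open>y\<close> in
  \<open>B(x, r)\<close>, and its flat measure is the element of index 0 in the chain of every good
  point; this is where the scales above \<open>r\<close> of the hypothesis enter. The constant must
  not depend on \<open>n\<close>. So coverings rely on doubling at support points, and flat measures
  are compared inside \<open>d\<close>-planes, where a centred ball of radius \<open>s\<close> has
  measure exactly \<open>s ^ d\<close>. Lipschitz tests do not see sharp balls: cutting off over a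
  layer of relative width \<delta> costs a factor 1/\<delta>, which is why errors have to be small
  compared with the square of \<delta>. The constants are chosen in the order \<delta> (relative
  error of slopes and densities), \<open>E\<close> (bound for the summed errors of a chain),
  \<epsilon> (threshold that defines good points), and last \<open>C1\<close>.\<close>

section \<open>Regularity and Vitali covering in metric spaces\<close>

text \<open>Sets squeezed between a closed and an open set of nearly equal measure form a
  \<sigma>-algebra that contains the closed sets, since a closed set is the intersection of its
  metric neighbourhoods. The closed approximation is carried along because complements exchange the
  two.\<close>

lemma outer_regular_finite_borel:
  fixes M :: "'a::metric_space measure"
  assumes sets: "sets M = sets borel" and fin: "emeasure M UNIV < \<infinity>"
    and Z: "Z \<in> sets borel" and e: "(e::real) > 0"
  shows "\<exists>U. open U \<and> Z \<subseteq> U \<and> emeasure M U \<le> emeasure M Z + ennreal e"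
proof -
  have sp: "space M = UNIV"
    using sets_eq_imp_space_eq[OF sets] by simp
  interpret finite_measure M
    by (rule finite_measureI) (use fin sp in auto)
  define R where "R = (\<lambda>A. A \<in> sets borel \<and> (\<forall>e>0. \<exists>F U. closed F \<and> open U \<and> F \<subseteq> A \<and> A \<subseteq> U
       \<and> measure M (U - F) < e))"
  have RD: "\<exists>F U. closed F \<and> open U \<and> F \<subseteq> A \<and> A \<subseteq> U \<and> measure M (U - F) < e"
    if "R A" "e > 0" for A e
    using that unfolding R_def by blast
  have RB: "A \<in> sets borel" if "R A" for A
    using that unfolding R_def by blast
  have RC: "R C" if C: "closed C" for C
    unfolding R_def
  proof (intro conjI allI impI)
    show "C \<in> sets borel" using C by simp
    fix e :: real assume "e > 0"
    show "\<exists>F U. closed F \<and> open U \<and> F \<subseteq> C \<and> C \<subseteq> U \<and> measure M (U - F) < e"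
    proof (cases "C = {}")
      case True
      then show ?thesis using \<open>e > 0\<close> by (intro exI[of _ "{}"]) auto
    next
      case False
      define U where "U k = {x. infdist x C < 1 / real (Suc k)}" for k
      have oU: "open (U k)" for k
        unfolding U_def by (intro open_Collect_less continuous_intros)
      have CU: "C \<subseteq> U k" for k
        by (auto simp: U_def)
      have dec: "decseq (\<lambda>k. U k - C)"
      proof (rule decseq_SucI)
        fix k
        have "1 / real (Suc (Suc k)) \<le> 1 / real (Suc k)" by (simp add: frac_le)
        then show "U (Suc k) - C \<subseteq> U k - C" by (auto simp: U_def)
      qed
      have "(\<Inter>k. U k - C) = {}"
      proof (rule ccontr)
        assume "(\<Inter>k. U k - C) \<noteq> {}"
        then obtain x where x: "\<And>k. infdist x C < 1 / real (Suc k)" "x \<notin> C"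
          by (auto simp: U_def)
        have "infdist x C \<le> 0"
        proof (rule field_le_epsilon)
          fix e :: real assume "0 < e"
          then obtain k where "1 / real (Suc k) < e" using nat_approx_posE by blast
          then show "infdist x C \<le> 0 + e" using x(1)[of k] by simp
        qed
        then have "x \<in> C"
          using C False infdist_nonneg[of x C] by (simp add: in_closed_iff_infdist_zero)
        then show False using x by simp
      qed
      moreover have "(\<lambda>k. measure M (U k - C)) \<longlonglongrightarrow> measure M (\<Inter>k. U k - C)"
        by (rule finite_Lim_measure_decseq[OF _ dec]) (use sets oU C in auto)
      ultimately have "(\<lambda>k. measure M (U k - C)) \<longlonglongrightarrow> 0" by (simp only: measure_empty)
      then have "eventually (\<lambda>k. measure M (U k - C) < e) sequentially"
        using \<open>e > 0\<close> by (rule order_tendstoD)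
      then obtain k where "measure M (U k - C) < e"
        by (auto simp: eventually_sequentially)
      then show ?thesis using C oU CU by blast
    qed
  qed
  have RZ: "R Z"
  proof -
    have "Z \<in> sigma_sets UNIV {C. closed C}"
      using Z by (simp add: borel_eq_closed)
    then show ?thesis
    proof induction
      case (Compl A)
      show ?case unfolding R_def
      proof (intro conjI allI impI)
        show "UNIV - A \<in> sets borel" using RB[OF Compl(2)] by auto
        fix e :: real assume "e > 0"
        obtain F U where FU: "closed F" "open U" "F \<subseteq> A" "A \<subseteq> U" "measure M (U - F) < e"
          using RD[OF Compl(2) \<open>e > 0\<close>] by blast
        have "- F - - U = U - F" by blast
        then have "measure M (- F - - U) < e" using FU(5) by (simp only:)
        moreover have "closed (- U)" "open (- F)" using FU by (simp_all add: open_closed)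
        moreover have "- U \<subseteq> UNIV - A" "UNIV - A \<subseteq> - F" using FU by blast+
        ultimately show "\<exists>F U. closed F \<and> open U \<and> F \<subseteq> UNIV - A \<and> UNIV - A \<subseteq> U \<and> measure M (U - F) < e"
          by blast
      qed
    next
      case (Union A)
      show ?case unfolding R_def
      proof (intro conjI allI impI)
        show "(\<Union>i. A i) \<in> sets borel" using RB[OF Union(2)] by auto
        fix e :: real assume "e > 0"
        have "\<exists>F U. closed F \<and> open U \<and> F \<subseteq> A i \<and> A i \<subseteq> U \<and> measure M (U - F) < (e / 2) * (1/2) ^ Suc i" for i
        proof -
          have pos: "(e / 2) * (1/2) ^ Suc i > 0" using \<open>e > 0\<close> by simp
          then show ?thesis using RD[OF Union(2)[of i] pos] by blast
        qed
        then obtain F U where FU: "\<And>i. closed (F i)" "\<And>i. open (U i)" "\<And>i. F i \<subseteq> A i" "\<And>i. A i \<subseteq> U i"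
          "\<And>i. measure M (U i - F i) < (e / 2) * (1/2) ^ Suc i"
          by metis
        \<comment> \<open>The union of all \<open>F i\<close> need not be closed, so only finitely
          many are kept. The errors were given the budget \<open>e / 2\<close>, which leaves room
          for this truncation by continuity from above.\<close>
        let ?F = "\<lambda>n. \<Union>i\<le>n. F i"
        let ?U = "\<Union>i. U i"
        have sF: "F i \<in> sets M" "U i \<in> sets M" for i using FU sets by auto
        have s: "(\<lambda>i. (e / 2) * (1/2) ^ Suc i) sums (e / 2 * 1)"
          by (intro sums_mult power_half_series)
        have sm: "summable (\<lambda>i. measure M (U i - F i))"
          by (rule summable_comparison_test[OF _ sums_summable[OF s]])
            (use less_imp_le[OF FU(5)] in \<open>auto intro!: exI[of _ 0]\<close>)
        have "measure M (\<Union>i. U i - F i) \<le> (\<Sum>i. measure M (U i - F i))"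
          by (rule finite_measure_subadditive_countably) (use sF sm in auto)
        also have "\<dots> \<le> (\<Sum>i. (e / 2) * (1/2) ^ Suc i)"
          by (rule suminf_le[OF _ sm sums_summable[OF s]]) (use less_imp_le[OF FU(5)] in blast)
        also have "\<dots> = e / 2" using sums_unique[OF s] by simp
        finally have 1: "measure M (\<Union>i. U i - F i) \<le> e / 2" .
        have "measure M (?U - (\<Union>i. F i)) \<le> measure M (\<Union>i. U i - F i)"
          by (rule finite_measure_mono) (use sF in auto)
        with 1 have 2: "measure M (?U - (\<Union>i. F i)) < e" using \<open>e > 0\<close> by linarith
        have "(\<lambda>n. measure M (?U - ?F n)) \<longlonglongrightarrow> measure M (\<Inter>n. ?U - ?F n)"
        proof (rule finite_Lim_measure_decseq)
          show "decseq (\<lambda>n. ?U - ?F n)"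
            by (intro decseq_SucI) (auto simp: atMost_Suc)
        qed (use sF in auto)
        moreover have "(\<Inter>n. ?U - ?F n) = ?U - (\<Union>i. F i)" by auto
        ultimately have "(\<lambda>n. measure M (?U - ?F n)) \<longlonglongrightarrow> measure M (?U - (\<Union>i. F i))" by (simp only:)
        from order_tendstoD(2)[OF this 2] obtain n where "measure M (?U - ?F n) < e"
          by (auto simp: eventually_sequentially)
        moreover have "closed (?F n)" "open ?U" using FU by auto
        moreover have "?F n \<subseteq> (\<Union>i. A i)" using FU(3) by blast
        moreover have "(\<Union>i. A i) \<subseteq> ?U" using FU(4) by blast
        ultimately show "\<exists>F U. closed F \<and> open U \<and> F \<subseteq> (\<Union>i. A i) \<and> (\<Union>i. A i) \<subseteq> U \<and> measure M (U - F) < e"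
          by blast
      qed
    next
      case (Basic C) then show ?case using RC by blast
    next
      case Empty then show ?case using RC by blast
    qed
  qed
  then obtain F U where FU: "closed F" "open U" "F \<subseteq> Z" "Z \<subseteq> U" "measure M (U - F) < e"
    using RD[OF RZ e] by blast
  have s: "U \<in> sets M" "F \<in> sets M" "Z \<in> sets M" using FU Z sets by auto
  have "measure M U \<le> measure M (Z \<union> (U - F))"
    by (rule finite_measure_mono) (use s FU(3) in auto)
  also have "\<dots> \<le> measure M Z + measure M (U - F)"
    by (rule measure_Un_le) (use s in auto)
  finally have "measure M U \<le> measure M Z + e" using FU by simp
  then have "emeasure M U \<le> emeasure M Z + ennreal e"
    using e by (simp add: emeasure_eq_measure flip: ennreal_plus)
  then show ?thesis using FU by blast
qed

text \<open>\<open>\<F>\<close> collects the disjoint subfamilies for which every ball of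
  \<open>I\<close> that meets a member also meets one at least half as large. This passes to unions
  of chains. A maximal family meets every ball of \<open>I\<close>: otherwise it could be enlarged
  by a ball disjoint from it whose radius exceeds half the supremum of such radii. The usual
  inclusion in a fivefold ball is left in this raw form because later only centres of balls have to
  be covered, for which the factor 3 suffices.\<close>

lemma Vitali_5r_covering:
  fixes I :: "('a::metric_space \<times> real) set"
  assumes pos: "\<And>y t. (y, t) \<in> I \<Longrightarrow> 0 < t" and bdd: "\<And>y t. (y, t) \<in> I \<Longrightarrow> t \<le> R"
  shows "\<exists>D\<subseteq>I. pairwise (\<lambda>p q. cball (fst p) (snd p) \<inter> cball (fst q) (snd q) = {}) D \<and>
     (\<forall>p\<in>I. \<exists>q\<in>D. cball (fst p) (snd p) \<inter> cball (fst q) (snd q) \<noteq> {} \<and> snd p \<le> 2 * snd q)"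
proof -
  let ?B = "\<lambda>p. cball (fst p) (snd p)"
  define \<F> where "\<F> = {D. D \<subseteq> I \<and> pairwise (\<lambda>p q. ?B p \<inter> ?B q = {}) D \<and>
     (\<forall>p\<in>I. (\<exists>q\<in>D. ?B p \<inter> ?B q \<noteq> {}) \<longrightarrow> (\<exists>q\<in>D. ?B p \<inter> ?B q \<noteq> {} \<and> snd p \<le> 2 * snd q))}"
  have \<F>1: "D \<subseteq> I" if "D \<in> \<F>" for D
    using that unfolding \<F>_def by blast
  have \<F>2: "?B p \<inter> ?B q = {}" if "D \<in> \<F>" "p \<in> D" "q \<in> D" "p \<noteq> q" for D p q
    using that unfolding \<F>_def pairwise_def by blast
  have \<F>3: "\<exists>q\<in>D. ?B p \<inter> ?B q \<noteq> {} \<and> snd p \<le> 2 * snd q"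
    if "D \<in> \<F>" "p \<in> I" "q \<in> D" "?B p \<inter> ?B q \<noteq> {}" for D p q
    using that unfolding \<F>_def by blast
  have \<F>I: "D \<in> \<F>" if "D \<subseteq> I" "\<And>p q. p \<in> D \<Longrightarrow> q \<in> D \<Longrightarrow> p \<noteq> q \<Longrightarrow> ?B p \<inter> ?B q = {}"
    "\<And>p q. p \<in> I \<Longrightarrow> q \<in> D \<Longrightarrow> ?B p \<inter> ?B q \<noteq> {} \<Longrightarrow> \<exists>q\<in>D. ?B p \<inter> ?B q \<noteq> {} \<and> snd p \<le> 2 * snd q"
    for D
    using that unfolding \<F>_def pairwise_def mem_Collect_eq by blast
  have "\<exists>D\<in>\<F>. \<forall>X\<in>\<F>. D \<subseteq> X \<longrightarrow> X = D"
  proof (rule subset_Zorn')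
    fix C assume C: "subset.chain \<F> C"
    then have CF: "C \<subseteq> \<F>" and ch: "\<And>X Y. X \<in> C \<Longrightarrow> Y \<in> C \<Longrightarrow> X \<subseteq> Y \<or> Y \<subseteq> X"
      by (auto simp: subset.chain_def)
    show "\<Union>C \<in> \<F>"
    proof (rule \<F>I)
      show "\<Union>C \<subseteq> I" using CF \<F>1 by blast
      show "?B p \<inter> ?B q = {}" if pq: "p \<in> \<Union>C" "q \<in> \<Union>C" "p \<noteq> q" for p q
      proof -
        from pq obtain X where "X \<in> C" "p \<in> X" "q \<in> X" using ch by blast
        then show ?thesis using CF pq(3) \<F>2[of X p q] by blast
      qed
      fix p q assume pq: "p \<in> I" "q \<in> \<Union>C" "?B p \<inter> ?B q \<noteq> {}"
      then obtain X where X: "X \<in> C" "q \<in> X" by blast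
      then have "\<exists>q\<in>X. ?B p \<inter> ?B q \<noteq> {} \<and> snd p \<le> 2 * snd q"
        using CF pq \<F>3[of X p q] by blast
      then show "\<exists>q\<in>\<Union>C. ?B p \<inter> ?B q \<noteq> {} \<and> snd p \<le> 2 * snd q" using X by blast
    qed
  qed
  then obtain D where D: "D \<in> \<F>" and max: "\<And>X. X \<in> \<F> \<Longrightarrow> D \<subseteq> X \<Longrightarrow> X = D" by blast
  have meets: "\<exists>q\<in>D. ?B p \<inter> ?B q \<noteq> {}" if "p \<in> I" for p
  proof (rule ccontr)
    define J where "J = {p \<in> I. \<forall>q\<in>D. ?B p \<inter> ?B q = {}}"
    assume "\<not> (\<exists>q\<in>D. ?B p \<inter> ?B q \<noteq> {})"
    then have pJ: "p \<in> J" using that by (auto simp: J_def)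
    have bd: "bdd_above (snd ` J)" by (rule bdd_aboveI2[of _ _ R]) (use bdd in \<open>auto simp: J_def\<close>)
    define s where "s = (SUP p\<in>J. snd p)"
    have "snd p \<le> s" unfolding s_def by (rule cSUP_upper[OF pJ bd])
    moreover have "snd p > 0" using pos[of "fst p" "snd p"] that by simp
    ultimately have "s / 2 < s" by simp
    then obtain p' where p': "p' \<in> J" "s / 2 < snd p'"
      unfolding s_def by (subst (asm) less_cSUP_iff[OF _ bd]) (use pJ in auto)
    have le: "snd q \<le> 2 * snd p'" if "q \<in> J" for q
      using cSUP_upper[OF that bd] p'(2) unfolding s_def by simp
    have "insert p' D \<in> \<F>"
    proof (rule \<F>I)
      show "insert p' D \<subseteq> I" using \<F>1[OF D] p' by (auto simp: J_def)
      show "?B p \<inter> ?B q = {}" if pq: "p \<in> insert p' D" "q \<in> insert p' D" "p \<noteq> q" for p q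
      proof (cases "p = p' \<or> q = p'")
        case True
        with p' pq show ?thesis unfolding J_def by blast
      next
        case False
        with pq \<F>2[OF D, of p q] show ?thesis by blast
      qed
      fix q u assume q: "q \<in> I" "u \<in> insert p' D" "?B q \<inter> ?B u \<noteq> {}"
      show "\<exists>u\<in>insert p' D. ?B q \<inter> ?B u \<noteq> {} \<and> snd q \<le> 2 * snd u"
      proof (cases "\<exists>u\<in>D. ?B q \<inter> ?B u \<noteq> {}")
        case True
        then have "\<exists>u\<in>D. ?B q \<inter> ?B u \<noteq> {} \<and> snd q \<le> 2 * snd u"
          using \<F>3[OF D q(1)] by blast
        then show ?thesis by blast
      next
        case False
        then have "q \<in> J" "u = p'" using q by (auto simp: J_def)
        then show ?thesis using le q by blast
      qed
    qed
    then have "p' \<in> D" using max by blast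
    moreover have "?B p' \<noteq> {}" using p'(1) pos[of "fst p'" "snd p'"] by (auto simp: J_def)
    ultimately show False using p'(1) unfolding J_def by blast
  qed
  show ?thesis
  proof (intro exI[of _ D] conjI ballI)
    show "D \<subseteq> I" by (rule \<F>1[OF D])
    show "pairwise (\<lambda>p q. ?B p \<inter> ?B q = {}) D" using \<F>2[OF D] by (simp add: pairwise_def)
    fix p assume "p \<in> I"
    then show "\<exists>q\<in>D. ?B p \<inter> ?B q \<noteq> {} \<and> snd p \<le> 2 * snd q"
      using meets \<F>3[OF D] by blast
  qed
qed


text \<open>Disjoint balls inside an open set \<open>U\<close> that is hardly larger than
  \<open>Z\<close> for \<open>N\<close> allow the comparison to be summed. What they miss of
  \<open>Z\<close> lies in the threefold enlargements of a tail of the family, and \<Lambda> bounds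
  their \<open>M\<close>-measure by the tail of a convergent series. Doubling at centres in
  \<open>Z\<close> thus replaces a Besicovitch covering, whose constant would involve the dimension
  \<open>n\<close>.\<close>

lemma measure_le_of_cball_measure_le:
  fixes M N :: "'a::{metric_space,second_countable_topology} measure"
  assumes sM: "sets M = sets borel" and sN: "sets N = sets borel"
    and fM: "emeasure M UNIV < \<infinity>" and fN: "emeasure N UNIV < \<infinity>"
    and Z: "Z \<in> sets borel" and t0: "(t0::real) > 0" and \<kappa>: "\<kappa> \<ge> 0"
    and le: "\<And>y t. y \<in> Z \<Longrightarrow> 0 < t \<Longrightarrow> t < t0 \<Longrightarrow> measure M (cball y t) \<le> \<kappa> * measure N (cball y t)"
    and dbl: "\<And>y t. y \<in> Z \<Longrightarrow> 0 < t \<Longrightarrow> t < t0 \<Longrightarrow> measure M (cball y (3 * t)) \<le> \<Lambda> * measure M (cball y t)"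
  shows "measure M Z \<le> \<kappa> * measure N Z"
proof -
  have sp: "space M = UNIV" "space N = UNIV"
    using sets_eq_imp_space_eq[OF sM] sets_eq_imp_space_eq[OF sN] by simp_all
  interpret M: finite_measure M by (rule finite_measureI) (use fM sp in auto)
  interpret N: finite_measure N by (rule finite_measureI) (use fN sp in auto)
  have key: "measure M Z \<le> \<kappa> * (measure N Z + e) + \<bar>\<Lambda>\<bar> * e" if e: "e > 0" for e
  proof -
    obtain U where U: "open U" "Z \<subseteq> U" "emeasure N U \<le> emeasure N Z + ennreal e"
      using outer_regular_finite_borel[OF sN fN Z e] by blast
    have NU: "measure N U \<le> measure N Z + e"
      using U(3) e by (simp add: N.emeasure_eq_measure flip: ennreal_plus)
    define I where "I = {(y, t). y \<in> Z \<and> 0 < t \<and> t < t0 \<and> cball y t \<subseteq> U}"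
    have "\<exists>D\<subseteq>I. pairwise (\<lambda>p q. cball (fst p) (snd p) \<inter> cball (fst q) (snd q) = {}) D \<and>
     (\<forall>p\<in>I. \<exists>q\<in>D. cball (fst p) (snd p) \<inter> cball (fst q) (snd q) \<noteq> {} \<and> snd p \<le> 2 * snd q)"
      by (rule Vitali_5r_covering[of I t0]) (auto simp: I_def)
    then obtain D where DI: "D \<subseteq> I"
      and Dd: "pairwise (\<lambda>p q. cball (fst p) (snd p) \<inter> cball (fst q) (snd q) = {}) D"
      and Dm: "\<And>p. p \<in> I \<Longrightarrow> \<exists>q\<in>D. cball (fst p) (snd p) \<inter> cball (fst q) (snd q) \<noteq> {} \<and> snd p \<le> 2 * snd q"
      by blast
    have Dp: "fst p \<in> Z" "0 < snd p" "snd p < t0" "cball (fst p) (snd p) \<subseteq> U" if "p \<in> D" for p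
      using subsetD[OF DI that] by (simp_all add: I_def case_prod_unfold)
    have "inj_on (\<lambda>p. ball (fst p) (snd p)) D"
    proof (rule inj_onI, rule ccontr)
      fix p q assume pq: "p \<in> D" "q \<in> D" "ball (fst p) (snd p) = ball (fst q) (snd q)" "p \<noteq> q"
      have "fst p \<in> ball (fst p) (snd p)" using Dp(2)[OF pq(1)] by simp
      moreover from this have "fst p \<in> ball (fst q) (snd q)" unfolding pq(3) .
      ultimately have "fst p \<in> cball (fst p) (snd p) \<inter> cball (fst q) (snd q)"
        using ball_subset_cball by blast
      then show False using pairwiseD[OF Dd pq(1,2,4)] by blast
    qed
    moreover have "countable ((\<lambda>p. ball (fst p) (snd p)) ` D)"
    proof (rule countable_disjoint_open_subsets)
      show "pairwise disjnt ((\<lambda>p. ball (fst p) (snd p)) ` D)"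
      proof (rule pairwiseI)
        fix X Y assume "X \<in> (\<lambda>p. ball (fst p) (snd p)) ` D" "Y \<in> (\<lambda>p. ball (fst p) (snd p)) ` D" "X \<noteq> Y"
        then obtain p q where pq: "p \<in> D" "q \<in> D" "p \<noteq> q" "X = ball (fst p) (snd p)" "Y = ball (fst q) (snd q)"
          by blast
        then have "cball (fst p) (snd p) \<inter> cball (fst q) (snd q) = {}"
          using pairwiseD[OF Dd pq(1-3)] by blast
        then show "disjnt X Y" using pq(4,5) ball_subset_cball unfolding disjnt_def by blast
      qed
    qed auto
    ultimately have cD: "countable D" using countable_image_inj_on by blast
    define J where "J = to_nat_on D ` D"
    define c where "c = from_nat_into D"
    have cJ: "c i \<in> D" "to_nat_on D (c i) = i" if "i \<in> J" for i
      using that cD by (auto simp: J_def c_def)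
    define B where "B a i = (if i \<in> J then cball (fst (c i)) (a * snd (c i)) else {})" for a i
    have sB: "B a i \<in> sets M" "B a i \<in> sets N" for a i using sM sN by (auto simp: B_def)
    have dB: "disjoint_family (B 1)"
    proof -
      have "B 1 i \<inter> B 1 j = {}" if "i \<noteq> j" for i j
      proof (cases "i \<in> J \<and> j \<in> J")
        case True
        then have "c i \<in> D" "c j \<in> D" "c i \<noteq> c j" using cJ that by metis+
        then show ?thesis using pairwiseD[OF Dd, of "c i" "c j"] True by (simp add: B_def)
      qed (auto simp: B_def)
      then show ?thesis by (auto simp: disjoint_family_on_def)
    qed
    have BU: "B 1 i \<subseteq> U" for i using cJ Dp by (auto simp: B_def)
    have sumM: "(\<lambda>i. measure M (B 1 i)) sums measure M (\<Union>i. B 1 i)"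
      by (rule M.finite_measure_UNION) (use sB dB in auto)
    have sumN: "(\<lambda>i. measure N (B 1 i)) sums measure N (\<Union>i. B 1 i)"
      by (rule N.finite_measure_UNION) (use sB dB in auto)
    have MB: "measure M (\<Union>i. B 1 i) \<le> \<kappa> * measure N (\<Union>i. B 1 i)"
    proof (rule sums_le[OF _ sumM sums_mult[OF sumN]])
      fix i show "measure M (B 1 i) \<le> \<kappa> * measure N (B 1 i)"
        using le[of "fst (c i)" "snd (c i)"] Dp[of "c i"] cJ[of i] by (simp add: B_def)
    qed
    have "measure N (\<Union>i. B 1 i) \<le> measure N U"
      by (rule N.finite_measure_mono) (use BU U sN in auto)
    then have "\<kappa> * measure N (\<Union>i. B 1 i) \<le> \<kappa> * (measure N Z + e)"
      using NU \<kappa> by (intro mult_left_mono) auto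
    with MB have 1: "measure M (\<Union>i. B 1 i) \<le> \<kappa> * (measure N Z + e)" by simp
    obtain m where m: "norm (\<Sum>i. measure M (B 1 (i + m))) < e"
      using suminf_exist_split[OF e sums_summable[OF sumM]] by blast
    \<comment> \<open>The first \<open>m\<close> balls form a closed set, so a point outside all
      balls has a small ball in \<open>I\<close> that avoids them. The selected ball which it meets
      must then have index at least \<open>m\<close>.\<close>
    have cov: "Z \<subseteq> (\<Union>i. B 1 i) \<union> (\<Union>i. B 3 (i + m))"
    proof
      fix z assume z: "z \<in> Z"
      show "z \<in> (\<Union>i. B 1 i) \<union> (\<Union>i. B 3 (i + m))"
      proof (cases "z \<in> (\<Union>i. B 1 i)")
        case False
        define V where "V = U - (\<Union>i<m. B 1 i)"
        have "closed (B 1 i)" for i by (simp add: B_def)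
        then have "open V" unfolding V_def using U by (intro open_Diff closed_UN) auto
        moreover have "z \<in> V" using z U False by (auto simp: V_def)
        ultimately obtain t' where t': "t' > 0" "cball z t' \<subseteq> V"
          using open_contains_cball by blast
        define t where "t = min t' (t0 / 2)"
        have t: "0 < t" "t < t0" "cball z t \<subseteq> V" using t' t0 by (auto simp: t_def)
        have "(z, t) \<in> I" using z t by (auto simp: I_def V_def)
        from Dm[OF this] obtain q where q: "q \<in> D" "cball z t \<inter> cball (fst q) (snd q) \<noteq> {}" "t \<le> 2 * snd q"
          by auto
        define i where "i = to_nat_on D q"
        have i: "i \<in> J" "c i = q" using q cD by (auto simp: i_def J_def c_def)
        have "\<not> i < m"
        proof
          assume "i < m"
          then have "cball z t \<inter> B 1 i = {}" using t(3) by (auto simp: V_def)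
          then show False using i q by (simp add: B_def)
        qed
        moreover obtain w where "dist z w \<le> t" "dist (fst q) w \<le> snd q" using q(2) by auto
        then have "dist (fst q) z \<le> 3 * snd q"
          using dist_triangle2[of "fst q" z w] q(3) by simp
        then have "z \<in> B 3 i" using i by (simp add: B_def)
        ultimately have "z \<in> B 3 ((i - m) + m)" by simp
        then show ?thesis by blast
      qed simp
    qed
    have B31: "measure M (B 3 i) \<le> \<bar>\<Lambda>\<bar> * measure M (B 1 i)" for i
    proof (cases "i \<in> J")
      case True
      have "measure M (B 3 i) \<le> \<Lambda> * measure M (B 1 i)"
        using dbl[of "fst (c i)" "snd (c i)"] Dp[of "c i"] cJ[of i] True by (simp add: B_def)
      also have "\<dots> \<le> \<bar>\<Lambda>\<bar> * measure M (B 1 i)" by (intro mult_right_mono) auto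
      finally show ?thesis .
    qed (simp add: B_def)
    have sm1: "summable (\<lambda>i. measure M (B 1 (i + m)))"
      using sums_summable[OF sumM] by (rule summable_ignore_initial_segment)
    have sm1': "summable (\<lambda>i. \<bar>\<Lambda>\<bar> * measure M (B 1 (i + m)))"
      by (rule summable_mult[OF sm1])
    have sm3: "summable (\<lambda>i. measure M (B 3 (i + m)))"
      by (rule summable_comparison_test[OF _ sm1']) (use B31 in \<open>auto intro!: exI[of _ 0]\<close>)
    have "measure M (\<Union>i. B 3 (i + m)) \<le> (\<Sum>i. measure M (B 3 (i + m)))"
      by (rule M.finite_measure_subadditive_countably) (use sB sm3 in auto)
    also have "\<dots> \<le> (\<Sum>i. \<bar>\<Lambda>\<bar> * measure M (B 1 (i + m)))"
      by (rule suminf_le[OF B31 sm3 sm1'])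
    also have "\<dots> = \<bar>\<Lambda>\<bar> * (\<Sum>i. measure M (B 1 (i + m)))"
      by (rule suminf_mult[OF sm1])
    also have "\<dots> \<le> \<bar>\<Lambda>\<bar> * e"
      using m by (intro mult_left_mono) auto
    finally have 2: "measure M (\<Union>i. B 3 (i + m)) \<le> \<bar>\<Lambda>\<bar> * e" .
    have "measure M Z \<le> measure M ((\<Union>i. B 1 i) \<union> (\<Union>i. B 3 (i + m)))"
      by (rule M.finite_measure_mono[OF cov]) (use sB in auto)
    also have "\<dots> \<le> measure M (\<Union>i. B 1 i) + measure M (\<Union>i. B 3 (i + m))"
      by (rule measure_Un_le) (use sB in auto)
    finally show ?thesis using 1 2 by linarith
  qed
  show ?thesis
  proof (rule field_le_epsilon)
    fix e :: real assume e: "e > 0"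
    define e' where "e' = e / (\<kappa> + \<bar>\<Lambda>\<bar> + 1)"
    have "e' > 0" using e \<kappa> by (simp add: e'_def add_nonneg_pos)
    have "\<kappa> + \<bar>\<Lambda>\<bar> + 1 \<noteq> 0" using \<kappa> by linarith
    then have "(\<kappa> + \<bar>\<Lambda>\<bar> + 1) * e' = e" by (simp add: e'_def)
    then have "\<kappa> * e' + \<bar>\<Lambda>\<bar> * e' + e' = e" by (simp add: distrib_right)
    then show "measure M Z \<le> \<kappa> * measure N Z + e"
      using key[OF \<open>e' > 0\<close>] \<open>e' > 0\<close> distrib_left[of \<kappa> "measure N Z" e'] by linarith
  qed
qed

section \<open>Orthogonal projections and coordinates\<close>

definition orthoproj :: "'a::real_inner set \<Rightarrow> 'a \<Rightarrow> 'a" where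
  "orthoproj W x = (SOME p. p \<in> W \<and> (\<forall>w\<in>W. (x - p) \<bullet> w = 0))"

text \<open>Finite dimension is expressed by a finite spanning set because \<open>dim\<close> has
  the value 0 on infinite-dimensional subspaces too. This is the reason for the assumption
  \<open>d \<ge> 1\<close> in \<open>finspan_of_dim\<close>.\<close>

definition finspan :: "'a::real_vector set \<Rightarrow> bool" where
  "finspan W \<longleftrightarrow> (\<exists>B. finite B \<and> W = span B)"

lemma finspan_subspace: "finspan W \<Longrightarrow> subspace W"
  by (auto simp: finspan_def)

lemma finspan_of_dim:
  assumes "subspace W" "dim W = d" "d \<ge> 1"
  shows "finspan W"
proof -
  obtain B where B: "B \<subseteq> W" "independent B" "W \<subseteq> span B" "card B = dim W"
    using basis_exists by blast
  then have "finite B" using assms card.infinite by fastforce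
  moreover have "span B = W" using B assms(1) span_minimal by blast
  ultimately show ?thesis unfolding finspan_def by blast
qed

lemma orthonormal_basis_finspan:
  fixes W :: "'a::real_inner set"
  assumes "finspan W"
  shows "\<exists>B. finite B \<and> B \<subseteq> W \<and> pairwise orthogonal B \<and> (\<forall>b\<in>B. norm b = 1) \<and> independent B \<and>
    card B = dim W \<and> span B = W"
proof -
  obtain B0 where B0: "finite B0" "W = span B0" using assms by (auto simp: finspan_def)
  obtain C where C: "finite C" "span C = span B0" "pairwise orthogonal C"
    using basis_orthogonal[OF B0(1)] by blast
  define C' where "C' = C - {0}"
  define B where "B = (\<lambda>x. x /\<^sub>R norm x) ` C'"
  have fin: "finite B" using C by (simp add: B_def C'_def)
  have sC': "span C' = W" using C(2) B0(2) by (simp add: C'_def span_delete_0)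
  have nz: "x \<noteq> 0" if "x \<in> C'" for x using that by (simp add: C'_def)
  have norm1: "norm b = 1" if "b \<in> B" for b using that nz by (auto simp: B_def)
  have orth: "pairwise orthogonal B"
    unfolding B_def
  proof (rule pairwiseI)
    fix p q assume "p \<in> (\<lambda>x. x /\<^sub>R norm x) ` C'" "q \<in> (\<lambda>x. x /\<^sub>R norm x) ` C'" "p \<noteq> q"
    then obtain x y where xy: "x \<in> C'" "y \<in> C'" "x \<noteq> y" "p = x /\<^sub>R norm x" "q = y /\<^sub>R norm y" by blast
    then have "orthogonal x y" using pairwiseD[OF C(3)] by (auto simp: C'_def)
    then show "orthogonal p q" using xy by (simp add: orthogonal_def)
  qed
  have "span B = W"
  proof
    show "span B \<subseteq> W"
      unfolding sC'[symmetric] by (rule span_minimal) (auto simp: B_def span_base span_mul)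
    show "W \<subseteq> span B"
      unfolding sC'[symmetric]
    proof (rule span_minimal)
      show "C' \<subseteq> span B"
      proof
        fix x assume x: "x \<in> C'"
        have "norm x *\<^sub>R (x /\<^sub>R norm x) \<in> span B"
          by (intro span_mul span_base) (use x in \<open>auto simp: B_def\<close>)
        then show "x \<in> span B" using nz[OF x] by simp
      qed
    qed simp
  qed
  moreover have "independent B"
    by (rule pairwise_orthogonal_independent[OF orth]) (use norm1 in force)
  moreover have "B \<subseteq> W" using \<open>span B = W\<close> span_superset by blast
  moreover have "card B = dim W"
    using \<open>span B = W\<close> \<open>independent B\<close> by (metis dim_eq_card_independent dim_span)
  ultimately show ?thesis using fin orth norm1 by blast
qed

lemma orthoproj_props:
  fixes W :: "'a::real_inner set"
  assumes "finspan W"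
  shows orthoproj_in: "orthoproj W x \<in> W"
    and orthoproj_orth: "w \<in> W \<Longrightarrow> (x - orthoproj W x) \<bullet> w = 0"
proof -
  obtain B where B: "finite B" "B \<subseteq> W" "pairwise orthogonal B" "\<forall>b\<in>B. norm b = 1" "span B = W"
    using orthonormal_basis_finspan[OF assms] by blast
  let ?p = "\<Sum>b\<in>B. (x \<bullet> b) *\<^sub>R b"
  have "?p \<in> W" unfolding B(5)[symmetric] by (intro span_sum span_mul span_base)
  moreover have "(x - ?p) \<bullet> w = 0" if "w \<in> W" for w
  proof -
    have "w \<in> span B" using that B by simp
    then show ?thesis
    proof (induction rule: span_induct_alt)
      case (step c b y)
      have "?p \<bullet> b = (\<Sum>b'\<in>B. (x \<bullet> b') * (b' \<bullet> b))"
        by (simp add: inner_sum_left)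
      also have "\<dots> = (\<Sum>b'\<in>B. if b' = b then x \<bullet> b else 0)"
      proof (rule sum.cong[OF refl])
        fix b' assume "b' \<in> B"
        show "(x \<bullet> b') * (b' \<bullet> b) = (if b' = b then x \<bullet> b else 0)"
        proof (cases "b' = b")
          case True
          have "b \<bullet> b = 1" using B(4) step(1) by (simp add: dot_square_norm)
          then show ?thesis using True by simp
        next
          case False
          then show ?thesis using pairwiseD[OF B(3) \<open>b' \<in> B\<close> step(1)] by (simp add: orthogonal_def)
        qed
      qed
      also have "\<dots> = x \<bullet> b" using B(1) step(1) by simp
      finally show ?case using step by (simp add: inner_add_right inner_diff_left)
    qed simp
  qed
  ultimately have "?p \<in> W \<and> (\<forall>w\<in>W. (x - ?p) \<bullet> w = 0)" by blast
  then have "orthoproj W x \<in> W \<and> (\<forall>w\<in>W. (x - orthoproj W x) \<bullet> w = 0)"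
    unfolding orthoproj_def by (rule someI)
  then show "orthoproj W x \<in> W" "w \<in> W \<Longrightarrow> (x - orthoproj W x) \<bullet> w = 0" by blast+
qed

lemma orthoproj_unique:
  fixes W :: "'a::real_inner set"
  assumes W: "finspan W" and p: "p \<in> W" "\<And>w. w \<in> W \<Longrightarrow> (x - p) \<bullet> w = 0"
  shows "orthoproj W x = p"
proof -
  let ?v = "orthoproj W x - p"
  have v: "?v \<in> W" using orthoproj_in[OF W] p finspan_subspace[OF W] by (simp add: subspace_diff)
  have "?v \<bullet> ?v = (x - p) \<bullet> ?v - (x - orthoproj W x) \<bullet> ?v"
    by (simp add: inner_diff_left)
  also have "\<dots> = 0" using p(2)[OF v] orthoproj_orth[OF W v] by simp
  finally show ?thesis by simp
qed

lemma linear_orthoproj: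
  fixes W :: "'a::real_inner set"
  assumes W: "finspan W"
  shows "linear (orthoproj W)"
proof (rule linearI)
  note s = finspan_subspace[OF W]
  show "orthoproj W (x + y) = orthoproj W x + orthoproj W y" for x y
  proof (rule orthoproj_unique[OF W])
    show "orthoproj W x + orthoproj W y \<in> W" using orthoproj_in[OF W] s by (simp add: subspace_add)
    fix w assume "w \<in> W"
    then show "(x + y - (orthoproj W x + orthoproj W y)) \<bullet> w = 0"
      using orthoproj_orth[OF W, of w x] orthoproj_orth[OF W, of w y]
      by (simp add: inner_add_left inner_diff_left)
  qed
  show "orthoproj W (c *\<^sub>R x) = c *\<^sub>R orthoproj W x" for c x
  proof (rule orthoproj_unique[OF W])
    show "c *\<^sub>R orthoproj W x \<in> W" using orthoproj_in[OF W] s by (simp add: subspace_mul)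
    fix w assume "w \<in> W"
    then show "(c *\<^sub>R x - c *\<^sub>R orthoproj W x) \<bullet> w = 0"
      using orthoproj_orth[OF W, of w x] by (simp add: inner_diff_left)
  qed
qed

lemma orthoproj_id: "finspan W \<Longrightarrow> x \<in> W \<Longrightarrow> orthoproj W x = (x::'a::real_inner)"
  by (rule orthoproj_unique) auto

lemma norm_orthoproj_Pythagoras:
  fixes W :: "'a::real_inner set"
  assumes W: "finspan W"
  shows "(norm x)\<^sup>2 = (norm (orthoproj W x))\<^sup>2 + (norm (x - orthoproj W x))\<^sup>2"
proof -
  have "orthogonal (orthoproj W x) (x - orthoproj W x)"
    using orthoproj_orth[OF W orthoproj_in[OF W], of x x] by (simp add: orthogonal_def inner_commute)
  from norm_add_Pythagorean[OF this] show ?thesis by simp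
qed

lemma norm_orthoproj_le:
  fixes W :: "'a::real_inner set"
  assumes W: "finspan W"
  shows "norm (orthoproj W x) \<le> norm x" "norm (x - orthoproj W x) \<le> norm x"
proof -
  have "(norm (orthoproj W x))\<^sup>2 \<le> (norm x)\<^sup>2" "(norm (x - orthoproj W x))\<^sup>2 \<le> (norm x)\<^sup>2"
    unfolding norm_orthoproj_Pythagoras[OF W, of x] by simp_all
  then show "norm (orthoproj W x) \<le> norm x" "norm (x - orthoproj W x) \<le> norm x"
    by (auto intro: power2_le_imp_le)
qed

lemma norm_diff_orthoproj_le:
  fixes W :: "'a::real_inner set"
  assumes W: "finspan W" and w: "w \<in> W"
  shows "norm (x - orthoproj W x) \<le> norm (x - w)"
proof -
  have "orthoproj W (x - w) = orthoproj W x - w"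
    using linear_diff[OF linear_orthoproj[OF W], of x w] orthoproj_id[OF W w] by simp
  then show ?thesis using norm_orthoproj_le(2)[OF W, of "x - w"] by simp
qed

section \<open>Coordinates and separability of the ambient space\<close>

lemma ex_Rn: "\<exists>n. x \<in> Rn n"
proof -
  obtain n where "\<forall>i\<in>{i. coord x i \<noteq> 0}. i < n"
    using finite_nat_set_iff_bounded[of "{i. coord x i \<noteq> 0}"] by auto
  then have "x \<in> Rn n" by (force simp: Rn_def)
  then show ?thesis by blast
qed

lemma abs_coord_le_norm: "\<bar>coord x i\<bar> \<le> norm x"
proof -
  obtain n where n: "x \<in> Rn n" using ex_Rn by blast
  show ?thesis
  proof (cases "i < n")
    case True
    then have "(coord x i)\<^sup>2 \<le> (\<Sum>i<n. (coord x i)\<^sup>2)"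
      using member_le_sum[of i "{..<n}" "\<lambda>i. (coord x i)\<^sup>2"] by simp
    then show ?thesis
      unfolding norm_Rn[OF n] by (intro real_le_rsqrt) simp
  next
    case False
    then show ?thesis using n by (simp add: Rn_def)
  qed
qed

lemma norm_Rn_le_sum: "x \<in> Rn n \<Longrightarrow> norm x \<le> (\<Sum>i<n. \<bar>coord x i\<bar>)"
  using L2_set_le_sum_abs[of "coord x" "{..<n}"] by (simp add: norm_Rn L2_set_def)

definition fin_seq_of :: "nat \<Rightarrow> (nat \<Rightarrow> real) \<Rightarrow> fin_seq" where
  "fin_seq_of n f = Abs_fin_seq (\<lambda>i. if i < n then f i else 0)"

lemma coord_fin_seq_of: "coord (fin_seq_of n f) i = (if i < n then f i else 0)"
  unfolding fin_seq_of_def by (subst Abs_fin_seq_inverse) (auto intro: finite_subset[of _ "{..<n}"])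

lemma fin_seq_of_in_Rn: "fin_seq_of n f \<in> Rn n"
  by (simp add: Rn_def coord_fin_seq_of)

text \<open>Finite sequences with rational entries are dense. Separability makes disjoint families
  of balls countable in the covering argument and gives the Lindelof property used for the
  complement of the support.\<close>

instance fin_seq :: second_countable_topology
proof
  define Q where "Q n = {x \<in> Rn n. \<forall>i. coord x i \<in> \<rat>}" for n
  have cQ: "countable (Q n)" for n
  proof -
    have "inj_on (\<lambda>x. map (coord x) [0..<n]) (Q n)"
    proof (rule inj_onI)
      fix x y assume xy: "x \<in> Q n" "y \<in> Q n" "map (coord x) [0..<n] = map (coord y) [0..<n]"
      show "x = y"
      proof (rule fin_seq_eqI)
        fix i show "coord x i = coord y i"
          using xy by (cases "i < n") (auto simp: Q_def Rn_def)
      qed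
    qed
    moreover have "(\<lambda>x. map (coord x) [0..<n]) ` Q n \<subseteq> lists \<rat>"
      by (auto simp: Q_def)
    moreover have "countable (lists \<rat> :: real list set)" by (simp add: countable_rat)
    ultimately show ?thesis using countable_image_inj_on countable_subset by metis
  qed
  define B where "B = (\<lambda>(x, q). ball x q) ` ((\<Union>n. Q n) \<times> (\<rat>::real set))"
  have cB: "countable B" unfolding B_def by (intro countable_image countable_SIGMA countable_UN) (auto simp: cQ countable_rat)
  have dense: "\<exists>q\<in>(\<Union>n. Q n). dist q x < e" if "e > 0" for x :: fin_seq and e
  proof -
    obtain n where n: "x \<in> Rn n" using ex_Rn by blast
    \<comment> \<open>With \<open>n + 1\<close> in place of \<open>n\<close> the total error stays
      strictly below \<open>e\<close>, also for \<open>n = 0\<close>.\<close>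
    have "\<exists>q. q \<in> \<rat> \<and> \<bar>q - coord x i\<bar> < e / (real n + 1)" for i
    proof -
      have "coord x i < coord x i + e / (real n + 1)" using that by (simp add: add_nonneg_pos)
      then obtain q where "q \<in> \<rat>" "coord x i < q" "q < coord x i + e / (real n + 1)"
        using Rats_dense_in_real by blast
      then show ?thesis by (intro exI[of _ q]) auto
    qed
    then obtain q where q: "\<And>i. q i \<in> \<rat>" "\<And>i. \<bar>q i - coord x i\<bar> < e / (real n + 1)" by metis
    define y where "y = fin_seq_of n q"
    have cy: "coord y i = (if i < n then q i else 0)" for i
      by (simp add: y_def coord_fin_seq_of)
    have "y \<in> Q n" using q by (auto simp: Q_def Rn_def cy)
    moreover have "dist y x < e"
    proof -
      have yx: "y - x \<in> Rn n" using n subspace_diff[OF subspace_Rn] \<open>y \<in> Q n\<close> by (auto simp: Q_def)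
      have "norm (y - x) \<le> (\<Sum>i<n. \<bar>coord (y - x) i\<bar>)" by (rule norm_Rn_le_sum[OF yx])
      also have "\<dots> \<le> (\<Sum>i<n. e / (real n + 1))"
        by (rule sum_mono) (use q(2) in \<open>auto simp: coord_simps cy intro!: less_imp_le\<close>)
      also have "\<dots> = e * (real n / (real n + 1))" by simp
      also have "\<dots> < e * 1" using that by (intro mult_strict_left_mono) auto
      finally show ?thesis by (simp add: dist_norm)
    qed
    ultimately show ?thesis by blast
  qed
  have "topological_basis B"
  proof (rule topological_basisI)
    show "open b" if "b \<in> B" for b using that by (auto simp: B_def)
    fix O' :: "fin_seq set" and x assume "open O'" "x \<in> O'"
    then obtain e where e: "e > 0" "ball x e \<subseteq> O'" using open_contains_ball by blast
    obtain q where q: "q \<in> (\<Union>n. Q n)" "dist q x < e / 4" using dense[of "e / 4" x] e by auto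
    obtain \<rho> where \<rho>: "\<rho> \<in> \<rat>" "e / 4 < \<rho>" "\<rho> < e / 2" using Rats_dense_in_real[of "e / 4" "e / 2"] e by auto
    have "ball q \<rho> \<subseteq> ball x e"
    proof
      fix z assume "z \<in> ball q \<rho>"
      then have "dist q z < \<rho>" by simp
      moreover have "dist x z \<le> dist q x + dist q z" by (metis dist_commute dist_triangle)
      ultimately show "z \<in> ball x e" using q(2) \<rho>(3) e(1) by simp
    qed
    moreover have "ball q \<rho> \<in> B" using q \<rho> unfolding B_def by blast
    moreover have "x \<in> ball q \<rho>" using q \<rho> by simp
    ultimately show "\<exists>B'\<in>B. x \<in> B' \<and> B' \<subseteq> O'" using e(2) by blast
  qed
  then have "open = generate_topology B" by (rule topological_basis_imp_subbasis)
  then show "\<exists>B::fin_seq set set. countable B \<and> open = generate_topology B" using cB by blast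
qed

section \<open>Hausdorff measure\<close>

lemma hausdorff_delta_mono: "A \<subseteq> B \<Longrightarrow> hausdorff_delta \<delta> d A \<le> hausdorff_delta \<delta> d B"
  unfolding hausdorff_delta_def by (rule INF_superset_mono) auto

lemma hausdorff_delta_antimono: "\<delta> \<le> \<delta>' \<Longrightarrow> hausdorff_delta \<delta>' d A \<le> hausdorff_delta \<delta> d A"
  unfolding hausdorff_delta_def by (rule INF_superset_mono) (auto intro: order.trans)

lemma hausdorff_delta_le:
  assumes "A \<subseteq> (\<Union>i. U i)" "\<And>i. bounded (U i)" "\<And>i. diameter (U i) \<le> \<delta>"
  shows "hausdorff_delta \<delta> d A \<le> (\<Sum>i. ennreal (diameter (U i) ^ d))"
  unfolding hausdorff_delta_def by (rule INF_lower) (use assms in auto)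

lemma hausdorff_delta_empty:
  assumes "d \<ge> 1" "\<delta> \<ge> 0"
  shows "hausdorff_delta \<delta> d {} = 0"
proof -
  have "hausdorff_delta \<delta> d {} \<le> (\<Sum>i. ennreal (diameter (({}) :: fin_seq set) ^ d))"
    by (rule hausdorff_delta_le) (use assms in auto)
  also have "\<dots> = 0" using assms by (simp add: power_0_left)
  finally show ?thesis by simp
qed

lemma hausdorff_delta_UN_le:
  "hausdorff_delta \<delta> d (\<Union>i. A i) \<le> (\<Sum>i. hausdorff_delta \<delta> d (A i))"
proof (rule ennreal_le_epsilon)
  fix e :: real assume fin: "(\<Sum>i. hausdorff_delta \<delta> d (A i)) < top" and e: "0 < e"
  have "\<exists>U. A i \<subseteq> (\<Union>j. U j) \<and> (\<forall>j. bounded (U j) \<and> diameter (U j) \<le> \<delta>) \<and>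
    (\<Sum>j. ennreal (diameter (U j) ^ d)) < hausdorff_delta \<delta> d (A i) + ennreal (e * (1/2)^Suc i)" for i
  proof -
    have "hausdorff_delta \<delta> d (A i) \<noteq> top"
      using ennreal_suminf_lessD[OF fin] by (simp add: less_top)
    then have "hausdorff_delta \<delta> d (A i) < hausdorff_delta \<delta> d (A i) + ennreal (e * (1/2)^Suc i)"
      using e by (simp add: ennreal_add_left_cancel_less[of _ 0, simplified])
    then show ?thesis
      by (subst (asm) (1) hausdorff_delta_def, subst (asm) INF_less_iff) auto
  qed
  then obtain U where U: "\<And>i. A i \<subseteq> (\<Union>j. U i j)" "\<And>i j. bounded (U i j)" "\<And>i j. diameter (U i j) \<le> \<delta>"
    "\<And>i. (\<Sum>j. ennreal (diameter (U i j) ^ d)) < hausdorff_delta \<delta> d (A i) + ennreal (e * (1/2)^Suc i)"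
    by metis
  define V where "V k = U (fst (prod_decode k)) (snd (prod_decode k))" for k
  have "(\<Union>i. A i) \<subseteq> (\<Union>k. V k)"
  proof
    fix x assume "x \<in> (\<Union>i. A i)"
    then obtain i j where "x \<in> U i j" using U(1) by blast
    then have "x \<in> V (prod_encode (i, j))" by (simp add: V_def)
    then show "x \<in> (\<Union>k. V k)" by blast
  qed
  then have "hausdorff_delta \<delta> d (\<Union>i. A i) \<le> (\<Sum>k. ennreal (diameter (V k) ^ d))"
    by (rule hausdorff_delta_le) (use U in \<open>auto simp: V_def\<close>)
  also have "\<dots> = (\<Sum>k. (\<lambda>(i, j). ennreal (diameter (U i j) ^ d)) (prod_decode k))"
    by (simp add: V_def case_prod_unfold)
  also have "\<dots> = (\<Sum>i. \<Sum>j. ennreal (diameter (U i j) ^ d))"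
    using suminf_ennreal_2dimen[of "\<lambda>i. \<Sum>j. ennreal (diameter (U i j) ^ d)" "\<lambda>(i, j). ennreal (diameter (U i j) ^ d)"]
    by (simp add: comp_def)
  also have "\<dots> \<le> (\<Sum>i. hausdorff_delta \<delta> d (A i) + ennreal (e * (1/2)^Suc i))"
    by (intro suminf_le less_imp_le U(4)) auto
  also have "\<dots> = (\<Sum>i. hausdorff_delta \<delta> d (A i)) + (\<Sum>i. ennreal (e * (1/2)^Suc i))"
    by (rule suminf_add[symmetric]) auto
  also have "(\<Sum>i. ennreal (e * (1/2)^Suc i)) = ennreal (e * 1)"
    by (rule suminf_ennreal_eq[OF _ sums_mult[OF power_half_series]]) (use e in auto)
  finally show "hausdorff_delta \<delta> d (\<Union>i. A i) \<le> (\<Sum>i. hausdorff_delta \<delta> d (A i)) + ennreal e" by simp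
qed

lemma hausdorff_unnormalized_mono:
  "A \<subseteq> B \<Longrightarrow> hausdorff_unnormalized d A \<le> hausdorff_unnormalized d B"
  unfolding hausdorff_unnormalized_def by (intro SUP_mono') (rule hausdorff_delta_mono)

lemma hausdorff_unnormalized_UN_le:
  "hausdorff_unnormalized d (\<Union>i. A i) \<le> (\<Sum>i. hausdorff_unnormalized d (A i))"
  unfolding hausdorff_unnormalized_def[of d "\<Union>i. A i"]
proof (rule SUP_least)
  fix \<delta> :: real assume "\<delta> \<in> {0<..}"
  then have "hausdorff_delta \<delta> d (A i) \<le> hausdorff_unnormalized d (A i)" for i
    unfolding hausdorff_unnormalized_def by (rule SUP_upper)
  then show "hausdorff_delta \<delta> d (\<Union>i. A i) \<le> (\<Sum>i. hausdorff_unnormalized d (A i))"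
    by (intro order.trans[OF hausdorff_delta_UN_le suminf_le]) auto
qed

lemma hausdorff_unnormalized_lipschitz:
  assumes L: "L > 0" and f: "L-lipschitz_on E f"
  shows "hausdorff_unnormalized d (f ` E) \<le> ennreal (L ^ d) * hausdorff_unnormalized d E"
  unfolding hausdorff_unnormalized_def[of d "f ` E"]
proof (rule SUP_least)
  fix \<delta> :: real assume \<delta>: "\<delta> \<in> {0<..}"
  \<comment> \<open>The constant is moved to the left so that the infimum on the right can be
    treated one cover at a time.\<close>
  have "ennreal ((1 / L) ^ d) * hausdorff_delta \<delta> d (f ` E) \<le> hausdorff_delta (\<delta> / L) d E"
    unfolding hausdorff_delta_def[of "\<delta> / L"]
  proof (rule INF_greatest)
      fix U :: "nat \<Rightarrow> fin_seq set"
      assume "U \<in> {U. E \<subseteq> (\<Union>i. U i) \<and> (\<forall>i. bounded (U i) \<and> diameter (U i) \<le> \<delta> / L)}"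
      then have U: "E \<subseteq> (\<Union>i. U i)" "\<And>i. bounded (U i)" "\<And>i. diameter (U i) \<le> \<delta> / L" by auto
      define V where "V i = f ` (U i \<inter> E)" for i
      have fL: "L-lipschitz_on (U i \<inter> E) f" for i using f by (rule lipschitz_on_subset) auto
      have dist_V: "dist x y \<le> L * diameter (U i)" if xy: "x \<in> V i" "y \<in> V i" for x y i
      proof -
        obtain u v where uv: "x = f u" "y = f v" "u \<in> U i \<inter> E" "v \<in> U i \<inter> E" using xy by (auto simp: V_def)
        have "dist x y \<le> L * dist u v" unfolding uv(1,2) by (rule lipschitz_onD[OF fL uv(3,4)])
        also have "\<dots> \<le> L * diameter (U i)"
          using L diameter_bounded_bound[OF U(2), of u i v] uv by (intro mult_left_mono) auto
        finally show ?thesis .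
      qed
      have dV: "diameter (V i) \<le> L * diameter (U i)" for i
        by (rule diameter_le) (use L diameter_ge_0[OF U(2)] dist_V in \<open>auto simp: dist_norm\<close>)
      have bV: "bounded (V i)" for i
        unfolding bounded_two_points using dist_V[of _ i] by blast
      have "hausdorff_delta \<delta> d (f ` E) \<le> (\<Sum>i. ennreal (diameter (V i) ^ d))"
      proof (rule hausdorff_delta_le[OF _ bV])
        show "f ` E \<subseteq> (\<Union>i. V i)"
        proof
          fix y assume "y \<in> f ` E"
          then obtain x where x: "x \<in> E" "y = f x" by blast
          then obtain i where "x \<in> U i" using U(1) by blast
          then have "y \<in> V i" using x by (simp add: V_def)
          then show "y \<in> (\<Union>i. V i)" by blast
        qed
        fix i
        have "L * diameter (U i) \<le> \<delta>" using U(3)[of i] L by (simp add: field_simps)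
        then show "diameter (V i) \<le> \<delta>" using dV[of i] by simp
      qed
      also have "\<dots> \<le> (\<Sum>i. ennreal (L ^ d) * ennreal (diameter (U i) ^ d))"
      proof (rule suminf_le)
        fix i
        have "diameter (V i) ^ d \<le> (L * diameter (U i)) ^ d"
          using dV diameter_ge_0[OF bV] by (intro power_mono) auto
        then show "ennreal (diameter (V i) ^ d) \<le> ennreal (L ^ d) * ennreal (diameter (U i) ^ d)"
          using L diameter_ge_0[OF U(2)] by (simp add: power_mult_distrib ennreal_leI flip: ennreal_mult)
      qed auto
      also have "\<dots> = ennreal (L ^ d) * (\<Sum>i. ennreal (diameter (U i) ^ d))"
        by (rule ennreal_suminf_cmult)
      finally have "ennreal ((1 / L) ^ d) * hausdorff_delta \<delta> d (f ` E)
          \<le> ennreal ((1 / L) ^ d) * (ennreal (L ^ d) * (\<Sum>i. ennreal (diameter (U i) ^ d)))"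
        by (rule mult_left_mono) simp
      also have "\<dots> = ennreal ((1 / L) ^ d * L ^ d) * (\<Sum>i. ennreal (diameter (U i) ^ d))"
        using L by (subst ennreal_mult) (auto simp: mult.assoc)
      also have "(1 / L) ^ d * L ^ d = 1" using L by (simp flip: power_mult_distrib)
      finally show "ennreal ((1 / L) ^ d) * hausdorff_delta \<delta> d (f ` E) \<le> (\<Sum>i. ennreal (diameter (U i) ^ d))"
        by simp
  qed
  then have "ennreal (L ^ d) * (ennreal ((1 / L) ^ d) * hausdorff_delta \<delta> d (f ` E))
      \<le> ennreal (L ^ d) * hausdorff_delta (\<delta> / L) d E"
    by (rule mult_left_mono) simp
  moreover have "ennreal (L ^ d) * (ennreal ((1 / L) ^ d) * X) = X" for X
  proof -
    have "ennreal (L ^ d) * ennreal ((1 / L) ^ d) = ennreal (L ^ d * (1 / L) ^ d)"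
      using L by (intro ennreal_mult[symmetric]) auto
    also have "L ^ d * (1 / L) ^ d = 1" using L by (simp flip: power_mult_distrib)
    finally show ?thesis by (simp flip: mult.assoc)
  qed
  ultimately have "hausdorff_delta \<delta> d (f ` E) \<le> ennreal (L ^ d) * hausdorff_delta (\<delta> / L) d E" by simp
  also have "hausdorff_delta (\<delta> / L) d E \<le> hausdorff_unnormalized d E"
    unfolding hausdorff_unnormalized_def by (rule SUP_upper) (use \<delta> L in auto)
  finally show "hausdorff_delta \<delta> d (f ` E) \<le> ennreal (L ^ d) * hausdorff_unnormalized d E"
    by (simp add: mult_left_mono)
qed

text \<open>A covering set of diameter below \<eta> meets at most one of \<open>A\<close> and
  \<open>B\<close>, so a fine cover of the union splits into two covers without loss. The empty
  traces cost nothing because \<open>d \<ge> 1\<close>.\<close>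

lemma hausdorff_unnormalized_separated:
  assumes d: "d \<ge> 1" and \<eta>: "\<eta> > 0" and sep: "\<And>a b. a \<in> A \<Longrightarrow> b \<in> B \<Longrightarrow> \<eta> \<le> dist a b"
  shows "hausdorff_unnormalized d A + hausdorff_unnormalized d B \<le> hausdorff_unnormalized d (A \<union> B)"
proof -
  have key: "hausdorff_delta \<delta> d A + hausdorff_delta \<delta> d B \<le> hausdorff_delta \<delta> d (A \<union> B)"
    if \<delta>: "0 < \<delta>" "\<delta> < \<eta>" for \<delta>
    unfolding hausdorff_delta_def[of _ _ "A \<union> B"]
  proof (rule INF_greatest)
    fix U :: "nat \<Rightarrow> fin_seq set"
    assume "U \<in> {U. A \<union> B \<subseteq> (\<Union>i. U i) \<and> (\<forall>i. bounded (U i) \<and> diameter (U i) \<le> \<delta>)}"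
    then have U: "A \<union> B \<subseteq> (\<Union>i. U i)" "\<And>i. bounded (U i)" "\<And>i. diameter (U i) \<le> \<delta>" by auto
    have one: "U i \<inter> A = {} \<or> U i \<inter> B = {}" for i
    proof (rule ccontr)
      assume "\<not> (U i \<inter> A = {} \<or> U i \<inter> B = {})"
      then obtain a b where "a \<in> U i" "a \<in> A" "b \<in> U i" "b \<in> B" by blast
      then show False
        using diameter_bounded_bound[OF U(2), of a i b] U(3)[of i] sep[of a b] \<delta> by simp
    qed
    have dm: "diameter (U i \<inter> X) ^ d \<le> diameter (U i) ^ d" for i X
      by (intro power_mono diameter_subset diameter_ge_0) (use U(2) in \<open>auto intro: bounded_subset\<close>)
    have dm0: "diameter (U i \<inter> X) \<le> \<delta>" for i X
      using diameter_subset[of "U i \<inter> X" "U i"] U(2,3)[of i] by auto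
    have "hausdorff_delta \<delta> d A \<le> (\<Sum>i. ennreal (diameter (U i \<inter> A) ^ d))"
      by (rule hausdorff_delta_le) (use U dm0 in \<open>auto intro: bounded_subset\<close>)
    moreover have "hausdorff_delta \<delta> d B \<le> (\<Sum>i. ennreal (diameter (U i \<inter> B) ^ d))"
      by (rule hausdorff_delta_le) (use U dm0 in \<open>auto intro: bounded_subset\<close>)
    ultimately have "hausdorff_delta \<delta> d A + hausdorff_delta \<delta> d B
      \<le> (\<Sum>i. ennreal (diameter (U i \<inter> A) ^ d)) + (\<Sum>i. ennreal (diameter (U i \<inter> B) ^ d))"
      by (rule add_mono)
    also have "\<dots> = (\<Sum>i. ennreal (diameter (U i \<inter> A) ^ d) + ennreal (diameter (U i \<inter> B) ^ d))"
      by (rule suminf_add) auto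
    also have "\<dots> \<le> (\<Sum>i. ennreal (diameter (U i) ^ d))"
    proof (rule suminf_le)
      fix i
      show "ennreal (diameter (U i \<inter> A) ^ d) + ennreal (diameter (U i \<inter> B) ^ d) \<le> ennreal (diameter (U i) ^ d)"
        using one[of i] dm[of i A] dm[of i B] d by (auto simp: ennreal_leI power_0_left)
    qed auto
    finally show "hausdorff_delta \<delta> d A + hausdorff_delta \<delta> d B \<le> (\<Sum>i. ennreal (diameter (U i) ^ d))" .
  qed
  have "hausdorff_delta \<delta>1 d A + hausdorff_delta \<delta>2 d B \<le> hausdorff_unnormalized d (A \<union> B)"
    if "\<delta>1 > 0" "\<delta>2 > 0" for \<delta>1 \<delta>2
  proof -
    define \<delta> where "\<delta> = min (min \<delta>1 \<delta>2) (\<eta> / 2)"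
    have \<delta>: "0 < \<delta>" "\<delta> < \<eta>" "\<delta> \<le> \<delta>1" "\<delta> \<le> \<delta>2" using that \<eta> by (auto simp: \<delta>_def)
    have "hausdorff_delta \<delta>1 d A + hausdorff_delta \<delta>2 d B \<le> hausdorff_delta \<delta> d A + hausdorff_delta \<delta> d B"
      using \<delta> by (intro add_mono hausdorff_delta_antimono)
    also have "\<dots> \<le> hausdorff_delta \<delta> d (A \<union> B)" using \<delta> by (intro key)
    also have "\<dots> \<le> hausdorff_unnormalized d (A \<union> B)"
      unfolding hausdorff_unnormalized_def by (rule SUP_upper) (use \<delta> in auto)
    finally show ?thesis .
  qed
  then have "(SUP \<delta>1\<in>{0<..}. SUP \<delta>2\<in>{0<..}. hausdorff_delta \<delta>1 d A + hausdorff_delta \<delta>2 d B)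
    \<le> hausdorff_unnormalized d (A \<union> B)"
    by (intro SUP_least) auto
  moreover have ne: "{0::real<..} \<noteq> {}"
  proof -
    have "1 \<in> {0::real<..}" by simp
    then show ?thesis by blast
  qed
  have "hausdorff_unnormalized d A + hausdorff_unnormalized d B =
      (SUP \<delta>1\<in>{0<..}. hausdorff_delta \<delta>1 d A + hausdorff_unnormalized d B)"
    unfolding hausdorff_unnormalized_def[of d A] by (rule ennreal_SUP_add_left[OF ne, symmetric])
  moreover have "X + hausdorff_unnormalized d B = (SUP \<delta>2\<in>{0<..}. X + hausdorff_delta \<delta>2 d B)" for X
    unfolding hausdorff_unnormalized_def[of d B] add.commute[of X] by (rule ennreal_SUP_add_left[OF ne, symmetric])
  ultimately show ?thesis by simp
qed

lemma hausdorff_unnormalized_empty: "d \<ge> 1 \<Longrightarrow> hausdorff_unnormalized d {} = 0"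
  unfolding hausdorff_unnormalized_def by (auto simp: hausdorff_delta_empty intro!: SUP_eqI)

lemma hausdorff_unnormalized_Un_le:
  assumes "d \<ge> 1"
  shows "hausdorff_unnormalized d (A \<union> B) \<le> hausdorff_unnormalized d A + hausdorff_unnormalized d B"
proof -
  let ?X = "\<lambda>i. if i = (0::nat) then A else if i = 1 then B else {}"
  have 1: "(\<Union>i. ?X i) = A \<union> B" by (auto split: if_splits)
  have "hausdorff_unnormalized d (A \<union> B) \<le> (\<Sum>i. hausdorff_unnormalized d (?X i))"
    using hausdorff_unnormalized_UN_le[of d ?X] unfolding 1 .
  also have "\<dots> = (\<Sum>i\<in>{0,1}. hausdorff_unnormalized d (?X i))"
    by (rule suminf_finite) (auto simp: hausdorff_unnormalized_empty[OF assms])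
  finally show ?thesis by simp
qed

text \<open>Neighbouring layers \<open>R i\<close> and \<open>R (i + 1)\<close> may touch, but
  layers of equal parity are at positive distance. \<open>k\<close> selects the parity, and the
  distance may depend on the pair of layers.\<close>

lemma hausdorff_unnormalized_sum_alternate:
  fixes R :: "nat \<Rightarrow> fin_seq set"
  assumes d: "d \<ge> 1"
    and sep: "\<And>i j. i < j \<Longrightarrow> \<exists>\<eta>>0. \<forall>a\<in>R (2 * i + k). \<forall>b\<in>R (2 * j + k). \<eta> \<le> dist a b"
  shows "(\<Sum>i<m. hausdorff_unnormalized d (R (2 * i + k))) \<le> hausdorff_unnormalized d (\<Union>i<m. R (2 * i + k))"
proof (induct m)
  case 0
  then show ?case by simp
next
  case (Suc m)
  let ?A = "\<Union>i<m. R (2 * i + k)" and ?B = "R (2 * m + k)"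
  have "\<exists>\<eta>. \<forall>i<m. \<eta> i > 0 \<and> (\<forall>a\<in>R (2 * i + k). \<forall>b\<in>?B. \<eta> i \<le> dist a b)"
    by (rule choice_iff'[THEN iffD1]) (use sep in blast)
  then obtain \<eta> where \<eta>: "\<And>i. i < m \<Longrightarrow> \<eta> i > 0" "\<And>i a b. i < m \<Longrightarrow> a \<in> R (2 * i + k) \<Longrightarrow> b \<in> ?B \<Longrightarrow> \<eta> i \<le> dist a b"
    by blast
  define \<theta> where "\<theta> = Min (insert 1 (\<eta> ` {..<m}))"
  have "\<theta> > 0" using \<eta>(1) by (simp add: \<theta>_def)
  moreover have "\<theta> \<le> dist a b" if "a \<in> ?A" "b \<in> ?B" for a b
  proof -
    obtain i where i: "i < m" "a \<in> R (2 * i + k)" using \<open>a \<in> ?A\<close> by blast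
    have "\<theta> \<le> \<eta> i" unfolding \<theta>_def using i by (intro Min_le) auto
    then show ?thesis using \<eta>(2)[OF i that(2)] by simp
  qed
  ultimately have "hausdorff_unnormalized d ?A + hausdorff_unnormalized d ?B \<le> hausdorff_unnormalized d (?A \<union> ?B)"
    by (rule hausdorff_unnormalized_separated[OF d])
  also have "?A \<union> ?B = (\<Union>i<Suc m. R (2 * i + k))" by (auto simp: lessThan_Suc)
  finally show ?case using order.trans[OF add_right_mono[OF Suc]] by simp
qed

text \<open>Caratheodory's criterion for a metric outer measure. The sets \<open>A k\<close> of
  points of \<open>E\<close> at distance at least \<open>1 / (k + 1)\<close> from \<open>C\<close>
  are separated from \<open>C\<close> and exhaust \<open>E - C\<close>. Summing the layers
  \<open>R k\<close> over even and over odd indices bounds their total measure by twice that of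
  \<open>E\<close>, so the part of \<open>E - C\<close> outside \<open>A k\<close> becomes
  negligible.\<close>

lemma hausdorff_unnormalized_closed_split:
  assumes d: "d \<ge> 1" and C: "closed C"
  shows "hausdorff_unnormalized d (E \<inter> C) + hausdorff_unnormalized d (E - C) = hausdorff_unnormalized d E"
    (is "?h (E \<inter> C) + _ = _")
proof (rule antisym)
  show "?h E \<le> ?h (E \<inter> C) + ?h (E - C)"
    using hausdorff_unnormalized_Un_le[OF d, of "E \<inter> C" "E - C"] by (simp add: Int_Diff_Un)
  show "?h (E \<inter> C) + ?h (E - C) \<le> ?h E"
  proof (cases "C = {} \<or> ?h E = top")
    case True
    then show ?thesis by (auto simp: hausdorff_unnormalized_empty[OF d])
  next
    case False
    then have C0: "C \<noteq> {}" and hE: "?h E \<noteq> top" by auto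
    have hfin: "?h X \<noteq> top" if "X \<subseteq> E" for X
      using hausdorff_unnormalized_mono[OF that, of d] hE by (auto simp: top_unique)
    define A where "A k = {x \<in> E. 1 / real (Suc k) \<le> infdist x C}" for k
    define R where "R k = A (Suc k) - A k" for k
    have AE: "A k \<subseteq> E - C" for k
    proof -
      have "0 < 1 / real (Suc k)" by simp
      then show ?thesis by (auto simp: A_def)
    qed
    have inc: "A k \<subseteq> A (Suc k)" for k
    proof -
      have "1 / real (Suc (Suc k)) \<le> 1 / real (Suc k)" by (simp add: frac_le)
      then show ?thesis by (auto simp: A_def)
    qed
    have 1: "?h (E \<inter> C) + ?h (A k) \<le> ?h E" for k
    proof -
      have "?h (E \<inter> C) + ?h (A k) \<le> ?h ((E \<inter> C) \<union> A k)"
      proof (rule hausdorff_unnormalized_separated[OF d, of "1 / real (Suc k)"])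
        fix a b assume "a \<in> E \<inter> C" "b \<in> A k"
        then show "1 / real (Suc k) \<le> dist a b"
          using infdist_le[of a C b] by (simp add: A_def dist_commute)
      qed simp
      also have "\<dots> \<le> ?h E" by (rule hausdorff_unnormalized_mono) (use AE in blast)
      finally show ?thesis .
    qed
    have RE: "R k \<subseteq> E" for k using AE by (auto simp: R_def)
    \<comment> \<open>Points of \<open>R i\<close> have distance at least \<open>1 / (i + 2)\<close>
      from \<open>C\<close>. Points of \<open>R j\<close> lie outside \<open>A j\<close>, hence at
      distance below \<open>1 / (j + 1) \<le> 1 / (i + 3)\<close>.\<close>
    have sepR: "\<exists>\<eta>>0. \<forall>a\<in>R i. \<forall>b\<in>R j. \<eta> \<le> dist a b" if "i + 2 \<le> j" for i j
    proof (intro exI conjI ballI)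
      show "1 / real (i + 2) - 1 / real (i + 3) > 0"
        using divide_strict_left_mono[of "real (i + 2)" "real (i + 3)" 1] by simp
      fix a b assume "a \<in> R i" "b \<in> R j"
      then have "1 / real (i + 2) \<le> infdist a C" by (simp add: R_def A_def)
      moreover have "infdist b C < 1 / real (Suc j)" using \<open>b \<in> R j\<close> AE by (auto simp: R_def A_def)
      moreover have "1 / real (Suc j) \<le> 1 / real (i + 3)" using that by (intro frac_le) auto
      moreover have "infdist a C \<le> infdist b C + dist a b" by (rule infdist_triangle)
      ultimately show "1 / real (i + 2) - 1 / real (i + 3) \<le> dist a b" by linarith
    qed
    define r where "r k = enn2real (?h (R k))" for k
    have r: "?h (R k) = ennreal (r k)" "r k \<ge> 0" for k using hfin[OF RE] by (auto simp: r_def less_top)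
    define H where "H = enn2real (?h E)"
    have H: "?h E = ennreal H" "H \<ge> 0" using hE by (auto simp: H_def less_top)
    have half: "(\<Sum>i<m. r (2 * i + k)) \<le> H" for m k
    proof -
      have "(\<Sum>i<m. ?h (R (2 * i + k))) \<le> ?h (\<Union>i<m. R (2 * i + k))"
        by (rule hausdorff_unnormalized_sum_alternate[OF d]) (auto intro!: sepR)
      also have "\<dots> \<le> ?h E" by (rule hausdorff_unnormalized_mono) (use RE in blast)
      finally show ?thesis using H r by (simp add: sum_ennreal sum_nonneg)
    qed
    have le2H: "(\<Sum>i<n. r i) \<le> 2 * H" for n
    proof -
      have "(\<Sum>i<n. r i) \<le> (\<Sum>i<2 * n. r i)" by (rule sum_mono2) (use r in auto)
      also have "\<dots> = (\<Sum>i<n. r (2 * i + 0)) + (\<Sum>i<n. r (2 * i + 1))"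
        by (induction n) (auto simp: algebra_simps)
      finally show ?thesis using half[of 0 n] half[of 1 n] by simp
    qed
    have sm: "summable r"
    proof (rule bounded_imp_summable)
      show "(\<Sum>k\<le>n. r k) \<le> 2 * H" for n
        using le2H[of "Suc n"] by (simp only: lessThan_Suc_atMost)
    qed (rule r(2))
    show ?thesis
    proof (rule ennreal_le_epsilon)
      fix e :: real assume e: "e > 0"
      obtain k where k: "norm (\<Sum>i. r (i + k)) < e" using suminf_exist_split[OF e sm] by blast
      have cov: "E - C \<subseteq> A k \<union> (\<Union>i. R (i + k))"
      proof
        fix x assume x: "x \<in> E - C"
        have "infdist x C > 0" using x C C0 infdist_nonneg[of x C] in_closed_iff_infdist_zero[OF C C0, of x] by force
        then obtain n where "1 / real (Suc n) < infdist x C" using nat_approx_posE by blast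
        then have xn: "x \<in> A n" using x by (simp add: A_def)
        have "x \<in> A n \<Longrightarrow> x \<in> A k \<union> (\<Union>i. R (i + k))" for n
        proof (induction n)
          case 0
          then show ?case using inc lift_Suc_mono_le[of A 0 k] by blast
        next
          case (Suc n)
          show ?case
          proof (cases "x \<in> A n")
            case True then show ?thesis by (rule Suc.IH)
          next
            case False
            then have "x \<in> R n" using Suc by (simp add: R_def)
            show ?thesis
            proof (cases "k \<le> n")
              case True
              then have "x \<in> R ((n - k) + k)" using \<open>x \<in> R n\<close> by simp
              then show ?thesis by blast
            next
              case False
              then have "A (Suc n) \<subseteq> A k" using inc lift_Suc_mono_le[of A "Suc n" k] by simp
              then show ?thesis using Suc.prems by blast
            qed
          qed
        qed
        then show "x \<in> A k \<union> (\<Union>i. R (i + k))" using xn by blast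
      qed
      have "?h (E - C) \<le> ?h (A k \<union> (\<Union>i. R (i + k)))" by (rule hausdorff_unnormalized_mono[OF cov])
      also have "\<dots> \<le> ?h (A k) + ?h (\<Union>i. R (i + k))" by (rule hausdorff_unnormalized_Un_le[OF d])
      also have "?h (\<Union>i. R (i + k)) \<le> (\<Sum>i. ?h (R (i + k)))" by (rule hausdorff_unnormalized_UN_le)
      also have "(\<Sum>i. ?h (R (i + k))) = ennreal (\<Sum>i. r (i + k))"
        unfolding r(1) using r(2) sm by (intro suminf_ennreal2) (auto intro: summable_ignore_initial_segment)
      also have "\<dots> \<le> ennreal e" using k by (intro ennreal_leI) auto
      finally have "?h (E \<inter> C) + ?h (E - C) \<le> ?h (E \<inter> C) + (?h (A k) + ennreal e)"
        by (simp add: add_mono)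
      also have "\<dots> \<le> ?h E + ennreal e" using 1[of k] by (simp add: add_mono flip: add.assoc)
      finally show "?h (E \<inter> C) + ?h (E - C) \<le> ?h E + ennreal e" .
    qed
  qed
qed

section \<open>Hausdorff measure traced on a set, and its normalization\<close>

definition hausdorff_on :: "nat \<Rightarrow> fin_seq set \<Rightarrow> fin_seq measure" where
  "hausdorff_on d E = measure_of UNIV (sets borel) (\<lambda>A. hausdorff d (A \<inter> E))"

lemma hausdorff_mono: "A \<subseteq> B \<Longrightarrow> hausdorff d A \<le> hausdorff d B"
  unfolding hausdorff_def by (intro divide_right_mono_ennreal hausdorff_unnormalized_mono)

lemma hausdorff_empty: "d \<ge> 1 \<Longrightarrow> hausdorff d {} = 0"
  by (simp add: hausdorff_def hausdorff_unnormalized_empty)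

lemma hausdorff_UN_le: "hausdorff d (\<Union>i. A i) \<le> (\<Sum>i. hausdorff d (A i))"
  unfolding hausdorff_def divide_ennreal_def ennreal_suminf_multc
  by (intro mult_right_mono hausdorff_unnormalized_UN_le) auto

lemma hausdorff_Un_le: "d \<ge> 1 \<Longrightarrow> hausdorff d (A \<union> B) \<le> hausdorff d A + hausdorff d B"
  unfolding hausdorff_def add_divide_distrib_ennreal[symmetric]
  by (intro divide_right_mono_ennreal hausdorff_unnormalized_Un_le)

lemma hausdorff_closed_split:
  "d \<ge> 1 \<Longrightarrow> closed C \<Longrightarrow> hausdorff d (E \<inter> C) + hausdorff d (E - C) = hausdorff d E"
  unfolding hausdorff_def divide_ennreal_def
  by (simp add: hausdorff_unnormalized_closed_split flip: distrib_right)

text \<open>The trace of the outer measure on an arbitrary \<open>E\<close> is an outer measure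
  again, and the splitting by closed sets, applied to \<open>X \<inter> E\<close>, puts all closed
  sets into its Caratheodory system. So the same construction serves planes and Lipschitz
  graphs.\<close>

lemma measure_space_hausdorff:
  assumes d: "d \<ge> 1"
  shows "measure_space UNIV (sets borel) (\<lambda>A. hausdorff d (A \<inter> E))"
proof -
  let ?f = "\<lambda>A. hausdorff d (A \<inter> E)"
  interpret sigma_algebra "UNIV :: fin_seq set" UNIV
    using sigma_algebra_Pow[of "UNIV :: fin_seq set"] by simp
  have om: "outer_measure_space UNIV ?f"
    unfolding outer_measure_space_def
  proof (intro conjI)
    show "positive UNIV ?f" by (simp add: positive_def hausdorff_empty[OF d])
    show "increasing UNIV ?f" by (auto simp: increasing_def intro!: hausdorff_mono)
    show "countably_subadditive UNIV ?f"
      unfolding countably_subadditive_def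
    proof (intro allI impI)
      fix A :: "nat \<Rightarrow> fin_seq set"
      have "(\<Union>i. A i) \<inter> E = (\<Union>i. A i \<inter> E)" by blast
      then show "?f (\<Union>i. A i) \<le> (\<Sum>i. ?f (A i))"
        using hausdorff_UN_le[of d "\<lambda>i. A i \<inter> E"] by (simp only:)
    qed
  qed
  let ?L = "lambda_system UNIV UNIV ?f"
  have ms: "measure_space UNIV ?L ?f"
    using caratheodory_lemma[OF om] .
  then have sa: "sigma_algebra UNIV ?L" by (simp add: measure_space_def)
  have "C \<in> ?L" if "closed C" for C
    unfolding lambda_system_eq mem_Collect_eq
  proof (intro conjI ballI UNIV_I)
    fix X
    have "X \<inter> C \<inter> E = (X \<inter> E) \<inter> C" "(X - C) \<inter> E = (X \<inter> E) - C" by blast+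
    then show "?f (X \<inter> C) + ?f (X - C) = ?f X"
      using hausdorff_closed_split[OF d that, of "X \<inter> E"] by simp
  qed
  then have "sigma_sets UNIV {C. closed C} \<subseteq> ?L"
    by (intro sigma_algebra.sigma_sets_subset[OF sa]) auto
  then have "sets borel \<subseteq> ?L" by (simp add: borel_eq_closed)
  moreover have "sigma_algebra UNIV (sets (borel :: fin_seq measure))"
    using sets.sigma_algebra_axioms[of "borel :: fin_seq measure"] by simp
  ultimately show ?thesis using measure_down[OF ms] by blast
qed

lemma sets_hausdorff_on [simp, measurable_cong]: "sets (hausdorff_on d E) = sets borel"
  and space_hausdorff_on [simp]: "space (hausdorff_on d E) = UNIV"
  using sets.sigma_sets_eq[of "borel :: fin_seq measure"]
  by (simp_all add: hausdorff_on_def sets_measure_of_conv space_measure_of_conv)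

lemma emeasure_hausdorff_on:
  assumes d: "d \<ge> 1" and A: "A \<in> sets borel"
  shows "emeasure (hausdorff_on d E) A = hausdorff d (A \<inter> E)"
proof (rule emeasure_measure_of[OF hausdorff_on_def])
  note ms = measure_space_hausdorff[OF d, of E]
  show "positive (sets (hausdorff_on d E)) (\<lambda>A. hausdorff d (A \<inter> E))"
    using ms by (simp add: measure_space_def)
  show "countably_additive (sets (hausdorff_on d E)) (\<lambda>A. hausdorff d (A \<inter> E))"
    using ms by (simp add: measure_space_def)
qed (use A in auto)

text \<open>Comparison with product Lebesgue measure. A covering set of diameter \<open>D\<close>
  lies in a cube of side \<open>2 * D\<close> about one of its points, and the cube
  \<open>?Q\<close> of side \<open>1 / (2 * d)\<close> corresponds to a subset of the unit ball
  because the Euclidean norm is at most the sum of the coordinates. With the next lemma this shows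
  that the divisor in \<open>hausdorff\<close> is neither 0 nor infinite.\<close>

lemma hausdorff_unnormalized_unit_ball_pos:
  assumes d: "d \<ge> 1"
  shows "hausdorff_unnormalized d (Rn_ball d 0 1) > 0"
proof -
  interpret product_sigma_finite "\<lambda>_::nat. lborel :: real measure"
    by standard
  let ?M = "Pi\<^sub>M {..<d} (\<lambda>_. lborel :: real measure)"
  let ?Q = "Pi\<^sub>E {..<d} (\<lambda>_. {0..1 / (2 * real d)})"
  have box: "emeasure ?M (Pi\<^sub>E {..<d} (\<lambda>i. {a i..a i + l})) = ennreal (l ^ d)" if "l \<ge> 0" for a l
    using that by (subst emeasure_PiM) (auto simp: prod_constant ennreal_power)
  have sbox: "Pi\<^sub>E {..<d} (\<lambda>i. {a i..a i + l}) \<in> sets ?M" for a :: "nat \<Rightarrow> real" and l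
    by (intro sets_PiM_I_finite) auto
  have "ennreal ((1 / (4 * real d)) ^ d) \<le> hausdorff_delta 1 d (Rn_ball d 0 1)"
    unfolding hausdorff_delta_def
  proof (rule INF_greatest)
    fix U :: "nat \<Rightarrow> fin_seq set"
    assume "U \<in> {U. Rn_ball d 0 1 \<subseteq> (\<Union>i. U i) \<and> (\<forall>i. bounded (U i) \<and> diameter (U i) \<le> 1)}"
    then have U: "Rn_ball d 0 1 \<subseteq> (\<Union>i. U i)" "\<And>i. bounded (U i)" by auto
    define u where "u j = (SOME x. x \<in> U j)" for j
    have u: "u j \<in> U j" if "x \<in> U j" for x j unfolding u_def using that by (rule someI)
    define D where "D j = diameter (U j)" for j
    have D: "D j \<ge> 0" for j unfolding D_def by (rule diameter_ge_0[OF U(2)])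
    define K where "K j = Pi\<^sub>E {..<d} (\<lambda>i. {coord (u j) i - D j..(coord (u j) i - D j) + 2 * D j})" for j
    have "?Q \<subseteq> (\<Union>j. K j)"
    proof
      fix f assume f: "f \<in> ?Q"
      let ?x = "fin_seq_of d f"
      have "norm ?x \<le> (\<Sum>i<d. \<bar>coord ?x i\<bar>)" by (rule norm_Rn_le_sum[OF fin_seq_of_in_Rn])
      also have "\<dots> \<le> (\<Sum>i<d. 1 / (2 * real d))"
      proof (rule sum_mono)
        fix i assume "i \<in> {..<d}"
        then show "\<bar>coord ?x i\<bar> \<le> 1 / (2 * real d)" using f by (auto simp: coord_fin_seq_of PiE_def Pi_def)
      qed
      also have "\<dots> = 1 / 2" using d by simp
      finally have "?x \<in> Rn_ball d 0 1" by (simp add: Rn_ball_def fin_seq_of_in_Rn)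
      then obtain j where j: "?x \<in> U j" using U(1) by blast
      have "\<bar>f i - coord (u j) i\<bar> \<le> D j" if "i < d" for i
      proof -
        have "\<bar>f i - coord (u j) i\<bar> = \<bar>coord (?x - u j) i\<bar>" using that by (simp add: coord_simps coord_fin_seq_of)
        also have "\<dots> \<le> dist ?x (u j)" unfolding dist_norm by (rule abs_coord_le_norm)
        also have "\<dots> \<le> D j" unfolding D_def by (rule diameter_bounded_bound[OF U(2) j u[OF j]])
        finally show ?thesis .
      qed
      then have "f i \<in> {coord (u j) i - D j..(coord (u j) i - D j) + 2 * D j}" if "i < d" for i
        using that by (fastforce simp: abs_le_iff)
      then have "f \<in> K j" using f unfolding K_def by (auto simp: PiE_def Pi_def)
      then show "f \<in> (\<Union>j. K j)" by blast
    qed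
    then have "emeasure ?M ?Q \<le> emeasure ?M (\<Union>j. K j)"
      by (rule emeasure_mono) (auto simp: K_def intro!: sbox sets.countable_UN)
    also have "\<dots> \<le> (\<Sum>j. emeasure ?M (K j))"
      by (rule emeasure_subadditive_countably) (auto simp: K_def intro!: sbox)
    also have "\<dots> = (\<Sum>j. ennreal (2 ^ d) * ennreal (D j ^ d))"
      unfolding K_def by (subst box) (use D in \<open>auto simp: power_mult_distrib ennreal_mult\<close>)
    also have "\<dots> = ennreal (2 ^ d) * (\<Sum>j. ennreal (D j ^ d))" by (rule ennreal_suminf_cmult)
    finally have "ennreal ((1 / (2 * real d)) ^ d) \<le> ennreal (2 ^ d) * (\<Sum>j. ennreal (D j ^ d))"
      using box[of "1 / (2 * real d)" "\<lambda>_. 0"] by simp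
    then have "ennreal ((1 / 2) ^ d) * ennreal ((1 / (2 * real d)) ^ d)
        \<le> ennreal ((1 / 2) ^ d) * (ennreal (2 ^ d) * (\<Sum>j. ennreal (D j ^ d)))"
      by (rule mult_left_mono) simp
    also have "\<dots> = ennreal ((1 / 2) ^ d * 2 ^ d) * (\<Sum>j. ennreal (D j ^ d))"
      by (subst ennreal_mult) (auto simp: mult.assoc)
    also have "(1 / 2 :: real) ^ d * 2 ^ d = 1" by (simp flip: power_mult_distrib)
    also have "ennreal ((1 / 2) ^ d) * ennreal ((1 / (2 * real d)) ^ d) = ennreal ((1 / (4 * real d)) ^ d)"
      by (subst ennreal_mult[symmetric]) (auto simp flip: power_mult_distrib)
    finally show "ennreal ((1 / (4 * real d)) ^ d) \<le> (\<Sum>i. ennreal (diameter (U i) ^ d))"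
      by (simp add: D_def)
  qed
  also have "\<dots> \<le> hausdorff_unnormalized d (Rn_ball d 0 1)"
    unfolding hausdorff_unnormalized_def by (rule SUP_upper) simp
  finally have le: "ennreal ((1 / (4 * real d)) ^ d) \<le> hausdorff_unnormalized d (Rn_ball d 0 1)" .
  have "0 < ennreal ((1 / (4 * real d)) ^ d)" using d by simp
  then show ?thesis using le by (rule less_le_trans)
qed

text \<open>The unit ball is covered by \<open>(2 * N) ^ d\<close> grid cubes of side
  \<open>1 / N\<close>, each of diameter at most \<open>d / N\<close>. The resulting sum
  \<open>(2 * d) ^ d\<close> does not depend on \<open>N\<close>, while the diameters tend to
  0.\<close>

lemma hausdorff_unnormalized_unit_ball_finite:
  assumes d: "d \<ge> 1"
  shows "hausdorff_unnormalized d (Rn_ball d 0 1) < top"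
proof -
  have "hausdorff_delta \<delta> d (Rn_ball d 0 1) \<le> ennreal ((2 * real d) ^ d)" if \<delta>: "\<delta> > 0" for \<delta>
  proof -
    obtain N where N: "real d / \<delta> < real N" using reals_Archimedean2 by blast
    have N0: "N > 0" using N \<delta> d by (metis divide_nonneg_pos gr0I not_less of_nat_0 of_nat_0_le_iff)
    have dN: "real d / real N \<le> \<delta>" using N \<delta> N0 by (simp add: field_simps)
    let ?I = "Pi\<^sub>E {..<d} (\<lambda>_. {..<2 * N})"
    have cI: "card ?I = (2 * N) ^ d" by (simp add: card_PiE prod_constant)
    obtain h where h: "bij_betw h {0..<(2 * N) ^ d} ?I"
      using ex_bij_betw_nat_finite[of ?I] cI by (auto intro!: finite_PiE)
    define K where "K g = {x \<in> Rn d. \<forall>i<d. - 1 + real (g i) / N \<le> coord x i \<and> coord x i \<le> - 1 + (real (g i) + 1) / N}"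
      for g :: "nat \<Rightarrow> nat"
    define U where "U k = (if k < (2 * N) ^ d then K (h k) else {})" for k
    have dist: "dist x y \<le> real d / real N" if "x \<in> K g" "y \<in> K g" for x y g
    proof -
      have "x - y \<in> Rn d" using that subspace_diff[OF subspace_Rn] by (auto simp: K_def)
      then have "dist x y \<le> (\<Sum>i<d. \<bar>coord (x - y) i\<bar>)" unfolding dist_norm by (rule norm_Rn_le_sum)
      also have "\<dots> \<le> (\<Sum>i<d. 1 / real N)"
      proof (rule sum_mono)
        fix i assume "i \<in> {..<d}"
        then have "- 1 + real (g i) / N \<le> coord x i" "coord x i \<le> - 1 + (real (g i) + 1) / N"
          "- 1 + real (g i) / N \<le> coord y i" "coord y i \<le> - 1 + (real (g i) + 1) / N"
          using that by (auto simp: K_def)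
        then show "\<bar>coord (x - y) i\<bar> \<le> 1 / real N" by (simp add: coord_simps add_divide_distrib abs_le_iff)
      qed
      finally show ?thesis by simp
    qed
    have bU: "bounded (U k)" for k
      unfolding U_def bounded_two_points using dist by (auto intro!: exI[of _ "real d / real N"])
    have dU: "diameter (U k) \<le> real d / real N" for k
      by (rule diameter_le) (use dist in \<open>auto simp: U_def dist_norm split: if_splits\<close>)
    have cov: "Rn_ball d 0 1 \<subseteq> (\<Union>k. U k)"
    proof
      fix x assume x: "x \<in> Rn_ball d 0 1"
      define g where "g = (\<lambda>i\<in>{..<d}. nat \<lfloor>(coord x i + 1) * N\<rfloor>)"
      have c: "-1 < coord x i" "coord x i < 1" for i
        using x abs_coord_le_norm[of x i] by (auto simp: Rn_ball_def abs_le_iff)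
      have gN: "g i < 2 * N" "real (g i) \<le> (coord x i + 1) * N" "(coord x i + 1) * N < real (g i) + 1" if "i < d" for i
      proof -
        have "0 \<le> (coord x i + 1) * N" using c[of i] by simp
        then have gi: "real (g i) = of_int \<lfloor>(coord x i + 1) * N\<rfloor>" using that by (simp add: g_def)
        show "real (g i) \<le> (coord x i + 1) * N" "(coord x i + 1) * N < real (g i) + 1" unfolding gi by linarith+
        have "(coord x i + 1) * N < 2 * real N" using c[of i] N0 by simp
        with \<open>real (g i) \<le> _\<close> have "real (g i) < real (2 * N)" by simp
        then show "g i < 2 * N" by (simp only: of_nat_less_iff)
      qed
      have "g \<in> ?I"
      proof (rule PiE_I)
        show "g i \<in> {..<2 * N}" if "i \<in> {..<d}" for i using gN(1) that by simp
        show "g i = undefined" if "i \<notin> {..<d}" for i using that by (simp add: g_def)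
      qed
      then have "g \<in> h ` {0..<(2 * N) ^ d}" unfolding bij_betw_imp_surj_on[OF h] .
      then obtain k where k: "k < (2 * N) ^ d" "h k = g" by auto
      have "x \<in> K g"
        unfolding K_def
      proof (intro CollectI conjI allI impI)
        show "x \<in> Rn d" using x by (simp add: Rn_ball_def)
        fix i assume i: "i < d"
        show "- 1 + real (g i) / real N \<le> coord x i" "coord x i \<le> - 1 + (real (g i) + 1) / real N"
          using gN(2,3)[OF i] N0 by (simp_all add: field_simps)
      qed
      then have "x \<in> U k" using k by (simp add: U_def)
      then show "x \<in> (\<Union>k. U k)" by blast
    qed
    have "hausdorff_delta \<delta> d (Rn_ball d 0 1) \<le> (\<Sum>k. ennreal (diameter (U k) ^ d))"
      by (rule hausdorff_delta_le[OF cov bU]) (rule order.trans[OF dU dN])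
    also have "\<dots> = (\<Sum>k<(2 * N) ^ d. ennreal (diameter (U k) ^ d))"
      by (rule suminf_finite) (use d in \<open>auto simp: U_def power_0_left\<close>)
    also have "\<dots> \<le> (\<Sum>k<(2 * N) ^ d. ennreal ((real d / real N) ^ d))"
      by (intro sum_mono ennreal_leI power_mono dU diameter_ge_0 bU)
    also have "\<dots> = of_nat ((2 * N) ^ d) * ennreal ((real d / real N) ^ d)" by simp
    also have "\<dots> = ennreal ((2 * real d) ^ d)"
    proof -
      have "real (2 * N) * (real d / real N) = 2 * real d" using N0 by simp
      then have "(2 * real d) ^ d = real ((2 * N) ^ d) * (real d / real N) ^ d"
        by (simp only: of_nat_power power_mult_distrib[symmetric])
      then have "ennreal ((2 * real d) ^ d) = ennreal (real ((2 * N) ^ d)) * ennreal ((real d / real N) ^ d)"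
        by (simp only: ennreal_mult'[OF of_nat_0_le_iff])
      then show ?thesis by (simp only: ennreal_of_nat_eq_real_of_nat)
    qed
    finally show ?thesis .
  qed
  then have "hausdorff_unnormalized d (Rn_ball d 0 1) \<le> ennreal ((2 * real d) ^ d)"
    unfolding hausdorff_unnormalized_def by (intro SUP_least) auto
  then show ?thesis using ennreal_less_top le_less_trans by blast
qed

lemma hausdorff_unit_ball: "d \<ge> 1 \<Longrightarrow> hausdorff d (Rn_ball d 0 1) = 1"
  unfolding hausdorff_def
  using hausdorff_unnormalized_unit_ball_pos[of d] hausdorff_unnormalized_unit_ball_finite[of d]
  by (intro ennreal_divide_self) auto

lemma hausdorff_lipschitz:
  assumes "L > 0" "L-lipschitz_on E f"
  shows "hausdorff d (f ` E) \<le> ennreal (L ^ d) * hausdorff d E"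
  unfolding hausdorff_def ennreal_times_divide
  by (intro divide_right_mono_ennreal hausdorff_unnormalized_lipschitz assms)

lemma hausdorff_similarity:
  assumes t: "t > 0" and f: "\<And>x y. x \<in> E \<Longrightarrow> y \<in> E \<Longrightarrow> dist (f x) (f y) = t * dist x y"
  shows "hausdorff d (f ` E) = ennreal (t ^ d) * hausdorff d E"
proof (rule antisym)
  show "hausdorff d (f ` E) \<le> ennreal (t ^ d) * hausdorff d E"
    by (rule hausdorff_lipschitz[OF t]) (use t f in \<open>auto intro!: lipschitz_onI\<close>)
  have inj: "inj_on f E" using f t by (fastforce intro: inj_onI)
  have "(1 / t)-lipschitz_on (f ` E) (inv_into E f)"
  proof (rule lipschitz_onI)
    fix x y assume "x \<in> f ` E" "y \<in> f ` E"
    then show "dist (inv_into E f x) (inv_into E f y) \<le> 1 / t * dist x y"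
      using f t inj by (auto simp: inv_into_f_f)
  qed (use t in simp)
  then have "hausdorff d (inv_into E f ` f ` E) \<le> ennreal ((1 / t) ^ d) * hausdorff d (f ` E)"
    by (rule hausdorff_lipschitz[rotated]) (use t in simp)
  moreover have "inv_into E f ` f ` E = E" using inj by (rule inv_into_image_cancel) simp
  ultimately have "hausdorff d E \<le> ennreal ((1 / t) ^ d) * hausdorff d (f ` E)" by simp
  then have "ennreal (t ^ d) * hausdorff d E \<le> ennreal (t ^ d) * (ennreal ((1 / t) ^ d) * hausdorff d (f ` E))"
    by (rule mult_left_mono) simp
  also have "\<dots> = ennreal (t ^ d * (1 / t) ^ d) * hausdorff d (f ` E)"
    using t by (subst ennreal_mult) (auto simp: mult.assoc)
  also have "t ^ d * (1 / t) ^ d = 1" using t by (simp flip: power_mult_distrib)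
  finally show "ennreal (t ^ d) * hausdorff d E \<le> hausdorff d (f ` E)" by simp
qed

section \<open>Hausdorff measure of balls in planes and on Lipschitz graphs\<close>

lemma subspace_isometry:
  assumes d: "d \<ge> 1" and W: "subspace W" "dim W = d"
  shows "\<exists>\<iota>. (\<forall>x y. x \<in> Rn d \<longrightarrow> y \<in> Rn d \<longrightarrow> dist (\<iota> x) (\<iota> y) = dist x y) \<and> \<iota> ` Rn d = W \<and> \<iota> 0 = (0::fin_seq)"
proof -
  obtain B where B: "finite B" "B \<subseteq> W" "pairwise orthogonal B" "\<forall>b\<in>B. norm b = 1" "card B = d" "span B = W"
    using orthonormal_basis_finspan[OF finspan_of_dim[OF W d]] W(2) by blast
  obtain b where b: "bij_betw b {..<d} B"
    using ex_bij_betw_nat_finite[OF B(1)] B(5) by (auto simp: atLeast0LessThan)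
  define \<iota> where "\<iota> x = (\<Sum>i<d. coord x i *\<^sub>R b i)" for x
  have bB: "b i \<in> B" if "i < d" for i using b that by (auto simp: bij_betw_def)
  have nrm: "norm (\<iota> x) = norm x" if "x \<in> Rn d" for x
  proof -
    have "(norm (\<iota> x))\<^sup>2 = (\<Sum>i<d. (norm (coord x i *\<^sub>R b i))\<^sup>2)"
      unfolding \<iota>_def
    proof (rule norm_sum_Pythagorean)
      show "pairwise (\<lambda>i j. orthogonal (coord x i *\<^sub>R b i) (coord x j *\<^sub>R b j)) {..<d}"
      proof (rule pairwiseI)
        fix i j assume ij: "i \<in> {..<d}" "j \<in> {..<d}" "i \<noteq> j"
        then have "b i \<noteq> b j" using b by (auto simp: bij_betw_def inj_on_def)
        then have "orthogonal (b i) (b j)" using pairwiseD[OF B(3)] bB ij by simp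
        then show "orthogonal (coord x i *\<^sub>R b i) (coord x j *\<^sub>R b j)" by (simp add: orthogonal_def)
      qed
    qed simp
    also have "\<dots> = (\<Sum>i<d. (coord x i)\<^sup>2)"
      by (rule sum.cong) (use bB B(4) in auto)
    finally have "(norm (\<iota> x))\<^sup>2 = (norm x)\<^sup>2" by (simp add: norm_Rn[OF that] sum_nonneg)
    then show ?thesis by simp
  qed
  have diff: "\<iota> x - \<iota> y = \<iota> (x - y)" for x y
    by (simp add: \<iota>_def coord_simps scaleR_left_diff_distrib sum_subtractf)
  have "dist (\<iota> x) (\<iota> y) = dist x y" if "x \<in> Rn d" "y \<in> Rn d" for x y
    using nrm[OF subspace_diff[OF subspace_Rn that]] by (simp add: dist_norm diff)
  moreover have "\<iota> ` Rn d = W"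
  proof
    show "\<iota> ` Rn d \<subseteq> W"
    proof
      fix w assume "w \<in> \<iota> ` Rn d"
      then obtain x where "w = \<iota> x" by blast
      moreover have "\<iota> x \<in> W"
        unfolding \<iota>_def using bB B(2) W(1) by (intro subspace_sum subspace_mul) auto
      ultimately show "w \<in> W" by simp
    qed
    show "W \<subseteq> \<iota> ` Rn d"
    proof
      fix w assume "w \<in> W"
      then have "w \<in> range (\<lambda>u. \<Sum>v\<in>B. u v *\<^sub>R v)" using span_finite[OF B(1)] B(6) by simp
      then obtain u where "w = (\<Sum>v\<in>B. u v *\<^sub>R v)" by blast
      also have "\<dots> = (\<Sum>i<d. u (b i) *\<^sub>R b i)"
        by (rule sum.reindex_bij_betw[OF b, symmetric])
      also have "\<dots> = \<iota> (fin_seq_of d (\<lambda>i. u (b i)))" by (simp add: \<iota>_def coord_fin_seq_of)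
      finally show "w \<in> \<iota> ` Rn d" using fin_seq_of_in_Rn by blast
    qed
  qed
  moreover have "\<iota> 0 = 0" by (simp add: \<iota>_def coord_simps)
  ultimately show ?thesis by blast
qed

lemma affine_rebase:
  assumes W: "subspace W" and p: "p \<in> (+) a ` W"
  shows "(+) a ` W = (+) p ` (W :: 'a::real_vector set)"
proof -
  obtain w where w: "w \<in> W" "p = a + w" using p by blast
  show ?thesis
  proof
    show "(+) a ` W \<subseteq> (+) p ` W"
    proof
      fix x assume "x \<in> (+) a ` W"
      then obtain v where "v \<in> W" "x = a + v" by blast
      then have "x = p + (v - w)" "v - w \<in> W" using w W by (auto simp: subspace_diff)
      then show "x \<in> (+) p ` W" by blast
    qed
    show "(+) p ` W \<subseteq> (+) a ` W"
    proof
      fix x assume "x \<in> (+) p ` W"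
      then obtain v where "v \<in> W" "x = p + v" by blast
      then have "x = a + (w + v)" "w + v \<in> W" using w W by (auto simp: subspace_add)
      then show "x \<in> (+) a ` W" by blast
    qed
  qed
qed

text \<open>An isometry with \<open>Rn d\<close>, a dilation and the normalization give the value
  exactly. This is the only information about \<open>H\<^sup>d\<close> on planes, besides
  translation invariance, used for comparing flat measures, so no constant depends on the position
  of the plane in \<open>Rn n\<close>.\<close>

lemma hausdorff_plane_ball:
  assumes d: "d \<ge> 1" and W: "subspace W" "dim W = d" and p: "p \<in> (+) a ` W" and t: "t > 0"
  shows "hausdorff d ((+) a ` W \<inter> ball p t) = ennreal (t ^ d)"
proof -
  obtain \<iota> :: "fin_seq \<Rightarrow> fin_seq" where \<iota>: "\<And>x y. x \<in> Rn d \<Longrightarrow> y \<in> Rn d \<Longrightarrow> dist (\<iota> x) (\<iota> y) = dist x y"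
    "\<iota> ` Rn d = W" "\<iota> 0 = 0"
    using subspace_isometry[OF d W] by blast
  have z: "0 \<in> Rn d" using subspace_0[OF subspace_Rn] .
  define f where "f x = p + t *\<^sub>R \<iota> x" for x
  have "f ` Rn_ball d 0 1 = (+) p ` W \<inter> ball p t"
  proof
    show "f ` Rn_ball d 0 1 \<subseteq> (+) p ` W \<inter> ball p t"
    proof
      fix y assume "y \<in> f ` Rn_ball d 0 1"
      then obtain x where x: "x \<in> Rn d" "norm x < 1" "y = p + t *\<^sub>R \<iota> x"
        by (auto simp: f_def Rn_ball_def)
      have "norm (\<iota> x) = norm x" using \<iota>(1)[OF x(1) z] \<iota>(3) by simp
      then have "dist p y < t" using t x by (simp add: dist_norm)
      moreover have "t *\<^sub>R \<iota> x \<in> W" using \<iota>(2) x(1) W(1) subspace_mul by blast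
      ultimately show "y \<in> (+) p ` W \<inter> ball p t" using x(3) by simp
    qed
    show "(+) p ` W \<inter> ball p t \<subseteq> f ` Rn_ball d 0 1"
    proof
      fix x assume x: "x \<in> (+) p ` W \<inter> ball p t"
      then obtain w where w: "w \<in> W" "x = p + w" by blast
      then have "w /\<^sub>R t \<in> W" using W(1) by (simp add: subspace_mul)
      then have "w /\<^sub>R t \<in> \<iota> ` Rn d" unfolding \<iota>(2) .
      then obtain y where y: "y \<in> Rn d" "\<iota> y = w /\<^sub>R t" by (metis imageE)
      have "norm y = norm w / t" using \<iota>(1)[OF y(1) z] \<iota>(3) y(2) t by (simp add: divide_inverse mult.commute)
      also have "\<dots> < 1" using x w t by (simp add: dist_norm)
      finally have "y \<in> Rn_ball d 0 1" using y by (simp add: Rn_ball_def)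
      moreover have "x = f y" using y w t by (simp add: f_def)
      ultimately show "x \<in> f ` Rn_ball d 0 1" by blast
    qed
  qed
  moreover have "hausdorff d (f ` Rn_ball d 0 1) = ennreal (t ^ d) * hausdorff d (Rn_ball d 0 1)"
  proof (rule hausdorff_similarity[OF t])
    fix x y assume xy: "x \<in> Rn_ball d 0 1" "y \<in> Rn_ball d 0 1"
    have "f x - f y = t *\<^sub>R (\<iota> x - \<iota> y)" by (simp add: f_def scaleR_diff_right)
    then show "dist (f x) (f y) = t * dist x y"
      using \<iota>(1)[of x y] xy t by (simp add: dist_norm Rn_ball_def)
  qed
  ultimately show ?thesis
    using affine_rebase[OF W(1) p] by (simp add: hausdorff_unit_ball[OF d])
qed

lemma hausdorff_translate:
  "hausdorff d ((+) v ` E) = hausdorff d E"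
  using hausdorff_similarity[of 1 E "(+) v" d] by (simp add: dist_norm)

text \<open>The graph map is \<open>(1 + \<gamma>)\<close>-Lipschitz, and its inverse, the
  orthogonal projection onto \<open>V\<close>, is 1-Lipschitz. Hence balls of the graph and balls of
  \<open>V\<close> correspond up to the factor \<open>1 + \<gamma>\<close> in the radius.\<close>

lemma hausdorff_graph_ball:
  assumes d: "d \<ge> 1" and V: "subspace V" "dim V = d" and f: "f ` V \<subseteq> V\<^sup>\<bottom>" "\<gamma>-lipschitz_on V f"
    and v: "v \<in> V" and t: "t > 0"
  defines "G \<equiv> (\<lambda>x. x + f x) ` V"
  shows "hausdorff d (ball (v + f v) t \<inter> G) \<le> ennreal (((1 + \<gamma>) * t) ^ d)"
    and "ennreal ((t / (1 + \<gamma>)) ^ d) \<le> hausdorff d (ball (v + f v) t \<inter> G)"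
proof -
  let ?F = "\<lambda>x. x + f x"
  have g: "\<gamma> \<ge> 0" using f(2) lipschitz_on_nonneg by blast
  have fs: "finspan V" by (rule finspan_of_dim[OF V d])
  have vV: "(+) 0 ` V = V" by auto
  have hb: "hausdorff d (V \<inter> ball v s) = ennreal (s ^ d)" if "s > 0" for s
    using hausdorff_plane_ball[OF d V, of v 0 s] v that by (simp add: vV)
  have F: "(1 + \<gamma>)-lipschitz_on V ?F"
    by (intro lipschitz_on_add lipschitz_on_id f(2))
  have proj: "orthoproj V (?F x) = x" if "x \<in> V" for x
  proof (rule orthoproj_unique[OF fs that])
    fix w assume "w \<in> V"
    moreover have "f x \<in> V\<^sup>\<bottom>" using f(1) that by blast
    ultimately show "(?F x - x) \<bullet> w = 0" by (auto simp: orthogonal_comp_def orthogonal_def inner_commute)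
  qed
  have P: "1-lipschitz_on S (orthoproj V)" for S
  proof (rule lipschitz_onI)
    fix x y :: fin_seq
    show "dist (orthoproj V x) (orthoproj V y) \<le> 1 * dist x y"
      using norm_orthoproj_le(1)[OF fs, of "x - y"] linear_diff[OF linear_orthoproj[OF fs], of x y]
      by (simp add: dist_norm)
  qed simp
  have pd: "dist x y \<le> dist (?F x) (?F y)" if "x \<in> V" "y \<in> V" for x y
    using lipschitz_onD[OF P[of UNIV], of "?F x" "?F y"] proj that by simp
  have "ball (?F v) t \<inter> G \<subseteq> ?F ` (V \<inter> ball v t)"
    using pd[OF v] by (force simp: G_def)
  then have "hausdorff d (ball (?F v) t \<inter> G) \<le> hausdorff d (?F ` (V \<inter> ball v t))" by (rule hausdorff_mono)
  also have "\<dots> \<le> ennreal ((1 + \<gamma>) ^ d) * hausdorff d (V \<inter> ball v t)"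
    by (rule hausdorff_lipschitz) (use g F in \<open>auto intro: lipschitz_on_subset\<close>)
  also have "\<dots> = ennreal (((1 + \<gamma>) * t) ^ d)"
    using g t by (simp add: hb power_mult_distrib ennreal_mult)
  finally show "hausdorff d (ball (v + f v) t \<inter> G) \<le> ennreal (((1 + \<gamma>) * t) ^ d)" .
  let ?s = "t / (1 + \<gamma>)"
  have s: "?s > 0" using t g by simp
  have img: "?F ` (V \<inter> ball v ?s) \<subseteq> ball (?F v) t \<inter> G"
  proof
    fix z assume "z \<in> ?F ` (V \<inter> ball v ?s)"
    then obtain x where x: "x \<in> V" "dist v x < ?s" "z = ?F x" by auto
    have "dist (?F v) (?F x) \<le> (1 + \<gamma>) * dist v x" by (rule lipschitz_onD[OF F v x(1)])
    also have "\<dots> < (1 + \<gamma>) * ?s" using x g by (intro mult_strict_left_mono) auto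
    also have "\<dots> = t" using g by simp
    finally show "z \<in> ball (?F v) t \<inter> G" using x by (auto simp: G_def)
  qed
  have "V \<inter> ball v ?s = orthoproj V ` ?F ` (V \<inter> ball v ?s)"
    using proj by (force simp: image_image)
  then have "hausdorff d (V \<inter> ball v ?s) \<le> ennreal (1 ^ d) * hausdorff d (?F ` (V \<inter> ball v ?s))"
    using hausdorff_lipschitz[where L = 1 and d = d and f = "orthoproj V" and E = "?F ` (V \<inter> ball v ?s)", OF _ P] by simp
  also have "\<dots> \<le> hausdorff d (ball (?F v) t \<inter> G)" using hausdorff_mono[OF img] by simp
  finally show "ennreal ((t / (1 + \<gamma>)) ^ d) \<le> hausdorff d (ball (v + f v) t \<inter> G)"
    by (simp add: hb[OF s])
qed

section \<open>Kirszbraun's extension theorem\<close>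

text \<open>A variance is expressed through mutual distances alone, so a map that does not increase
  distances does not increase variances. In this form the Lipschitz hypothesis enters Kirszbraun's
  theorem.\<close>

lemma weighted_variance_identity:
  fixes f :: "'i \<Rightarrow> 'a::real_inner"
  assumes "finite E" "sum u E = 1"
  shows "(\<Sum>e\<in>E. u e * (norm (f e))\<^sup>2) - (norm (\<Sum>e\<in>E. u e *\<^sub>R f e))\<^sup>2
    = (\<Sum>e\<in>E. \<Sum>e'\<in>E. u e * u e' * (norm (f e - f e'))\<^sup>2) / 2"
proof -
  have "(\<Sum>e\<in>E. \<Sum>e'\<in>E. u e * u e' * (norm (f e - f e'))\<^sup>2)
    = (\<Sum>e\<in>E. \<Sum>e'\<in>E. (u e * (norm (f e))\<^sup>2) * u e' + u e * (u e' * (norm (f e'))\<^sup>2) - 2 * ((u e *\<^sub>R f e) \<bullet> (u e' *\<^sub>R f e')))"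
    by (intro sum.cong refl)
      (simp add: power2_norm_eq_inner inner_diff_left inner_diff_right inner_commute algebra_simps)
  also have "\<dots> = (\<Sum>e\<in>E. \<Sum>e'\<in>E. (u e * (norm (f e))\<^sup>2) * u e')
      + (\<Sum>e\<in>E. \<Sum>e'\<in>E. u e * (u e' * (norm (f e'))\<^sup>2))
      - 2 * (\<Sum>e\<in>E. \<Sum>e'\<in>E. (u e *\<^sub>R f e) \<bullet> (u e' *\<^sub>R f e'))"
    by (simp only: sum.distrib sum_subtractf sum_distrib_left)
  also have "(\<Sum>e\<in>E. \<Sum>e'\<in>E. (u e *\<^sub>R f e) \<bullet> (u e' *\<^sub>R f e')) = (\<Sum>e\<in>E. u e *\<^sub>R f e) \<bullet> (\<Sum>e\<in>E. u e *\<^sub>R f e)"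
    unfolding inner_sum_left unfolding inner_sum_right ..
  also have "(\<Sum>e\<in>E. \<Sum>e'\<in>E. (u e * (norm (f e))\<^sup>2) * u e') = (\<Sum>e\<in>E. u e * (norm (f e))\<^sup>2) * sum u E"
    by (rule sum_product[symmetric])
  also have "(\<Sum>e\<in>E. \<Sum>e'\<in>E. u e * (u e' * (norm (f e'))\<^sup>2)) = sum u E * (\<Sum>e\<in>E. u e * (norm (f e))\<^sup>2)"
    by (rule sum_product[symmetric])
  finally show ?thesis using assms(2) by (simp add: power2_norm_eq_inner)
qed

text \<open>
  The point \<open>q\<close> comes from a maximizer of the concave function \<open>s - |y|\<^sup>2\<close> on the convex hull of the points
  \<open>(x, y, |y|\<^sup>2 - |p - x|\<^sup>2)\<close>; its maximum is at most 0 because both variances can be compared.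
\<close>
lemma kirszbraun_finite_point:
  fixes S :: "('a::real_inner \<times> 'b::real_inner) set"
  assumes fin: "finite S" and ne: "S \<noteq> {}"
    and lip: "\<And>x y x' y'. (x, y) \<in> S \<Longrightarrow> (x', y') \<in> S \<Longrightarrow> norm (y - y') \<le> norm (x - x')"
  shows "\<exists>q\<in>convex hull (snd ` S). \<forall>(x, y)\<in>S. norm (q - y) \<le> norm (p - x)"
proof -
  define s where "s = (\<lambda>(x :: 'a, y :: 'b). (norm y)\<^sup>2 - (norm (p - x))\<^sup>2)"
  define E where "E = (\<lambda>z. (fst z, snd z, s z)) ` S"
  have finE: "finite E" and neE: "E \<noteq> {}" using fin ne by (auto simp: E_def)
  define g where "g = (\<lambda>z :: 'a \<times> 'b \<times> real. snd (snd z) - (norm (fst (snd z)))\<^sup>2)"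
  have "compact (convex hull E)" by (rule finite_imp_compact_convex_hull[OF finE])
  moreover have "convex hull E \<noteq> {}" using neE by simp
  moreover have "continuous_on (convex hull E) g" unfolding g_def by (intro continuous_intros)
  ultimately have "\<exists>z\<in>convex hull E. \<forall>w\<in>convex hull E. g w \<le> g z"
    by (rule continuous_attains_sup)
  then obtain z where z: "z \<in> convex hull E" "\<And>w. w \<in> convex hull E \<Longrightarrow> g w \<le> g z"
    by blast
  obtain u where u: "\<And>e. e \<in> E \<Longrightarrow> 0 \<le> u e" "sum u E = 1" "(\<Sum>e\<in>E. u e *\<^sub>R e) = z"
    using z(1) unfolding convex_hull_finite[OF finE] by blast
  define q where "q = fst (snd z)"
  have q: "q = (\<Sum>e\<in>E. u e *\<^sub>R fst (snd e))" unfolding q_def u(3)[symmetric] by (simp add: fst_sum snd_sum)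
  have sz: "snd (snd z) = (\<Sum>e\<in>E. u e * snd (snd e))" unfolding u(3)[symmetric] by (simp add: snd_sum)
  have Es: "snd (snd e) = (norm (fst (snd e)))\<^sup>2 - (norm (p - fst e))\<^sup>2" if "e \<in> E" for e
    using that by (auto simp: E_def s_def case_prod_unfold)
  have "g z = (\<Sum>e\<in>E. u e * ((norm (fst (snd e)))\<^sup>2 - (norm (p - fst e))\<^sup>2)) - (norm q)\<^sup>2"
    unfolding g_def sz q_def[symmetric] using Es by simp
  also have "\<dots> = ((\<Sum>e\<in>E. u e * (norm (fst (snd e)))\<^sup>2) - (norm (\<Sum>e\<in>E. u e *\<^sub>R fst (snd e)))\<^sup>2)
      - (\<Sum>e\<in>E. u e * (norm (p - fst e))\<^sup>2)"
    unfolding q by (simp add: right_diff_distrib sum_subtractf)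
  also have "(\<Sum>e\<in>E. u e * (norm (fst (snd e)))\<^sup>2) - (norm (\<Sum>e\<in>E. u e *\<^sub>R fst (snd e)))\<^sup>2
      = (\<Sum>e\<in>E. \<Sum>e'\<in>E. u e * u e' * (norm (fst (snd e) - fst (snd e')))\<^sup>2) / 2"
    by (rule weighted_variance_identity[OF finE u(2)])
  \<comment> \<open>The variance of the second components is at most that of the first ones. The
    latter is the second moment about \<open>p\<close>, which cancels, minus a square.\<close>
  also have "\<dots> \<le> (\<Sum>e\<in>E. \<Sum>e'\<in>E. u e * u e' * (norm ((p - fst e) - (p - fst e')))\<^sup>2) / 2"
  proof (intro divide_right_mono sum_mono mult_left_mono power_mono)
    fix e e' assume e: "e \<in> E" "e' \<in> E"
    have "(fst e, fst (snd e)) \<in> S" "(fst e', fst (snd e')) \<in> S" using e by (auto simp: E_def)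
    from lip[OF this] show "norm (fst (snd e) - fst (snd e')) \<le> norm ((p - fst e) - (p - fst e'))"
      by (simp add: norm_minus_commute)
    show "0 \<le> u e * u e'" using u(1) e by simp
  qed auto
  also have "\<dots> = (\<Sum>e\<in>E. u e * (norm (p - fst e))\<^sup>2) - (norm (\<Sum>e\<in>E. u e *\<^sub>R (p - fst e)))\<^sup>2"
    by (rule weighted_variance_identity[OF finE u(2), symmetric])
  finally have gz: "g z \<le> 0" using zero_le_power2[of "norm (\<Sum>e\<in>E. u e *\<^sub>R (p - fst e))"] by linarith
  have "norm (q - y) \<le> norm (p - x)" if xy: "(x, y) \<in> S" for x y
  proof -
    define a where "a = s (x, y)"
    define \<sigma> where "\<sigma> = snd (snd z)"
    have e: "(x, y, a) \<in> E" using xy by (force simp: E_def a_def)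
    \<comment> \<open>Maximality of \<open>g\<close> at \<open>z\<close> along the segment to the
      point of \<open>E\<close> over \<open>(x, y)\<close>, divided by \<open>t\<close>. Letting
      \<open>t\<close> tend to 0 gives the first-order condition from which the distance bound
      follows.\<close>
    have ineq: "(a - \<sigma>) - 2 * (q \<bullet> (y - q)) \<le> t * (norm (y - q))\<^sup>2" if t: "0 < t" "t \<le> 1" for t
    proof -
      have "(1 - t) *\<^sub>R z + t *\<^sub>R (x, y, a) \<in> convex hull E"
        using t by (intro convexD[OF convex_convex_hull z(1) hull_inc[OF e]]) auto
      from z(2)[OF this] have "((1 - t) * \<sigma> + t * a) - (norm ((1 - t) *\<^sub>R q + t *\<^sub>R y))\<^sup>2 \<le> \<sigma> - (norm q)\<^sup>2"
        by (simp add: g_def q_def \<sigma>_def)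
      moreover have "(1 - t) *\<^sub>R q + t *\<^sub>R y = q + t *\<^sub>R (y - q)" by (simp add: algebra_simps)
      moreover have "(norm (q + t *\<^sub>R (y - q)))\<^sup>2 = (norm q)\<^sup>2 + 2 * t * (q \<bullet> (y - q)) + t\<^sup>2 * (norm (y - q))\<^sup>2"
        unfolding power2_norm_eq_inner by (simp add: inner_add_left inner_add_right inner_commute power2_eq_square)
      ultimately have "t * ((a - \<sigma>) - 2 * (q \<bullet> (y - q))) \<le> t * (t * (norm (y - q))\<^sup>2)"
        by (simp add: algebra_simps power2_eq_square)
      then show ?thesis using t by simp
    qed
    have "(a - \<sigma>) - 2 * (q \<bullet> (y - q)) \<le> 0"
    proof (rule field_le_epsilon)
      fix e :: real assume e: "0 < e"
      define t where "t = min 1 (e / ((norm (y - q))\<^sup>2 + 1))"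
      have np: "0 < (norm (y - q))\<^sup>2 + 1" by (simp add: add_nonneg_pos)
      then have "0 < t" "t \<le> 1" using e by (auto simp: t_def)
      have "t * (norm (y - q))\<^sup>2 \<le> (e / ((norm (y - q))\<^sup>2 + 1)) * ((norm (y - q))\<^sup>2 + 1)"
        using \<open>0 < t\<close> e by (intro mult_mono) (auto simp: t_def)
      also have "\<dots> = e" using np by simp
      finally show "(a - \<sigma>) - 2 * (q \<bullet> (y - q)) \<le> 0 + e" using ineq[OF \<open>0 < t\<close> \<open>t \<le> 1\<close>] by simp
    qed
    moreover have "(norm (q - y))\<^sup>2 = (norm y)\<^sup>2 - (norm q)\<^sup>2 - 2 * (q \<bullet> (y - q))"
      unfolding power2_norm_eq_inner by (simp add: inner_diff_left inner_diff_right inner_commute)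
    moreover have "g z = \<sigma> - (norm q)\<^sup>2" by (simp add: g_def \<sigma>_def q_def)
    ultimately have "(norm (q - y))\<^sup>2 \<le> (norm (p - x))\<^sup>2"
      using gz by (simp add: a_def s_def)
    then show ?thesis by (rule power2_le_imp_le) simp
  qed
  moreover have "q \<in> convex hull (snd ` S)"
    unfolding q
  proof (rule convex_sum[OF finE convex_convex_hull u(2)])
    show "fst (snd e) \<in> convex hull (snd ` S)" if "e \<in> E" for e
      using that by (intro hull_inc) (force simp: E_def)
  qed (rule u(1))
  ultimately show ?thesis by blast
qed

text \<open>Zorn's lemma on graphs, kept as relations: the distance estimate with equal arguments
  makes them single-valued. A new point \<open>p\<close> needs a value in the intersection of the
  sets \<open>cball y (L * dist x p) \<inter> T\<close>; these are compact, so finitely many of them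
  suffice, and \<open>kirszbraun_finite_point\<close> supplies the value. A convex target
  \<open>T\<close> absorbs the convex hull found there; it will be the orthogonal complement of
  \<open>V\<close> in \<open>Rn n\<close>.\<close>

lemma kirszbraun_extension:
  fixes D V :: "'a::real_inner set" and T :: "'b::real_inner set"
  assumes L: "L \<ge> 0" and f: "L-lipschitz_on D f" "f ` D \<subseteq> T" and D: "D \<subseteq> V"
    and T: "convex T" "T \<noteq> {}" "\<And>y r. compact (cball y r \<inter> T)"
  shows "\<exists>g. L-lipschitz_on V g \<and> g ` V \<subseteq> T \<and> (\<forall>x\<in>D. g x = f x)"
proof -
  define \<F> where "\<F> = {G. G \<subseteq> V \<times> T \<and> (\<forall>(x, y)\<in>G. \<forall>(x', y')\<in>G. dist y y' \<le> L * dist x x') \<and> (\<lambda>x. (x, f x)) ` D \<subseteq> G}"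
  have \<F>I: "G \<in> \<F>" if "G \<subseteq> V \<times> T"
    "\<And>x y x' y'. (x, y) \<in> G \<Longrightarrow> (x', y') \<in> G \<Longrightarrow> dist y y' \<le> L * dist x x'" "(\<lambda>x. (x, f x)) ` D \<subseteq> G" for G
    using that unfolding \<F>_def by blast
  have \<F>1: "G \<subseteq> V \<times> T" "(\<lambda>x. (x, f x)) ` D \<subseteq> G" if "G \<in> \<F>" for G
    using that unfolding \<F>_def by blast+
  have \<F>2: "dist y y' \<le> L * dist x x'" if "G \<in> \<F>" "(x, y) \<in> G" "(x', y') \<in> G" for G x y x' y'
    using that unfolding \<F>_def by blast
  have f\<F>: "(\<lambda>x. (x, f x)) ` D \<in> \<F>"
  proof (rule \<F>I)
    show "(\<lambda>x. (x, f x)) ` D \<subseteq> V \<times> T" using f(2) D by blast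
    fix x y x' y' assume "(x, y) \<in> (\<lambda>x. (x, f x)) ` D" "(x', y') \<in> (\<lambda>x. (x, f x)) ` D"
    then have "x \<in> D" "x' \<in> D" "y = f x" "y' = f x'" by auto
    then show "dist y y' \<le> L * dist x x'" using lipschitz_onD[OF f(1)] by simp
  qed simp
  have "\<exists>G\<in>\<F>. \<forall>X\<in>\<F>. G \<subseteq> X \<longrightarrow> X = G"
  proof (rule subset_Zorn_nonempty)
    show "\<F> \<noteq> {}" using f\<F> by blast
    fix C assume "C \<noteq> {}" and C: "subset.chain \<F> C"
    then have CF: "C \<subseteq> \<F>" and ch: "\<And>X Y. X \<in> C \<Longrightarrow> Y \<in> C \<Longrightarrow> X \<subseteq> Y \<or> Y \<subseteq> X"
      by (auto simp: subset.chain_def)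
    show "\<Union>C \<in> \<F>"
    proof (rule \<F>I)
      show "\<Union>C \<subseteq> V \<times> T" using CF \<F>1(1) by blast
      show "(\<lambda>x. (x, f x)) ` D \<subseteq> \<Union>C" using CF \<F>1(2) \<open>C \<noteq> {}\<close> by blast
      fix x y x' y' assume "(x, y) \<in> \<Union>C" "(x', y') \<in> \<Union>C"
      then obtain X where "X \<in> C" "(x, y) \<in> X" "(x', y') \<in> X" using ch by blast
      then show "dist y y' \<le> L * dist x x'" using \<F>2[of X] CF by blast
    qed
  qed
  then obtain G where G: "G \<in> \<F>" and max: "\<And>X. X \<in> \<F> \<Longrightarrow> G \<subseteq> X \<Longrightarrow> X = G" by blast
  have tot: "\<exists>y. (p, y) \<in> G" if p: "p \<in> V" for p
  proof -
    have "\<exists>q. q \<in> T \<and> (\<forall>x y. (x, y) \<in> G \<longrightarrow> dist y q \<le> L * dist x p)"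
    proof (cases "G = {}")
      case False
      define \<K> where "\<K> = (\<lambda>(x, y). cball y (L * dist x p) \<inter> T) ` G"
      obtain x0 y0 where xy0: "(x0, y0) \<in> G" using False by auto
      have "(cball y0 (L * dist x0 p) \<inter> T) \<inter> \<Inter>\<K> \<noteq> {}"
      proof (rule compact_imp_fip)
        show "compact (cball y0 (L * dist x0 p) \<inter> T)" by (rule T(3))
        show "closed K" if "K \<in> \<K>" for K
        proof -
          obtain z where "K = (\<lambda>(x, y). cball y (L * dist x p) \<inter> T) z" using \<open>K \<in> \<K>\<close> unfolding \<K>_def by blast
          then show ?thesis using compact_imp_closed[OF T(3)] by (cases z) simp
        qed
        fix \<K>' assume K': "finite \<K>'" "\<K>' \<subseteq> \<K>"
        show "(cball y0 (L * dist x0 p) \<inter> T) \<inter> \<Inter>\<K>' \<noteq> {}"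
        proof -
          obtain G0 where G0: "G0 \<subseteq> G" "finite G0" "\<K>' = (\<lambda>(x, y). cball y (L * dist x p) \<inter> T) ` G0"
            using finite_subset_image[OF K'[unfolded \<K>_def]] by blast
          define G' where "G' = insert (x0, y0) G0"
          have G': "finite G'" "G' \<subseteq> G" using G0 xy0 by (auto simp: G'_def)
          \<comment> \<open>Scaling the arguments turns the Lipschitz constant into 1. As
            \<open>S\<close> is a relation, the collisions of arguments for \<open>L = 0\<close> do
            no harm.\<close>
          define S where "S = (\<lambda>(x, y). (L *\<^sub>R x, y)) ` G'"
          have "\<exists>q\<in>convex hull (snd ` S). \<forall>(x, y)\<in>S. norm (q - y) \<le> norm (L *\<^sub>R p - x)"
          proof (rule kirszbraun_finite_point)
            show "finite S" using G'(1) by (simp add: S_def)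
            show "S \<noteq> {}" by (auto simp: S_def G'_def)
            fix x y x' y' assume "(x, y) \<in> S" "(x', y') \<in> S"
            then obtain a a' where a: "(a, y) \<in> G'" "(a', y') \<in> G'" "x = L *\<^sub>R a" "x' = L *\<^sub>R a'"
              by (auto simp: S_def)
            have "dist y y' \<le> L * dist a a'" using \<F>2[OF G] a G'(2) by blast
            then show "norm (y - y') \<le> norm (x - x')"
              using L unfolding a(3,4) by (simp add: dist_norm flip: scaleR_diff_right)
          qed
          then obtain q where q: "q \<in> convex hull (snd ` S)" "\<And>x y. (x, y) \<in> S \<Longrightarrow> norm (q - y) \<le> norm (L *\<^sub>R p - x)"
            by blast
          have "snd ` S \<subseteq> T" using \<F>1(1)[OF G] G'(2) by (auto simp: S_def)
          then have "q \<in> T" using q(1) hull_minimal[of "snd ` S" T convex] T(1) by blast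
          moreover have "q \<in> cball y (L * dist x p)" if "(x, y) \<in> G'" for x y
          proof -
            have "(L *\<^sub>R x, y) \<in> S" using that by (force simp: S_def)
            from q(2)[OF this] show ?thesis
              using L by (simp add: dist_norm norm_minus_commute flip: scaleR_diff_right)
          qed
          ultimately have "q \<in> (cball y0 (L * dist x0 p) \<inter> T) \<inter> \<Inter>\<K>'"
            unfolding G0(3) G'_def by auto
          then show ?thesis by blast
        qed
      qed
      then obtain q where q: "q \<in> T" "q \<in> \<Inter>\<K>" by blast
      have "dist y q \<le> L * dist x p" if "(x, y) \<in> G" for x y
      proof -
        have "cball y (L * dist x p) \<inter> T \<in> \<K>" unfolding \<K>_def using that by force
        then have "q \<in> cball y (L * dist x p)" using q(2) by blast
        then show ?thesis by simp
      qed
      then show ?thesis using q(1) by blast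
    qed (use T(2) in auto)
    then obtain q where q: "q \<in> T" "\<And>x y. (x, y) \<in> G \<Longrightarrow> dist y q \<le> L * dist x p"
      by blast
    have "insert (p, q) G \<in> \<F>"
    proof (rule \<F>I)
      show "insert (p, q) G \<subseteq> V \<times> T" using \<F>1[OF G] p q by blast
      show "(\<lambda>x. (x, f x)) ` D \<subseteq> insert (p, q) G" using \<F>1[OF G] by blast
      fix x y x' y' assume "(x, y) \<in> insert (p, q) G" "(x', y') \<in> insert (p, q) G"
      then consider "(x, y) = (p, q)" "(x', y') = (p, q)" | "(x, y) = (p, q)" "(x', y') \<in> G"
        | "(x, y) \<in> G" "(x', y') = (p, q)" | "(x, y) \<in> G" "(x', y') \<in> G" by blast
      then show "dist y y' \<le> L * dist x x'"
      proof cases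
        case 2
        then show ?thesis using q(2)[of x' y'] by (simp add: dist_commute)
      next
        case 3
        then show ?thesis using q(2)[of x y] by simp
      next
        case 4
        then show ?thesis using \<F>2[OF G] by blast
      qed auto
    qed
    then show ?thesis using max by blast
  qed
  then obtain g where g: "\<And>p. p \<in> V \<Longrightarrow> (p, g p) \<in> G" by metis
  have "L-lipschitz_on V g" by (rule lipschitz_onI) (use \<F>2[OF G] g L in blast)+
  moreover have "g ` V \<subseteq> T" using g \<F>1(1)[OF G] by blast
  moreover have "g x = f x" if "x \<in> D" for x
  proof -
    have "(x, g x) \<in> G" "(x, f x) \<in> G" using that D g \<F>1(2)[OF G] by blast+
    then have "dist (g x) (f x) \<le> L * dist x x" using \<F>2[OF G] by blast
    then show ?thesis by simp
  qed
  ultimately show ?thesis by blast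
qed

section \<open>Closedness and compactness in \<open>Rn n\<close>\<close>

lemma closed_Rn: "closed (Rn n)"
proof -
  have "Rn n = (\<Inter>i\<in>{n..}. {x. coord x i = 0})" by (auto simp: Rn_def)
  moreover have "closed {x. coord x i = 0}" for i
  proof (rule closed_Collect_eq)
    show "continuous_on UNIV (\<lambda>x. coord x i)"
    proof (rule lipschitz_on_continuous_on)
      show "1-lipschitz_on UNIV (\<lambda>x. coord x i)"
      proof (rule lipschitz_onI)
        fix x y :: fin_seq
        show "dist (coord x i) (coord y i) \<le> 1 * dist x y"
          using abs_coord_le_norm[of "x - y" i] by (simp add: dist_norm coord_simps)
      qed simp
    qed
  qed simp
  ultimately show ?thesis by auto
qed

text \<open>Closed balls of the infinite-dimensional ambient space are not compact, so compactness
  is obtained by adding one coordinate at a time: the ball in \<open>Rn (Suc n)\<close> is a closed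
  part of a continuous image of a product with an interval.\<close>

lemma compact_cball_Rn: "compact (cball y r \<inter> Rn n)"
proof -
  have *: "compact (cball 0 R \<inter> Rn n)" for R
  proof (induction n)
    case 0
    have "Rn 0 = {0}" by (auto simp: Rn_def coord_simps intro: fin_seq_eqI)
    then have "cball 0 R \<inter> Rn 0 = (if R \<ge> 0 then {0} else {})" by auto
    then show ?case by simp
  next
    case (Suc n)
    define b where "b = fin_seq_of (Suc n) (\<lambda>i. if i = n then 1 else 0)"
    have cb: "coord b i = (if i = n then 1 else 0)" for i by (auto simp: b_def coord_fin_seq_of)
    define h where "h = (\<lambda>z :: fin_seq \<times> real. fst z + snd z *\<^sub>R b)"
    have "compact ((cball 0 R \<inter> Rn n) \<times> {-R..R})" using Suc by (intro compact_Times) auto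
    then have "compact (h ` ((cball 0 R \<inter> Rn n) \<times> {-R..R}))"
      by (intro compact_continuous_image) (auto simp: h_def intro!: continuous_intros)
    moreover have "cball 0 R \<inter> Rn (Suc n) \<subseteq> h ` ((cball 0 R \<inter> Rn n) \<times> {-R..R})"
    proof
      fix x assume x: "x \<in> cball 0 R \<inter> Rn (Suc n)"
      define x' where "x' = x - coord x n *\<^sub>R b"
      have x'n: "x' \<in> Rn n" using x by (auto simp: x'_def Rn_def coord_simps cb)
      have "norm x' \<le> norm x"
        unfolding norm_Rn[OF x'n] norm_Rn[of x "Suc n", OF IntD2[OF x]]
        by (intro real_sqrt_le_mono) (auto simp: x'_def coord_simps cb lessThan_Suc intro!: sum_mono add_increasing)
      then have "x' \<in> cball 0 R \<inter> Rn n" using x x'n by simp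
      moreover have "coord x n \<in> {-R..R}" using x abs_coord_le_norm[of x n] by auto
      moreover have "x = h (x', coord x n)" by (simp add: h_def x'_def)
      ultimately show "x \<in> h ` ((cball 0 R \<inter> Rn n) \<times> {-R..R})" by blast
    qed
    ultimately show ?case
      using closed_Int[OF closed_cball closed_Rn] compact_Int_closed[of _ "cball 0 R \<inter> Rn (Suc n)"]
      by (metis Int_absorb1 )
  qed
  have "cball y r \<inter> Rn n = (cball 0 (norm y + r) \<inter> Rn n) \<inter> cball y r"
  proof -
    have "norm z \<le> norm y + r" if "dist y z \<le> r" for z
      using that norm_triangle_ineq2[of z y] by (simp add: dist_norm norm_minus_commute)
    then show ?thesis by auto
  qed
  then show ?thesis using compact_Int_closed[OF * closed_cball] by metis
qed

section \<open>Test functions and flat measures\<close>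

definition test_fun :: "'a::metric_space \<Rightarrow> real \<Rightarrow> ('a \<Rightarrow> real) \<Rightarrow> bool" where
  "test_fun y s \<phi> \<longleftrightarrow> 1-lipschitz_on UNIV \<phi> \<and> (\<forall>z. z \<notin> ball y s \<longrightarrow> \<phi> z = 0)"

definition tent :: "'a::metric_space \<Rightarrow> real \<Rightarrow> 'a \<Rightarrow> real" where
  "tent p \<sigma> z = max 0 (\<sigma> - dist z p)"

lemma lipschitz_1I: "(\<And>x y. \<phi> x \<le> \<phi> y + dist x y) \<Longrightarrow> 1-lipschitz_on UNIV (\<phi> :: 'a::metric_space \<Rightarrow> real)"
proof (rule lipschitz_onI)
  fix x y assume "\<And>x y. \<phi> x \<le> \<phi> y + dist x y"
  from this[of x y] this[of y x] show "dist (\<phi> x) (\<phi> y) \<le> 1 * dist x y"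
    by (simp add: dist_real_def abs_le_iff dist_commute)
qed simp

lemma lipschitz_1D: "1-lipschitz_on UNIV (\<phi> :: 'a::metric_space \<Rightarrow> real) \<Longrightarrow> \<phi> x \<le> \<phi> y + dist x y"
  using lipschitz_onD[of 1 UNIV \<phi> x y] by (simp add: dist_real_def abs_le_iff)

lemma tent_1D: "tent p \<sigma> x \<le> tent p \<sigma> y + dist x y"
  using dist_triangle2[of y p x] dist_triangle[of y p x] by (auto simp: tent_def dist_commute)

lemma tent_bounds: "0 \<le> tent p \<sigma> z" "\<sigma> \<ge> 0 \<Longrightarrow> tent p \<sigma> z \<le> \<sigma>" "z \<notin> ball p \<sigma> \<Longrightarrow> tent p \<sigma> z = 0"
  by (auto simp: tent_def dist_commute)

lemma tent_ge: "z \<in> ball p \<rho> \<Longrightarrow> \<sigma> - \<rho> \<le> tent p \<sigma> z"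
  by (auto simp: tent_def dist_commute)

lemma test_fun_tent: "ball p \<sigma> \<subseteq> ball y s \<Longrightarrow> test_fun y s (tent p \<sigma>)"
  unfolding test_fun_def using tent_1D tent_bounds(3) by (blast intro: lipschitz_1I)

lemma test_fun_min_tent:
  assumes "ball p \<sigma> \<subseteq> ball y s" "\<And>z. 0 \<le> g z" "\<And>u v. g u \<le> g v + dist u v"
  shows "test_fun y s (\<lambda>z. min (g z) (tent p \<sigma> z))"
  unfolding test_fun_def
proof (intro conjI allI impI)
  show "1-lipschitz_on UNIV (\<lambda>z. min (g z) (tent p \<sigma> z))"
  proof (rule lipschitz_1I)
    fix u v show "min (g u) (tent p \<sigma> u) \<le> min (g v) (tent p \<sigma> v) + dist u v"
      using assms(3)[of u v] tent_1D[of p \<sigma> u v] by linarith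
  qed
  fix z assume "z \<notin> ball y s"
  then have "tent p \<sigma> z = 0" using assms(1) tent_bounds(3) by blast
  then show "min (g z) (tent p \<sigma> z) = 0" using assms(2)[of z] by simp
qed

lemma test_fun_measurable: "test_fun y s \<phi> \<Longrightarrow> \<phi> \<in> borel_measurable borel"
  unfolding test_fun_def by (intro borel_measurable_continuous_onI lipschitz_on_continuous_on) auto

locale ball_finite_measure =
  fixes N :: "'a::metric_space measure"
  assumes sets_N: "sets N = sets borel" and fin_N: "\<And>y s. emeasure N (ball y s) < \<infinity>"
begin

lemma space_N: "space N = UNIV"
  using sets_eq_imp_space_eq[OF sets_N] by simp

lemma measurable_N: "f \<in> borel_measurable borel \<Longrightarrow> f \<in> borel_measurable N"
  using measurable_cong_sets[OF sets_N refl] by blast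

lemma integrable_ball: "integrable N (\<lambda>z. \<kappa> * indicator (ball p \<sigma>) z :: real)"
  using fin_N by (intro integrable_mult_right integrable_real_indicator) (auto simp: sets_N)

lemma integral_ball: "(\<integral>z. \<kappa> * indicator (ball p \<sigma>) z \<partial>N) = \<kappa> * measure N (ball p \<sigma>)"
  by (simp add: space_N)

lemma integrable_test:
  assumes "test_fun y s \<phi>"
  shows "integrable N \<phi>"
proof (rule integrableI_bounded_set[where A = "ball y s" and B = "\<bar>\<phi> y\<bar> + s"])
  show "\<phi> \<in> borel_measurable N" by (rule measurable_N[OF test_fun_measurable[OF assms]])
  have lip: "1-lipschitz_on UNIV \<phi>" using assms by (simp add: test_fun_def)
  show "AE x\<in>ball y s in N. norm (\<phi> x) \<le> \<bar>\<phi> y\<bar> + s"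
  proof (rule AE_I2, rule impI)
    fix x assume "x \<in> ball y s"
    then show "norm (\<phi> x) \<le> \<bar>\<phi> y\<bar> + s"
      using lipschitz_1D[OF lip, of x y] lipschitz_1D[OF lip, of y x] by (auto simp: dist_commute)
  qed
  show "AE x in N. x \<notin> ball y s \<longrightarrow> \<phi> x = 0" using assms by (simp add: test_fun_def)
qed (use fin_N sets_N in auto)

lemma integral_test_le:
  assumes "test_fun y s \<phi>" "AE z in N. \<phi> z \<le> \<kappa> * indicator (ball p \<sigma>) z"
  shows "(\<integral>z. \<phi> z \<partial>N) \<le> \<kappa> * measure N (ball p \<sigma>)"
  using integral_mono_AE[OF integrable_test[OF assms(1)] integrable_ball assms(2)]
  unfolding integral_ball .

lemma integral_test_ge:
  assumes "test_fun y s \<phi>" "AE z in N. \<kappa> * indicator (ball p \<sigma>) z \<le> \<phi> z"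
  shows "\<kappa> * measure N (ball p \<sigma>) \<le> (\<integral>z. \<phi> z \<partial>N)"
  using integral_mono_AE[OF integrable_ball integrable_test[OF assms(1)] assms(2)]
  unfolding integral_ball .

lemma measure_ball_mono: "ball y s \<subseteq> ball z t \<Longrightarrow> measure N (ball y s) \<le> measure N (ball z t)"
  using fin_N[of z t] by (intro measure_mono_fmeasurable) (auto simp: sets_N fmeasurable_def)

lemma tent_integral_ge:
  assumes "ball z \<rho> \<subseteq> ball y s" "\<rho> \<ge> 0"
  shows "\<rho> / 2 * measure N (ball z (\<rho> / 2)) \<le> (\<integral>u. tent z \<rho> u \<partial>N)"
proof (rule integral_test_ge[OF test_fun_tent[OF assms(1)]])
  show "AE u in N. \<rho> / 2 * indicator (ball z (\<rho> / 2)) u \<le> tent z \<rho> u"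
  proof (rule AE_I2)
    fix u
    show "\<rho> / 2 * indicator (ball z (\<rho> / 2)) u \<le> tent z \<rho> u"
      using tent_ge[of u z "\<rho> / 2" \<rho>] tent_bounds(1)[of z \<rho> u] by (auto simp: indicator_def)
  qed
qed

end

section \<open>Distance to a plane, and integration on planes\<close>

definition plane_proj :: "'a::real_inner \<Rightarrow> 'a set \<Rightarrow> 'a \<Rightarrow> 'a" where
  "plane_proj a W z = a + orthoproj W (z - a)"

definition plane_dist :: "'a::real_inner \<Rightarrow> 'a set \<Rightarrow> 'a \<Rightarrow> real" where
  "plane_dist a W z = dist z (plane_proj a W z)"

lemma plane_proj_in: "finspan W \<Longrightarrow> plane_proj a W z \<in> (+) a ` W"
  by (auto simp: plane_proj_def orthoproj_in)

lemma plane_dist_eq: "plane_dist a W z = norm ((z - a) - orthoproj W (z - a))"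
  by (simp add: plane_dist_def plane_proj_def dist_norm algebra_simps)

lemma plane_dist_nonneg: "0 \<le> plane_dist a W z"
  by (simp add: plane_dist_def)

lemma plane_dist_0: "finspan W \<Longrightarrow> z \<in> (+) a ` W \<Longrightarrow> plane_dist a W z = 0"
  by (auto simp: plane_dist_eq orthoproj_id)

text \<open>Only the component of the displacement orthogonal to \<open>W\<close> can change the
  distance. This gives a gain over \<open>plane_dist_1D\<close> for displacements in a subspace
  almost parallel to \<open>W\<close>.\<close>

lemma plane_dist_diff:
  assumes W: "finspan W"
  shows "plane_dist a W u \<le> plane_dist a W v + norm ((u - v) - orthoproj W (u - v))"
proof -
  have "(u - a) - orthoproj W (u - a) = ((v - a) - orthoproj W (v - a)) + ((u - v) - orthoproj W (u - v))"
    using linear_add[OF linear_orthoproj[OF W], of "v - a" "u - v"] by (simp add: algebra_simps)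
  then show ?thesis unfolding plane_dist_eq by (metis norm_triangle_ineq)
qed

lemma plane_dist_1D:
  assumes W: "finspan W"
  shows "plane_dist a W u \<le> plane_dist a W v + dist u v"
  using plane_dist_diff[OF W, of a u v] norm_orthoproj_le(2)[OF W, of "u - v"] by (simp add: dist_norm)

lemma plane_dist_le:
  assumes W: "finspan W" and p: "p \<in> (+) a ` W"
  shows "plane_dist a W z \<le> dist z p"
  using plane_dist_1D[OF W, of a z p] plane_dist_0[OF W p] by simp

lemma plane_proj_dist_le:
  assumes W: "finspan W" and p: "p \<in> (+) a ` W"
  shows "dist p (plane_proj a W z) \<le> dist p z"
proof -
  obtain w where w: "w \<in> W" "p = a + w" using p by blast
  have "orthoproj W (p - z) = w - orthoproj W (z - a)"
    using linear_diff[OF linear_orthoproj[OF W], of w "z - a"] orthoproj_id[OF W w(1)] w(2)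
    by (simp add: algebra_simps)
  then have "p - plane_proj a W z = orthoproj W (p - z)" by (simp add: plane_proj_def w(2))
  then show ?thesis using norm_orthoproj_le(1)[OF W, of "p - z"] by (simp add: dist_norm)
qed

lemma closed_plane:
  fixes a :: "'a::real_inner"
  assumes W: "finspan W"
  shows "closed ((+) a ` W)"
proof -
  have "(+) a ` W = {z. plane_dist a W z = 0}"
  proof
    show "{z. plane_dist a W z = 0} \<subseteq> (+) a ` W"
    proof
      fix z assume "z \<in> {z. plane_dist a W z = 0}"
      then have "z = plane_proj a W z" by (simp add: plane_dist_def)
      then show "z \<in> (+) a ` W" using plane_proj_in[OF W, of a z] by simp
    qed
  qed (use plane_dist_0[OF W] in auto)
  moreover have "continuous_on UNIV (plane_dist a W)"
    by (rule lipschitz_on_continuous_on[OF lipschitz_1I]) (rule plane_dist_1D[OF W])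
  ultimately show ?thesis by (simp add: closed_Collect_eq)
qed

locale flat_plane =
  fixes d :: nat and a :: fin_seq and W :: "fin_seq set"
  assumes d: "d \<ge> 1" and W: "subspace W" "dim W = d"
begin

abbreviation "P \<equiv> (+) a ` W"
abbreviation "HP \<equiv> hausdorff_on d P"

lemma fs: "finspan W"
  by (rule finspan_of_dim[OF W d])

lemma emeasure_ball_on: "p \<in> P \<Longrightarrow> s > 0 \<Longrightarrow> emeasure HP (ball p s) = ennreal (s ^ d)"
  using hausdorff_plane_ball[OF d W] by (simp add: emeasure_hausdorff_on[OF d] Int_commute)

lemma emeasure_ball_le: "s > 0 \<Longrightarrow> emeasure HP (ball y s) \<le> ennreal (s ^ d)"
proof -
  assume s: "s > 0"
  let ?q = "plane_proj a W y"
  have "ball y s \<inter> P \<subseteq> ball ?q s \<inter> P"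
  proof
    fix p assume p: "p \<in> ball y s \<inter> P"
    then show "p \<in> ball ?q s \<inter> P"
      using plane_proj_dist_le[OF fs, of p a y] by (simp add: dist_commute)
  qed
  then have "emeasure HP (ball y s) \<le> emeasure HP (ball ?q s)"
    by (simp add: emeasure_hausdorff_on[OF d] hausdorff_mono)
  then show ?thesis using emeasure_ball_on[OF plane_proj_in[OF fs] s] by simp
qed

lemma emeasure_ball_fin: "emeasure HP (ball y s) < \<infinity>"
proof (cases "s > 0")
  case True
  show ?thesis using order.strict_trans1[OF emeasure_ball_le[OF True] ennreal_less_top] by simp
next
  case False
  then have e: "ball y s = {}" by simp
  show ?thesis unfolding e by simp
qed

sublocale ball_finite_measure HP
  by standard (use emeasure_ball_fin in auto)

lemma measure_ball_on: "p \<in> P \<Longrightarrow> s > 0 \<Longrightarrow> measure HP (ball p s) = s ^ d"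
  by (simp add: measure_def emeasure_ball_on)

lemma measure_ball_le: "s > 0 \<Longrightarrow> measure HP (ball y s) \<le> s ^ d"
  using emeasure_ball_le by (simp add: measure_def enn2real_leI)

lemma measure_ball_ge:
  assumes "plane_dist a W y < s"
  shows "(s - plane_dist a W y) ^ d \<le> measure HP (ball y s)"
proof -
  have "ball (plane_proj a W y) (s - plane_dist a W y) \<subseteq> ball y s"
  proof
    fix z assume "z \<in> ball (plane_proj a W y) (s - plane_dist a W y)"
    then show "z \<in> ball y s"
      using dist_triangle[of y z "plane_proj a W y"] by (simp add: plane_dist_def)
  qed
  from measure_ball_mono[OF this] show ?thesis
    using measure_ball_on[OF plane_proj_in[OF fs], of "s - plane_dist a W y" y] assms by simp
qed

lemma AE_plane: "AE z in HP. z \<in> P"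
proof (rule AE_I[where N = "- P"])
  have "- P \<in> sets borel" using closed_plane[OF fs] by simp
  then show "emeasure HP (- P) = 0" by (simp add: emeasure_hausdorff_on[OF d] hausdorff_empty[OF d])
  show "- P \<in> sets HP" using closed_plane[OF fs] by simp
qed auto

lemma integral_vanish:
  assumes "\<And>z. z \<in> P \<Longrightarrow> \<phi> z = 0"
  shows "(\<integral>z. \<phi> z \<partial>HP) = 0"
proof (rule integral_eq_zero_AE)
  show "AE z in HP. \<phi> z = 0" using AE_plane by eventually_elim (rule assms)
qed

lemma tent_integral_on_ge:
  assumes "p \<in> P" "\<sigma> > 0"
  shows "(\<sigma> / 2) ^ Suc d \<le> (\<integral>u. tent p \<sigma> u \<partial>HP)"
  using tent_integral_ge[of p \<sigma> p \<sigma>] measure_ball_on[of p "\<sigma> / 2"] assms by simp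

end

text \<open>The integral depends only on the distribution of the distance to the apex, and balls
  centred on either plane have the same measure. So densities on two planes can be compared by tents
  without moving one plane to the other.\<close>

lemma tent_integral_plane_eq:
  assumes "flat_plane d W" "flat_plane d U" "p \<in> (+) a ` W" "q \<in> (+) b ` U"
  shows "(\<integral>u. tent p \<sigma> u \<partial>hausdorff_on d ((+) a ` W)) = (\<integral>u. tent q \<sigma> u \<partial>hausdorff_on d ((+) b ` U))"
proof -
  interpret A: flat_plane d a W by fact
  interpret B: flat_plane d b U by fact
  have m: "(\<lambda>z. - dist z p) \<in> borel_measurable (hausdorff_on d X)" for X and p :: fin_seq
    by (rule measurable_compose[of "\<lambda>z. z", OF _ borel_measurable_continuous_onI])
      (auto intro!: continuous_intros measurable_ident_sets)
  have v: "(\<lambda>z. - dist z p) -` {x<..} \<inter> UNIV = ball p (- x)" for x and p :: fin_seq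
    by (auto simp: dist_commute)
  have eq: "distr (hausdorff_on d A.P) borel (\<lambda>z. - dist z p) = distr (hausdorff_on d B.P) borel (\<lambda>z. - dist z q)"
  proof (rule measure_eqI_lessThan)
    fix x :: real
    show "emeasure (distr (hausdorff_on d A.P) borel (\<lambda>z. - dist z p)) {x<..} < \<infinity>"
      by (simp add: emeasure_distr[OF m] v[simplified] A.emeasure_ball_fin[simplified])
    show "emeasure (distr (hausdorff_on d A.P) borel (\<lambda>z. - dist z p)) {x<..}
        = emeasure (distr (hausdorff_on d B.P) borel (\<lambda>z. - dist z q)) {x<..}"
    proof (cases "x < 0")
      case True
      then show ?thesis
        using A.emeasure_ball_on[OF assms(3), of "-x"] B.emeasure_ball_on[OF assms(4), of "-x"]
        by (simp add: emeasure_distr[OF m] v[simplified])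
    next
      case False
      then have e: "ball p (- x) = {}" "ball q (- x) = {}" by simp_all
      show ?thesis by (simp add: emeasure_distr[OF m] v[simplified]) (simp only: e emeasure_empty)
    qed
  qed simp_all
  have "(\<integral>u. tent p \<sigma> u \<partial>hausdorff_on d X) = (\<integral>r. max 0 (\<sigma> + r) \<partial>distr (hausdorff_on d X) borel (\<lambda>z. - dist z p))"
    for p X by (subst integral_distr[OF m]) (auto simp: tent_def[abs_def])
  then show ?thesis using eq by simp
qed

section \<open>Comparison of flat approximations\<close>

text \<open>
  The factor \<open>c\<close> is free, unlike in \<open>\<alpha>\<close>, where it is fixed by the masses of the ball: this makes the
  notion pass to smaller balls, whereas masses of balls are not controlled linearly by \<open>W1\<close>.
\<close>
definition flat_approx ::
  "nat \<Rightarrow> fin_seq measure \<Rightarrow> fin_seq \<Rightarrow> real \<Rightarrow> fin_seq \<Rightarrow> fin_seq set \<Rightarrow> real \<Rightarrow> real \<Rightarrow> bool" where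
  "flat_approx d M y s a W c e \<longleftrightarrow> flat_plane d W \<and> 0 \<le> c \<and>
     (\<forall>\<phi>. test_fun y s \<phi> \<longrightarrow> \<bar>(\<integral>z. \<phi> z \<partial>M) - c * (\<integral>z. \<phi> z \<partial>hausdorff_on d ((+) a ` W))\<bar> \<le> e)"

lemma flat_approxD:
  assumes "flat_approx d M y s a W c e" "test_fun y s \<phi>"
  shows "(\<integral>z. \<phi> z \<partial>M) \<le> c * (\<integral>z. \<phi> z \<partial>hausdorff_on d ((+) a ` W)) + e"
    and "c * (\<integral>z. \<phi> z \<partial>hausdorff_on d ((+) a ` W)) \<le> (\<integral>z. \<phi> z \<partial>M) + e"
  using assms unfolding flat_approx_def by (auto simp: abs_le_iff dest!: spec[of _ \<phi>])

lemma flat_approx_plane: "flat_approx d M y s a W c e \<Longrightarrow> flat_plane d W"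
  and flat_approx_nonneg: "flat_approx d M y s a W c e \<Longrightarrow> 0 \<le> c"
  by (auto simp: flat_approx_def)

lemma flat_approx_mono:
  assumes "flat_approx d M y s a W c e" "ball y' s' \<subseteq> ball y s" "e \<le> e'"
  shows "flat_approx d M y' s' a W c e'"
proof -
  have "test_fun y s \<phi>" if "test_fun y' s' \<phi>" for \<phi>
    using that assms(2) unfolding test_fun_def by blast
  then show ?thesis using assms(1,3) unfolding flat_approx_def by (meson order.trans)
qed

lemma tent_le_indicator: "\<sigma> \<ge> 0 \<Longrightarrow> tent p \<sigma> z \<le> \<sigma> * indicator (ball p \<sigma>) z"
  by (auto simp: tent_def indicator_def dist_commute)

text \<open>If the plane missed the ball around \<open>z\<close>, the tent over that ball would have
  flat integral 0, whereas its integral against \<open>M\<close> exceeds \<open>e\<close>.\<close>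

lemma flat_near:
  assumes M: "ball_finite_measure M" and flat: "flat_approx d M y s a W c e"
    and sub: "ball z \<rho> \<subseteq> ball y s" and \<rho>: "\<rho> > 0" and e: "e < \<rho> / 2 * measure M (ball z (\<rho> / 2))"
  shows "plane_dist a W z < \<rho>"
proof (rule ccontr)
  interpret M: ball_finite_measure M by fact
  interpret flat_plane d a W by (rule flat_approx_plane[OF flat])
  assume "\<not> plane_dist a W z < \<rho>"
  then have "(\<integral>u. tent z \<rho> u \<partial>HP) = 0"
    using plane_dist_le[OF fs, of _ a z] by (intro integral_vanish tent_bounds(3)) (force simp: dist_commute)
  then have "(\<integral>u. tent z \<rho> u \<partial>M) \<le> e"
    using flat_approxD(1)[OF flat test_fun_tent[OF sub]] by simp
  then show False using M.tent_integral_ge[OF sub] \<rho> e by simp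
qed

text \<open>Here and in \<open>flat_const_le\<close> the tent of the full ball is the test function.
  The upper bound on \<open>c\<close> also needs the plane to pass near the centre, as a plane that
  misses the ball leaves \<open>c\<close> undetermined.\<close>

lemma flat_const_ge:
  assumes M: "ball_finite_measure M" and flat: "flat_approx d M y s a W c e" and s: "s > 0"
  shows "s / 2 * measure M (ball y (s / 2)) \<le> c * s ^ Suc d + e"
proof -
  interpret M: ball_finite_measure M by fact
  interpret flat_plane d a W by (rule flat_approx_plane[OF flat])
  have tf: "test_fun y s (tent y s)" by (rule test_fun_tent) simp
  have "(\<integral>u. tent y s u \<partial>HP) \<le> s * measure HP (ball y s)"
    by (rule integral_test_le[OF tf], rule AE_I2, rule tent_le_indicator) (use s in simp)
  also have "\<dots> \<le> s * s ^ d" using s measure_ball_le[OF s] by (intro mult_left_mono) auto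
  finally have "c * (\<integral>u. tent y s u \<partial>HP) \<le> c * s ^ Suc d"
    using flat_approx_nonneg[OF flat] by (simp add: mult_left_mono)
  then show ?thesis
    using flat_approxD(1)[OF flat tf] M.tent_integral_ge[of y s y s] s by simp
qed

lemma flat_const_le:
  assumes M: "ball_finite_measure M" and flat: "flat_approx d M y s a W c e" and s: "s > 0"
    and near: "plane_dist a W y \<le> s / 4"
  shows "c * (s / 4 * (s / 2) ^ d) \<le> s * measure M (ball y s) + e"
proof -
  interpret M: ball_finite_measure M by fact
  interpret flat_plane d a W by (rule flat_approx_plane[OF flat])
  have tf: "test_fun y s (tent y s)" by (rule test_fun_tent) simp
  let ?q = "plane_proj a W y"
  have "(\<integral>u. tent y s u \<partial>M) \<le> s * measure M (ball y s)"
    by (rule M.integral_test_le[OF tf], rule AE_I2, rule tent_le_indicator) (use s in simp)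
  moreover have "s / 4 * measure HP (ball ?q (s / 2)) \<le> (\<integral>u. tent y s u \<partial>HP)"
  proof (rule integral_test_ge[OF tf], rule AE_I2)
    fix z
    show "s / 4 * indicator (ball ?q (s / 2)) z \<le> tent y s z"
    proof (cases "z \<in> ball ?q (s / 2)")
      case True
      then have "dist z y \<le> 3 * s / 4"
        using near dist_triangle[of y z ?q] by (simp add: plane_dist_def dist_commute)
      then have "s / 4 \<le> s - dist z y" by simp
      then show ?thesis using True by (simp add: tent_def le_max_iff_disj)
    qed (simp add: tent_bounds)
  qed
  then have "c * (s / 4 * (s / 2) ^ d) \<le> c * (\<integral>u. tent y s u \<partial>HP)"
    using measure_ball_on[OF plane_proj_in[OF fs], of "s / 2" y] s flat_approx_nonneg[OF flat]
    by (intro mult_left_mono) auto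
  ultimately show ?thesis using flat_approxD(2)[OF flat tf] by simp
qed

text \<open>
  The test function is the distance to the first plane, cut off by a tent. By Markov's inequality
  most points of the second plane are close to the first one, so two of them differ by a
  prescribed vector of \<open>U\<close>.
\<close>
lemma flat_compare_angle:
  assumes flat1: "flat_approx d M y s a W c e1" and flat2: "flat_approx d M y s b U c' e2" and s: "s > 0"
    and near1: "plane_dist a W y \<le> s / 8" and near2: "plane_dist b U y \<le> s / 8"
    and K: "K > 0" "4 * 8 ^ d * (e1 + e2) \<le> K * (c' * s ^ d)" "c' > 0"
  shows "w \<in> U \<Longrightarrow> norm (w - orthoproj W w) \<le> 16 * K / s * norm w"
    and "plane_dist a W (plane_proj b U y) \<le> 3 * K"
proof -
  interpret A: flat_plane d a W by (rule flat_approx_plane[OF flat1])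
  interpret B: flat_plane d b U by (rule flat_approx_plane[OF flat2])
  let ?g = "plane_dist a W" and ?q = "plane_proj b U y"
  define \<phi> where "\<phi> z = min (?g z) (tent y s z)" for z
  have tf: "test_fun y s \<phi>"
    unfolding \<phi>_def by (rule test_fun_min_tent) (auto simp: plane_dist_nonneg plane_dist_1D[OF A.fs])
  have "(\<integral>z. \<phi> z \<partial>A.HP) = 0"
    by (rule A.integral_vanish) (simp add: \<phi>_def plane_dist_0[OF A.fs] tent_bounds)
  then have le: "c' * (\<integral>z. \<phi> z \<partial>B.HP) \<le> e1 + e2"
    using flat_approxD(1)[OF flat1 tf] flat_approxD(2)[OF flat2 tf] by simp
  \<comment> \<open>The tent does not cut here: the distance to the first plane is at most
    \<open>s / 8 + 3 * s / 8\<close>, while the tent is at least \<open>5 * s / 8\<close>.\<close>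
  have eq: "\<phi> z = ?g z" if "dist z ?q < s / 4" for z
  proof -
    have "dist z y \<le> 3 * s / 8"
      using that near2 dist_triangle[of z y ?q] by (simp add: plane_dist_def dist_commute)
    moreover have "?g z \<le> ?g y + dist z y" by (rule plane_dist_1D[OF A.fs])
    ultimately show ?thesis using near1 by (simp add: \<phi>_def tent_def)
  qed
  define S where "S = {z \<in> ball ?q (s / 4). K \<le> ?g z}"
  have cont: "continuous_on UNIV ?g"
    by (rule lipschitz_on_continuous_on[OF lipschitz_1I]) (rule plane_dist_1D[OF A.fs])
  have Sb: "S \<in> sets borel"
  proof -
    have "S = ball ?q (s / 4) \<inter> {z. K \<le> ?g z}" by (auto simp: S_def)
    then show ?thesis using closed_Collect_le[OF continuous_on_const cont, of K] by auto
  qed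
  have "emeasure B.HP S \<le> emeasure B.HP (ball ?q (s / 4))"
    by (rule emeasure_mono) (auto simp: S_def)
  then have Sfin: "emeasure B.HP S < \<infinity>" using B.emeasure_ball_fin by (rule le_less_trans)
  have "K * measure B.HP S \<le> (\<integral>z. \<phi> z \<partial>B.HP)"
  proof -
    have i: "integrable B.HP (\<lambda>z. K * indicator S z :: real)"
      using Sfin Sb by (intro integrable_mult_right integrable_real_indicator) auto
    have "(\<integral>z. K * indicator S z \<partial>B.HP) \<le> (\<integral>z. \<phi> z \<partial>B.HP)"
    proof (rule integral_mono[OF i B.integrable_test[OF tf]])
      fix z
      show "K * indicator S z \<le> \<phi> z"
      proof (cases "z \<in> S")
        case True
        then show ?thesis using eq[of z] by (simp add: S_def dist_commute)
      next
        case False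
        then show ?thesis by (simp add: \<phi>_def plane_dist_nonneg tent_bounds)
      qed
    qed
    then show ?thesis by simp
  qed
  then have cK: "c' * (K * measure B.HP S) \<le> e1 + e2"
    using le K(3) mult_left_mono[of "K * measure B.HP S" "(\<integral>z. \<phi> z \<partial>B.HP)" c'] by linarith
  \<comment> \<open>The factor \<open>4 * 8 ^ d\<close> is chosen so that the bad set
    \<open>S\<close> fills at most a quarter of a plane ball of radius \<open>s / 8\<close>.\<close>
  have "4 * 8 ^ d * (c' * (K * measure B.HP S)) \<le> 4 * 8 ^ d * (e1 + e2)"
    by (rule mult_left_mono[OF cK]) simp
  also have "\<dots> \<le> K * (c' * s ^ d)" by (rule K(2))
  finally have "(K * c') * (4 * 8 ^ d * measure B.HP S) \<le> (K * c') * s ^ d"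
    by (simp only: mult_ac)
  then have "4 * 8 ^ d * measure B.HP S \<le> s ^ d"
    using mult_pos_pos[OF K(1,3)] by (simp only: mult_le_cancel_left_pos)
  then have S4: "measure B.HP S \<le> (s / 8) ^ d / 4"
    by (simp add: power_divide field_simps)
  have HS: "hausdorff d (S \<inter> B.P) = ennreal (measure B.HP S)"
    unfolding emeasure_hausdorff_on[OF A.d Sb, symmetric]
    using Sfin by (intro emeasure_eq_ennreal_measure) auto
  \<comment> \<open>\<open>S\<close> and its translate by \<open>- v\<close> together occupy at most
    half of the plane ball of radius \<open>s / 8\<close>, so some \<open>z\<close> of that ball
    lies outside both.\<close>
  have good: "\<exists>z. z \<in> B.P \<and> dist z ?q < s / 8 \<and> ?g z < K \<and> ?g (z + v) < K" if v: "v \<in> U" "norm v \<le> s / 8" for v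
  proof (rule ccontr)
    assume no: "\<not> ?thesis"
    have "B.P \<inter> ball ?q (s / 8) \<subseteq> (S \<inter> B.P) \<union> (+) (- v) ` (S \<inter> B.P)"
    proof
      fix z assume z: "z \<in> B.P \<inter> ball ?q (s / 8)"
      show "z \<in> (S \<inter> B.P) \<union> (+) (- v) ` (S \<inter> B.P)"
      proof (cases "K \<le> ?g z")
        case True
        then show ?thesis using z s by (auto simp: S_def)
      next
        case False
        then have "K \<le> ?g (z + v)" using no z by (auto simp: dist_commute)
        moreover have "z + v \<in> B.P" using z v(1) B.W(1) by (auto simp: add.assoc subspace_add)
        moreover have "dist ?q (z + v) < s / 4"
          using z v(2) dist_triangle[of ?q "z + v" z] by (simp add: dist_norm)
        ultimately have "z + v \<in> S \<inter> B.P" by (simp add: S_def)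
        then have "- v + (z + v) \<in> (+) (- v) ` (S \<inter> B.P)" by (rule imageI)
        then show ?thesis by simp
      qed
    qed
    then have "hausdorff d (B.P \<inter> ball ?q (s / 8)) \<le> hausdorff d ((S \<inter> B.P) \<union> (+) (- v) ` (S \<inter> B.P))"
      by (rule hausdorff_mono)
    also have "\<dots> \<le> hausdorff d (S \<inter> B.P) + hausdorff d ((+) (- v) ` (S \<inter> B.P))"
      by (rule hausdorff_Un_le[OF A.d])
    also have "\<dots> = ennreal (measure B.HP S) + ennreal (measure B.HP S)"
      unfolding hausdorff_translate HS ..
    also have "\<dots> = ennreal (2 * measure B.HP S)" by (simp flip: ennreal_plus)
    also have "\<dots> \<le> ennreal ((s / 8) ^ d / 2)" using S4 by (intro ennreal_leI) simp
    also have "hausdorff d (B.P \<inter> ball ?q (s / 8)) = ennreal ((s / 8) ^ d)"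
      by (rule hausdorff_plane_ball[OF A.d B.W plane_proj_in[OF B.fs]]) (use s in simp)
    finally have "(s / 8) ^ d \<le> (s / 8) ^ d / 2" using s by (subst (asm) ennreal_le_iff) auto
    moreover have "(s / 8) ^ d > 0" using s by simp
    ultimately show False by linarith
  qed
  have ang: "norm (w - orthoproj W w) \<le> 16 * K / s * norm w" if w: "w \<in> U" for w
  proof (cases "w = 0")
    case True
    then show ?thesis using linear_0[OF linear_orthoproj[OF A.fs]] by simp
  next
    case False
    \<comment> \<open>The longest admissible displacement in direction \<open>w\<close>: a deviation
      of at most \<open>2 * K\<close> over the length \<open>s / 8\<close> is the slope
      \<open>16 * K / s\<close>.\<close>
    define v where "v = (s / (8 * norm w)) *\<^sub>R w"
    have nv: "norm v = s / 8" using False s by (simp add: v_def)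
    have "v \<in> U" using w B.W(1) by (simp add: v_def subspace_mul)
    then obtain z where z: "?g z < K" "?g (z + v) < K" using good[of v] nv by auto
    have "v - orthoproj W v = ((z + v - a) - orthoproj W (z + v - a)) - ((z - a) - orthoproj W (z - a))"
      using linear_add[OF linear_orthoproj[OF A.fs], of v "z - a"] by (simp add: algebra_simps)
    then have "norm (v - orthoproj W v) \<le> ?g (z + v) + ?g z"
      unfolding plane_dist_eq by (metis norm_triangle_ineq4)
    then have "norm (v - orthoproj W v) \<le> 2 * K" using z by simp
    moreover have "v - orthoproj W v = (s / (8 * norm w)) *\<^sub>R (w - orthoproj W w)"
      using linear_cmul[OF linear_orthoproj[OF A.fs], of _ w] by (simp add: v_def scaleR_diff_right)
    ultimately have "s / (8 * norm w) * norm (w - orthoproj W w) \<le> 2 * K" using s by simp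
    then show ?thesis using s False by (simp add: field_simps)
  qed
  then show "w \<in> U \<Longrightarrow> norm (w - orthoproj W w) \<le> 16 * K / s * norm w" .
  \<comment> \<open>The displacement 0 gives one point of the second plane close to the first.
    Walking from it to \<open>?q\<close> along the second plane adds the slope times
    \<open>s / 8\<close>, that is \<open>2 * K\<close>.\<close>
  obtain z where z: "z \<in> B.P" "dist z ?q < s / 8" "?g z < K"
    using good[of 0] s subspace_0[OF B.W(1)] by auto
  have "?q - z \<in> U"
  proof -
    obtain u where "u \<in> U" "z = b + u" using z(1) by blast
    then show ?thesis
      using orthoproj_in[OF B.fs, of "y - b"] subspace_diff[OF B.W(1)] by (simp add: plane_proj_def)
  qed
  have "?g ?q \<le> ?g z + norm ((?q - z) - orthoproj W (?q - z))" by (rule plane_dist_diff[OF A.fs])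
  also have "\<dots> \<le> K + 16 * K / s * norm (?q - z)" using z(3) ang[OF \<open>?q - z \<in> U\<close>] by simp
  also have "\<dots> \<le> K + 16 * K / s * (s / 8)"
    using z(2) s K(1) by (intro add_left_mono mult_left_mono) (auto simp: dist_norm norm_minus_commute)
  also have "\<dots> = 3 * K" using s by simp
  finally show "plane_dist a W (plane_proj b U y) \<le> 3 * K" .
qed

text \<open>The test function is the tent with apex \<open>p\<close> on the first plane. Tents of
  this size have the same integral \<open>I\<close> on every plane through their apex, so only the
  shift from \<open>p\<close> to its projection \<open>q\<close> on the second plane costs
  something, at most \<open>h * (s / 2) ^ d\<close>. The upper estimate costs nothing: projecting
  the apex brings it no farther from any point of the plane.\<close>

lemma flat_compare_const:
  assumes flat1: "flat_approx d M y s a W c e1" and flat2: "flat_approx d M y s b U c' e2" and s: "s > 0"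
    and near1: "plane_dist a W y \<le> s / 8" and h: "plane_dist b U (plane_proj a W y) \<le> h"
  shows "\<bar>c - c'\<bar> * (s / 4) ^ Suc d \<le> e1 + e2 + c' * (h * (s / 2) ^ d)"
proof -
  interpret A: flat_plane d a W by (rule flat_approx_plane[OF flat1])
  interpret B: flat_plane d b U by (rule flat_approx_plane[OF flat2])
  define p where "p = plane_proj a W y"
  define q where "q = plane_proj b U p"
  have p: "p \<in> A.P" unfolding p_def by (rule plane_proj_in[OF A.fs])
  have q: "q \<in> B.P" unfolding q_def by (rule plane_proj_in[OF B.fs])
  have pq: "dist p q \<le> h" using h by (simp add: plane_dist_def p_def q_def)
  have h0: "h \<ge> 0" using pq zero_le_dist[of p q] by linarith
  have sub: "ball p (s / 2) \<subseteq> ball y s"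
  proof
    fix z assume "z \<in> ball p (s / 2)"
    then show "z \<in> ball y s"
      using near1 dist_triangle[of y z p] s by (simp add: plane_dist_def p_def)
  qed
  have tf: "test_fun y s (tent p (s / 2))" by (rule test_fun_tent[OF sub])
  have tq: "test_fun q (s / 2) (tent q (s / 2))" by (rule test_fun_tent) simp
  define I where "I = (\<integral>z. tent p (s / 2) z \<partial>A.HP)"
  have Iq: "I = (\<integral>z. tent q (s / 2) z \<partial>B.HP)"
    unfolding I_def by (rule tent_integral_plane_eq[OF A.flat_plane_axioms B.flat_plane_axioms p q])
  have I: "(s / 4) ^ Suc d \<le> I"
    using A.tent_integral_on_ge[OF p, of "s / 2"] s by (simp add: I_def)
  have upper: "(\<integral>z. tent p (s / 2) z \<partial>B.HP) \<le> I"
    unfolding Iq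
  proof (rule integral_mono_AE[OF B.integrable_test[OF tf] B.integrable_test[OF tq]])
    show "AE z in B.HP. tent p (s / 2) z \<le> tent q (s / 2) z"
      using B.AE_plane
    proof eventually_elim
      case (elim z)
      then show ?case using plane_proj_dist_le[OF B.fs elim, of p] by (simp add: tent_def q_def)
    qed
  qed
  have "(\<integral>z. tent q (s / 2) z - h * indicator (ball q (s / 2)) z \<partial>B.HP) \<le> (\<integral>z. tent p (s / 2) z \<partial>B.HP)"
  proof (rule integral_mono[OF Bochner_Integration.integrable_diff[OF B.integrable_test[OF tq] B.integrable_ball] B.integrable_test[OF tf]])
    fix z
    have "dist z p \<le> dist z q + h" using dist_triangle[of z p q] pq by (simp add: dist_commute)
    then show "tent q (s / 2) z - h * indicator (ball q (s / 2)) z \<le> tent p (s / 2) z"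
      by (auto simp: tent_def indicator_def dist_commute)
  qed
  then have "I - h * measure B.HP (ball q (s / 2)) \<le> (\<integral>z. tent p (s / 2) z \<partial>B.HP)"
    unfolding Bochner_Integration.integral_diff[OF B.integrable_test[OF tq] B.integrable_ball] B.integral_ball Iq .
  then have lower: "I - h * (s / 2) ^ d \<le> (\<integral>z. tent p (s / 2) z \<partial>B.HP)"
    using B.measure_ball_on[OF q, of "s / 2"] s by simp
  have c': "c' \<ge> 0" by (rule flat_approx_nonneg[OF flat2])
  have 1: "c * I \<le> c' * I + (e1 + e2)"
    using flat_approxD(2)[OF flat1 tf] flat_approxD(1)[OF flat2 tf] mult_left_mono[OF upper c'] by (simp add: I_def)
  have 2: "c' * I - c' * (h * (s / 2) ^ d) \<le> c * I + (e1 + e2)"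
    using flat_approxD(1)[OF flat1 tf] flat_approxD(2)[OF flat2 tf] mult_left_mono[OF lower c']
    by (simp add: I_def right_diff_distrib)
  have "0 \<le> c' * (h * (s / 2) ^ d)" using c' h0 s by simp
  with 1 2 have "\<bar>c - c'\<bar> * I \<le> e1 + e2 + c' * (h * (s / 2) ^ d)"
    using I s by (auto simp: abs_if left_diff_distrib)
  moreover have "\<bar>c - c'\<bar> * (s / 4) ^ Suc d \<le> \<bar>c - c'\<bar> * I" by (rule mult_left_mono[OF I]) simp
  ultimately show ?thesis by linarith
qed

text \<open>The indicator of a ball is replaced by a tent truncated at height
  \<open>\<delta> * t\<close>, which is \<open>\<delta> * t\<close> times a cutoff with transition
  width \<open>\<delta> * t\<close>; dividing by this height produces
  \<open>e / (\<delta> * t)\<close>. Of the loss \<open>2 * \<delta>\<close> in the lower bound, one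
  \<delta> is the transition layer and the other the distance of the plane from
  \<open>y\<close>.\<close>

lemma flat_ball_measure:
  assumes M: "ball_finite_measure M" and flat: "flat_approx d M y s a W c e"
    and t: "t > 0" and \<delta>: "0 < \<delta>" "2 * \<delta> < 1" "t * (1 + \<delta>) \<le> s"
    and near: "plane_dist a W y \<le> \<delta> * t"
  shows "measure M (ball y t) \<le> c * (t * (1 + \<delta>)) ^ d + e / (\<delta> * t)"
    and "c * (t * (1 - 2 * \<delta>)) ^ d - e / (\<delta> * t) \<le> measure M (ball y t)"
proof -
  interpret M: ball_finite_measure M by fact
  interpret flat_plane d a W by (rule flat_approx_plane[OF flat])
  note c = flat_approx_nonneg[OF flat]
  have dt: "\<delta> * t > 0" using \<delta> t by simp
  have cancel: "(c * (\<delta> * t * X) + e) / (\<delta> * t) = c * X + e / (\<delta> * t)"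
    "(c * (\<delta> * t * X) - e) / (\<delta> * t) = c * X - e / (\<delta> * t)" for X
  proof -
    have "c * (\<delta> * t * X) / (\<delta> * t) = c * X"
      using dt nonzero_mult_div_cancel_left[of "\<delta> * t" "c * X"] by (simp only: mult.left_commute[of c])
    then show "(c * (\<delta> * t * X) + e) / (\<delta> * t) = c * X + e / (\<delta> * t)"
      "(c * (\<delta> * t * X) - e) / (\<delta> * t) = c * X - e / (\<delta> * t)"
      by (simp_all only: add_divide_distrib diff_divide_distrib)
  qed
  define \<phi> where "\<phi> \<sigma> z = min (\<delta> * t) (tent y \<sigma> z)" for \<sigma> z
  have tf: "test_fun y s (\<phi> \<sigma>)" if "\<sigma> \<le> s" for \<sigma>
    unfolding \<phi>_def by (rule test_fun_min_tent) (use dt that in auto)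
  have low: "\<delta> * t * measure N (ball y (\<sigma> - \<delta> * t)) \<le> (\<integral>z. \<phi> \<sigma> z \<partial>N)"
    if "ball_finite_measure N" "\<sigma> \<le> s" for N \<sigma>
  proof (rule ball_finite_measure.integral_test_ge[OF that(1) tf[OF that(2)]], rule AE_I2)
    fix z show "\<delta> * t * indicator (ball y (\<sigma> - \<delta> * t)) z \<le> \<phi> \<sigma> z"
      using dt by (auto simp: \<phi>_def tent_def indicator_def dist_commute)
  qed
  have upp: "(\<integral>z. \<phi> \<sigma> z \<partial>N) \<le> \<delta> * t * measure N (ball y \<sigma>)"
    if "ball_finite_measure N" "\<sigma> \<le> s" for N \<sigma>
  proof (rule ball_finite_measure.integral_test_le[OF that(1) tf[OF that(2)]], rule AE_I2)
    fix z show "\<phi> \<sigma> z \<le> \<delta> * t * indicator (ball y \<sigma>) z"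
      using dt by (auto simp: \<phi>_def tent_def indicator_def dist_commute)
  qed
  have ts: "t \<le> s" using \<delta> t by (auto simp: distrib_left intro: order.trans[rotated])
  have "\<delta> * t * measure M (ball y (t * (1 + \<delta>) - \<delta> * t)) \<le> c * (\<delta> * t * measure HP (ball y (t * (1 + \<delta>)))) + e"
    using low[OF M \<delta>(3)] flat_approxD(1)[OF flat tf[OF \<delta>(3)]]
      mult_left_mono[OF upp[OF ball_finite_measure_axioms \<delta>(3)] c] by simp
  also have "\<dots> \<le> c * (\<delta> * t * (t * (1 + \<delta>)) ^ d) + e"
    using c dt measure_ball_le[of "t * (1 + \<delta>)" y] t \<delta> by (intro add_right_mono mult_left_mono) auto
  finally have "\<delta> * t * measure M (ball y t) \<le> c * (\<delta> * t * (t * (1 + \<delta>)) ^ d) + e"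
    by (simp add: algebra_simps)
  then have "measure M (ball y t) \<le> (c * (\<delta> * t * (t * (1 + \<delta>)) ^ d) + e) / (\<delta> * t)"
    using dt by (subst pos_le_divide_eq) (simp_all add: mult_ac)
  also have "\<dots> = c * (t * (1 + \<delta>)) ^ d + e / (\<delta> * t)"
    using cancel(1) .
  finally show "measure M (ball y t) \<le> c * (t * (1 + \<delta>)) ^ d + e / (\<delta> * t)" .
  have d2: "2 * \<delta> * t < t" using mult_strict_right_mono[OF \<delta>(2) t] by simp
  have pos: "0 \<le> t * (1 - 2 * \<delta>)" using \<delta> t by simp
  have "(t * (1 - 2 * \<delta>)) ^ d \<le> (t - \<delta> * t - plane_dist a W y) ^ d"
    by (rule power_mono[OF _ pos]) (use near in \<open>simp add: algebra_simps\<close>)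
  also have "\<dots> \<le> measure HP (ball y (t - \<delta> * t))"
    by (rule measure_ball_ge) (use near d2 in linarith)
  finally have "c * (\<delta> * t * (t * (1 - 2 * \<delta>)) ^ d) \<le> c * (\<delta> * t * measure HP (ball y (t - \<delta> * t)))"
    using c dt by (intro mult_left_mono) auto
  also have "\<dots> \<le> c * (\<integral>z. \<phi> t z \<partial>HP)"
    using low[OF ball_finite_measure_axioms ts] c by (intro mult_left_mono) auto
  also have "\<dots> \<le> \<delta> * t * measure M (ball y t) + e"
    using flat_approxD(2)[OF flat tf[OF ts]] upp[OF M ts] by simp
  finally have "c * (\<delta> * t * (t * (1 - 2 * \<delta>)) ^ d) - e \<le> \<delta> * t * measure M (ball y t)" by simp
  then have "(c * (\<delta> * t * (t * (1 - 2 * \<delta>)) ^ d) - e) / (\<delta> * t) \<le> measure M (ball y t)"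
    using dt by (subst pos_divide_le_eq) (simp_all add: mult_ac)
  moreover have "(c * (\<delta> * t * (t * (1 - 2 * \<delta>)) ^ d) - e) / (\<delta> * t) = c * (t * (1 - 2 * \<delta>)) ^ d - e / (\<delta> * t)"
    using cancel(2) .
  ultimately show "c * (t * (1 - 2 * \<delta>)) ^ d - e / (\<delta> * t) \<le> measure M (ball y t)" by simp
qed

section \<open>Chains of flat approximations for doubling measures\<close>

text \<open>In this setting \<open>n\<close> does not occur, so every constant derived here depends
  on \<open>C\<close> and \<open>d\<close> only.\<close>

locale doubling_support = ball_finite_measure M for M :: "fin_seq measure" +
  fixes C :: real and S :: "fin_seq set" and d :: nat
  assumes C: "C \<ge> 1" and d: "d \<ge> 1"
    and pos: "\<And>y s. y \<in> S \<Longrightarrow> s > 0 \<Longrightarrow> measure M (ball y s) > 0"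
    and dbl: "\<And>y s. y \<in> S \<Longrightarrow> s > 0 \<Longrightarrow> measure M (ball y (2 * s)) \<le> C * measure M (ball y s)"
begin

abbreviation "m y s \<equiv> measure M (ball y s)"

lemma ball_finite_M: "ball_finite_measure M" ..

lemma dbl_pow: "y \<in> S \<Longrightarrow> s > 0 \<Longrightarrow> m y (2 ^ k * s) \<le> C ^ k * m y s"
proof (induction k)
  case (Suc k)
  have "m y (2 * (2 ^ k * s)) \<le> C * m y (2 ^ k * s)" using Suc.prems by (intro dbl) auto
  also have "\<dots> \<le> C * (C ^ k * m y s)" using Suc C by (intro mult_left_mono) auto
  finally show ?case by (simp add: mult.assoc)
qed simp

text \<open>The error is measured in the unit \<open>s * m y s\<close>, which makes \<alpha> scale
  invariant and comparable with the coefficients \<open>alpha\<close>.\<close>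

definition flat :: "fin_seq \<Rightarrow> real \<Rightarrow> fin_seq \<Rightarrow> fin_seq set \<Rightarrow> real \<Rightarrow> real \<Rightarrow> bool" where
  "flat y s a W c \<alpha> \<longleftrightarrow> y \<in> S \<and> s > 0 \<and> 0 < \<alpha> \<and> flat_approx d M y s a W c (\<alpha> * s * m y s)"

text \<open>From radius \<open>s / 2 ^ (k + 1)\<close>, \<open>k + 2\<close> doublings about
  \<open>z\<close> reach a ball that contains \<open>B(y, s)\<close>. So the small ball about
  \<open>z\<close> carries at least the fraction \<open>1 / C ^ (k + 2)\<close> of the mass, too
  much for a plane at distance \<open>s / 2 ^ k\<close> or more.\<close>

lemma flat_near_support:
  assumes flat: "flat y s a W c \<alpha>" and z: "z \<in> S" "dist y z \<le> s / 2"
    and \<alpha>: "\<alpha> < (1/2) ^ (k + 1) / C ^ (k + 2)" and k: "k \<ge> 1"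
  shows "plane_dist a W z < s / 2 ^ k"
proof (rule flat_near[OF ball_finite_M])
  show "flat_approx d M y s a W c (\<alpha> * s * m y s)" using flat by (simp add: flat_def)
  have s: "s > 0" using flat by (simp add: flat_def)
  show "s / 2 ^ k > 0" using s by simp
  have "(2::real) ^ 1 \<le> 2 ^ k" using k by (intro power_increasing) auto
  then have "s / 2 ^ k \<le> s / 2" using s by (intro divide_left_mono) auto
  show "ball z (s / 2 ^ k) \<subseteq> ball y s"
  proof
    fix u assume "u \<in> ball z (s / 2 ^ k)"
    then have "dist z u < s / 2 ^ k" by simp
    then have "dist y u < s" using dist_triangle[of y u z] z(2) \<open>s / 2 ^ k \<le> s / 2\<close> by linarith
    then show "u \<in> ball y s" by simp
  qed
  have "ball y s \<subseteq> ball z (2 ^ (k + 2) * (s / 2 ^ k / 2))"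
  proof
    fix u assume "u \<in> ball y s"
    then show "u \<in> ball z (2 ^ (k + 2) * (s / 2 ^ k / 2))"
      using dist_triangle[of z u y] z(2) s by (simp add: dist_commute)
  qed
  from measure_ball_mono[OF this] have le: "m y s \<le> C ^ (k + 2) * m z (s / 2 ^ k / 2)"
    using dbl_pow[OF z(1), of "s / 2 ^ k / 2" "k + 2"] s by simp
  have my: "m y s > 0" using pos flat s by (simp add: flat_def)
  have Ck: "C ^ (k + 2) > 0" using C by simp
  have "\<alpha> * s * m y s < (1/2) ^ (k + 1) / C ^ (k + 2) * s * m y s"
    using \<alpha> s my by (intro mult_strict_right_mono) auto
  also have "\<dots> \<le> (1/2) ^ (k + 1) / C ^ (k + 2) * s * (C ^ (k + 2) * m z (s / 2 ^ k / 2))"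
    using le s C by (intro mult_left_mono) auto
  also have "\<dots> = s / 2 ^ k / 2 * m z (s / 2 ^ k / 2)"
    using Ck C by (auto simp: power_divide)
  finally show "\<alpha> * s * m y s < s / 2 ^ k / 2 * m z (s / 2 ^ k / 2)" .
qed

text \<open>The threshold of \<open>flat_near_support\<close> for \<open>k = 4\<close>. Distance
  \<open>s1 / 16\<close> to the plane of the larger scale is what \<open>flat_step\<close> needs to
  get \<open>s2 / 8\<close> when \<open>s1 \<le> 2 * s2\<close>.\<close>

definition \<alpha>0 :: real where "\<alpha>0 = (1/2) ^ 5 / C ^ 6"

lemma \<alpha>0_le: "k \<le> 4 \<Longrightarrow> \<alpha>0 \<le> (1/2) ^ (k + 1) / C ^ (k + 2)"
  unfolding \<alpha>0_def using C by (intro frac_le power_decreasing power_increasing) auto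

lemma \<alpha>0_le_C: "\<alpha>0 \<le> 1 / (4 * C)"
proof -
  have "C ^ 1 \<le> C ^ 6" using C by (intro power_increasing) auto
  then have "1 / (32 * C ^ 6) \<le> 1 / (4 * C)" using C by (intro divide_left_mono) auto
  then show ?thesis by (simp add: \<alpha>0_def power_divide)
qed

lemma flat_near_center:
  assumes "flat y s a W c \<alpha>" "\<alpha> < \<alpha>0" "1 \<le> k" "k \<le> 4"
  shows "plane_dist a W y < s / 2 ^ k"
  using assms \<alpha>0_le[of k] by (intro flat_near_support[OF assms(1)]) (auto simp: flat_def)

lemma flat_const_bounds:
  assumes flat: "flat y s a W c \<alpha>" and \<alpha>: "\<alpha> < \<alpha>0"
  shows "m y s / (4 * C) \<le> c * s ^ d" "c * s ^ d \<le> 8 * 2 ^ d * m y s"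
proof -
  have s: "s > 0" and y: "y \<in> S" and fl: "flat_approx d M y s a W c (\<alpha> * s * m y s)" and \<alpha>p: "\<alpha> > 0"
    using flat by (auto simp: flat_def)
  have my: "m y s > 0" by (rule pos[OF y s])
  have \<alpha>C: "\<alpha> \<le> 1 / (4 * C)" using \<alpha> \<alpha>0_le_C by simp
  have "m y s \<le> C * m y (s / 2)" using dbl[OF y, of "s / 2"] s by simp
  then have "m y s / C \<le> m y (s / 2)" using C by (simp add: field_simps)
  then have "s / 2 * (m y s / C) \<le> s / 2 * m y (s / 2)" using s by (intro mult_left_mono) auto
  also have "\<dots> \<le> c * s ^ Suc d + \<alpha> * s * m y s" by (rule flat_const_ge[OF ball_finite_M fl s])
  also have "\<dots> \<le> c * s ^ Suc d + 1 / (4 * C) * s * m y s"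
    using \<alpha>C s my by (intro add_left_mono mult_right_mono) auto
  finally have "s * (m y s / (4 * C)) \<le> s * (c * s ^ d)" by (simp add: field_simps)
  then show "m y s / (4 * C) \<le> c * s ^ d" using s by (simp only: mult_le_cancel_left_pos)
  have "plane_dist a W y \<le> s / 4" using flat_near_center[OF flat \<alpha>, of 2] by simp
  from flat_const_le[OF ball_finite_M fl s this]
  have "c * (s / 4 * (s / 2) ^ d) \<le> s * m y s + \<alpha> * s * m y s" .
  also have "\<dots> \<le> s * m y s + 1 * s * m y s"
  proof (intro add_left_mono mult_right_mono)
    have "1 / (4 * C) \<le> 1" using C by simp
    then show "\<alpha> \<le> 1" using \<alpha>C by linarith
  qed (use s my in auto)
  finally have "s * (c * s ^ d) \<le> s * (8 * 2 ^ d * m y s)"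
    by (simp add: power_divide field_simps)
  then show "c * s ^ d \<le> 8 * 2 ^ d * m y s" using s by (simp only: mult_le_cancel_left_pos)
qed

text \<open>The density loss of \<open>flat_step\<close>: \<open>4 ^ (d + 1)\<close> undoes the
  factor of the tent integral, \<open>4 * C * 2 ^ d\<close> passes from mass to density,
  \<open>2 * C\<close> bounds the error \<beta>, and \<open>385 * 16 ^ d * C\<close> is the direct
  error 1 plus 384 for the displacement of the plane. The loss for angles is smaller.\<close>

definition K0 :: real where "K0 = 4 ^ (d + 1) * 8 * 2 ^ d * 385 * 16 ^ d * C ^ 3"

lemma K0_ge: "512 * 8 ^ d * C\<^sup>2 \<le> K0" "4 ^ (d + 1) * (4 * C * 2 ^ d) * (2 * C) * (385 * 16 ^ d * C) \<le> K0"
  and K0_pos: "K0 > 0"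
proof -
  have C23: "C\<^sup>2 \<le> C ^ 3" using C by (intro power_increasing) auto
  have "(1::real) \<le> 4 ^ d * 2 ^ d * 2 ^ d"
    using mult_mono[of 1 "4 ^ d * 2 ^ d :: real" 1 "2 ^ d"] mult_mono[of 1 "4 ^ d :: real" 1 "2 ^ d"] by simp
  then have "8 ^ d * 1 \<le> 8 ^ d * (4 ^ d * 2 ^ d * 2 ^ d :: real)" by (intro mult_left_mono) auto
  also have "\<dots> = 4 ^ d * 2 ^ d * (8 * 2) ^ d" by (simp only: power_mult_distrib mult_ac)
  finally have "8 ^ d \<le> 4 ^ d * 2 ^ d * (16 ^ d :: real)" by simp
  then have "512 * 8 ^ d \<le> 512 * (4 ^ d * 2 ^ d * (16 ^ d :: real))" by (intro mult_left_mono) auto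
  also have "\<dots> \<le> 12320 * (4 ^ d * 2 ^ d * (16 ^ d :: real))" by (intro mult_right_mono) auto
  also have "\<dots> = 4 ^ (d + 1) * 8 * 2 ^ d * 385 * (16 ^ d :: real)" by simp
  finally have le: "512 * 8 ^ d \<le> 4 ^ (d + 1) * 8 * 2 ^ d * 385 * (16 ^ d :: real)" .
  have "512 * 8 ^ d * C\<^sup>2 \<le> 4 ^ (d + 1) * 8 * 2 ^ d * 385 * 16 ^ d * C ^ 3"
    by (rule mult_mono[OF le C23]) (use C in simp_all)
  then show "512 * 8 ^ d * C\<^sup>2 \<le> K0" by (simp add: K0_def)
  show "4 ^ (d + 1) * (4 * C * 2 ^ d) * (2 * C) * (385 * 16 ^ d * C) \<le> K0"
    by (simp add: K0_def power3_eq_cube)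
  show "K0 > 0" using C by (simp add: K0_def)
qed

text \<open>Both approximations are read at the smaller scale, where the error of the first grows by
  at most \<open>2 * C\<close>: a factor 2 for the radius and one doubling.
  \<open>flat_compare_angle\<close> bounds the tilt; applied with the roles exchanged it bounds the
  distance that \<open>flat_compare_const\<close> needs.\<close>

lemma flat_step:
  assumes flat1: "flat y s1 a W c \<alpha>1" and flat2: "flat y s2 b U c' \<alpha>2"
    and \<alpha>: "\<alpha>1 < \<alpha>0" "\<alpha>2 < \<alpha>0" and s12: "s2 \<le> s1" "s1 \<le> 2 * s2"
  shows "\<bar>c - c'\<bar> \<le> K0 * (\<alpha>1 + \<alpha>2) * c"
    and "v \<in> U \<Longrightarrow> norm (v - orthoproj W v) \<le> K0 * (\<alpha>1 + \<alpha>2) * norm v"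
proof -
  have s: "s1 > 0" "s2 > 0" and y: "y \<in> S" and \<alpha>p: "\<alpha>1 > 0" "\<alpha>2 > 0"
    and fl1: "flat_approx d M y s1 a W c (\<alpha>1 * s1 * m y s1)"
    and fl2: "flat_approx d M y s2 b U c' (\<alpha>2 * s2 * m y s2)"
    using flat1 flat2 by (auto simp: flat_def)
  define \<mu> where "\<mu> = m y s2"
  \<comment> \<open>The sum of both errors at scale \<open>s2\<close>, in the unit
    \<open>s2 * \<mu>\<close>.\<close>
  define \<beta> where "\<beta> = 2 * C * \<alpha>1 + \<alpha>2"
  have C0: "C > 0" using C by simp
  have \<mu>: "\<mu> > 0" unfolding \<mu>_def by (rule pos[OF y s(2)])
  have \<beta>: "\<beta> > 0" using \<alpha>p C0 by (simp add: \<beta>_def add_pos_pos)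
  have \<beta>le: "\<beta> \<le> 2 * C * (\<alpha>1 + \<alpha>2)"
    using mult_right_mono[of 1 "2 * C" \<alpha>2] C \<alpha>p by (simp add: \<beta>_def distrib_left)
  have m1: "\<mu> \<le> m y s1" unfolding \<mu>_def using s12 by (intro measure_ball_mono) auto
  have m12: "m y s1 \<le> C * \<mu>"
  proof -
    have "m y s1 \<le> m y (2 * s2)" using s12 by (intro measure_ball_mono) auto
    also have "\<dots> \<le> C * \<mu>" unfolding \<mu>_def by (rule dbl[OF y s(2)])
    finally show ?thesis .
  qed
  have e1: "\<alpha>1 * s1 * m y s1 \<le> 2 * C * \<alpha>1 * s2 * \<mu>"
  proof -
    have "(\<alpha>1 * s1) * m y s1 \<le> (\<alpha>1 * (2 * s2)) * (C * \<mu>)"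
      using s12 m12 \<alpha>p s \<mu> C0 by (intro mult_mono mult_left_mono) auto
    then show ?thesis by (simp add: mult_ac)
  qed
  have F1: "flat_approx d M y s2 a W c (2 * C * \<alpha>1 * s2 * \<mu>)"
    by (rule flat_approx_mono[OF fl1 _ e1]) (use s12 in auto)
  have F2: "flat_approx d M y s2 b U c' (\<alpha>2 * s2 * \<mu>)"
    using fl2 by (simp add: \<mu>_def)
  have e: "2 * C * \<alpha>1 * s2 * \<mu> + \<alpha>2 * s2 * \<mu> = \<beta> * s2 * \<mu>"
    by (simp add: \<beta>_def distrib_right)
  have n1: "plane_dist a W y \<le> s2 / 8"
    using flat_near_center[OF flat1 \<alpha>(1), of 4] s12(2) by simp
  have n2: "plane_dist b U y \<le> s2 / 8"
    using flat_near_center[OF flat2 \<alpha>(2), of 3] by simp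
  note b1 = flat_const_bounds[OF flat1 \<alpha>(1)]
  note b2 = flat_const_bounds[OF flat2 \<alpha>(2), folded \<mu>_def]
  have c0: "c \<ge> 0" "c' \<ge> 0" using flat_approx_nonneg fl1 fl2 by blast+
  have c_low: "\<mu> / (4 * C * 2 ^ d) \<le> c * s2 ^ d"
  proof -
    have "\<mu> / (4 * C) \<le> m y s1 / (4 * C)" using m1 C0 by (intro divide_right_mono) auto
    also have "\<dots> \<le> c * s1 ^ d" by (rule b1)
    also have "\<dots> \<le> c * (2 * s2) ^ d" using s12 s c0 by (intro mult_left_mono power_mono) auto
    finally have "\<mu> / (4 * C) / 2 ^ d \<le> c * (2 * s2) ^ d / 2 ^ d" by (rule divide_right_mono) simp
    also have "\<dots> = c * s2 ^ d" by (simp add: power_mult_distrib)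
    finally show ?thesis by (simp only: divide_divide_eq_left)
  qed
  have cpos: "c > 0" "c' > 0"
  proof -
    have "0 < \<mu> / (4 * C * 2 ^ d)" "0 < \<mu> / (4 * C)" using \<mu> C0 by simp_all
    then have "0 < c * s2 ^ d" "0 < c' * s2 ^ d" using c_low b2(1) by linarith+
    then show "c > 0" "c' > 0" using s by (simp_all add: zero_less_mult_iff)
  qed
  define K where "K = 4 * 8 ^ d * (4 * C) * \<beta> * s2"
  have K: "K > 0" using \<beta> C0 s by (simp add: K_def)
  have Kc: "4 * 8 ^ d * (2 * C * \<alpha>1 * s2 * \<mu> + \<alpha>2 * s2 * \<mu>) \<le> K * (c' * s2 ^ d)"
  proof -
    have "K * (\<mu> / (4 * C)) \<le> K * (c' * s2 ^ d)" using K b2(1) by (intro mult_left_mono) auto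
    moreover have "K * (\<mu> / (4 * C)) = 4 * 8 ^ d * (\<beta> * s2 * \<mu>)" using C0 by (simp add: K_def)
    ultimately show ?thesis unfolding e by simp
  qed
  show "norm (v - orthoproj W v) \<le> K0 * (\<alpha>1 + \<alpha>2) * norm v" if v: "v \<in> U"
  proof -
    have "norm (v - orthoproj W v) \<le> 16 * K / s2 * norm v"
      by (rule flat_compare_angle(1)[OF F1 F2 s(2) n1 n2 K Kc cpos(2) v])
    also have "16 * K / s2 = 256 * 8 ^ d * C * \<beta>" using s by (simp add: K_def)
    also have "256 * 8 ^ d * C * \<beta> \<le> 256 * 8 ^ d * C * (2 * C * (\<alpha>1 + \<alpha>2))"
      using \<beta>le C0 by (intro mult_left_mono) auto
    also have "\<dots> = 512 * 8 ^ d * C\<^sup>2 * (\<alpha>1 + \<alpha>2)" by (simp add: power2_eq_square)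
    also have "\<dots> \<le> K0 * (\<alpha>1 + \<alpha>2)" using K0_ge(1) \<alpha>p by (intro mult_right_mono) auto
    finally show ?thesis by (simp add: mult_right_mono)
  qed
  \<comment> \<open>The same as \<open>K\<close> with the roles exchanged. The extra
    \<open>2 ^ d\<close> comes from the weaker lower bound \<open>c_low\<close>, which transfers
    \<open>c\<close> from scale \<open>s1\<close> to \<open>s2\<close>.\<close>
  define K' where "K' = 4 * 8 ^ d * (4 * C * 2 ^ d) * \<beta> * s2"
  have K': "K' > 0" using \<beta> C0 s by (simp add: K'_def)
  have Kc': "4 * 8 ^ d * (\<alpha>2 * s2 * \<mu> + 2 * C * \<alpha>1 * s2 * \<mu>) \<le> K' * (c * s2 ^ d)"
  proof -
    have "K' * (\<mu> / (4 * C * 2 ^ d)) \<le> K' * (c * s2 ^ d)" using K' c_low by (intro mult_left_mono) auto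
    moreover have "K' * (\<mu> / (4 * C * 2 ^ d)) = 4 * 8 ^ d * (\<beta> * s2 * \<mu>)" using C0 by (simp add: K'_def)
    ultimately show ?thesis using e by (simp add: add.commute)
  qed
  have h: "plane_dist b U (plane_proj a W y) \<le> 3 * K'"
    by (rule flat_compare_angle(2)[OF F2 F1 s(2) n2 n1 K' Kc' cpos(1)])
  have "\<bar>c - c'\<bar> * (s2 / 4) ^ Suc d \<le> \<beta> * s2 * \<mu> + c' * (3 * K' * (s2 / 2) ^ d)"
    using flat_compare_const[OF F1 F2 s(2) n1 h] unfolding e .
  also have "c' * (3 * K' * (s2 / 2) ^ d) = (c' * s2 ^ d) * (48 * 8 ^ d * C * \<beta> * s2)"
    by (simp add: K'_def power_divide)
  also have "\<dots> \<le> (8 * 2 ^ d * \<mu>) * (48 * 8 ^ d * C * \<beta> * s2)"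
    using b2(2) C0 \<beta> s by (intro mult_right_mono) auto
  also have "\<beta> * s2 * \<mu> + (8 * 2 ^ d * \<mu>) * (48 * 8 ^ d * C * \<beta> * s2) = \<beta> * s2 * \<mu> * (1 + 384 * (2 ^ d * 8 ^ d) * C)"
    by (simp add: algebra_simps)
  also have "(2::real) ^ d * 8 ^ d = 16 ^ d" by (simp flip: power_mult_distrib)
  also have "\<beta> * s2 * \<mu> * (1 + 384 * 16 ^ d * C) \<le> \<beta> * s2 * \<mu> * (385 * 16 ^ d * C)"
  proof (rule mult_left_mono)
    have "1 \<le> 16 ^ d * C" using C mult_mono[of 1 "16 ^ d" 1 C] by simp
    then show "1 + 384 * 16 ^ d * C \<le> 385 * 16 ^ d * C" unfolding mult.assoc by linarith
  qed (use \<beta> s \<mu> in simp)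
  finally have 1: "\<bar>c - c'\<bar> * (s2 / 4) ^ Suc d \<le> \<beta> * s2 * \<mu> * (385 * 16 ^ d * C)" by simp
  have "\<mu> \<le> (4 * C * 2 ^ d) * (c * s2 ^ d)"
    using c_low C0 by (simp add: pos_divide_le_eq mult.commute)
  then have "\<beta> * s2 * \<mu> * (385 * 16 ^ d * C) \<le> \<beta> * s2 * ((4 * C * 2 ^ d) * (c * s2 ^ d)) * (385 * 16 ^ d * C)"
    using \<beta> s C0 by (intro mult_right_mono mult_left_mono) auto
  with 1 have "\<bar>c - c'\<bar> * (s2 / 4) ^ Suc d \<le> \<beta> * s2 * ((4 * C * 2 ^ d) * (c * s2 ^ d)) * (385 * 16 ^ d * C)"
    by linarith
  also have "\<dots> = (4 ^ Suc d * (4 * C * 2 ^ d) * \<beta> * (385 * 16 ^ d * C) * c) * (s2 / 4) ^ Suc d"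
    by (simp add: power_divide mult_ac)
  finally have "\<bar>c - c'\<bar> \<le> 4 ^ Suc d * (4 * C * 2 ^ d) * \<beta> * (385 * 16 ^ d * C) * c"
    using s by (simp only: mult_le_cancel_right_pos zero_less_power divide_pos_pos zero_less_numeral)
  also have "\<dots> \<le> 4 ^ Suc d * (4 * C * 2 ^ d) * (2 * C * (\<alpha>1 + \<alpha>2)) * (385 * 16 ^ d * C) * c"
    using \<beta>le C0 c0 by (intro mult_right_mono mult_left_mono) auto
  also have "\<dots> = (4 ^ (d + 1) * (4 * C * 2 ^ d) * (2 * C) * (385 * 16 ^ d * C)) * ((\<alpha>1 + \<alpha>2) * c)"
    by (simp add: mult_ac)
  also have "\<dots> \<le> K0 * ((\<alpha>1 + \<alpha>2) * c)"
    using K0_ge(2) \<alpha>p c0 by (intro mult_right_mono) auto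
  finally show "\<bar>c - c'\<bar> \<le> K0 * (\<alpha>1 + \<alpha>2) * c" by (simp add: mult.assoc)
qed

text \<open>Each error occurs in two consecutive steps, so the changes \<open>\<theta> j\<close> add
  up to at most \<open>2 * K0 * \<epsilon>\<close>. For the densities the changes are relative to
  \<open>c j\<close>; the induction keeps \<open>c j \<le> 2 * c 0\<close>, which costs another
  factor 2. For the angles a vector is projected from one subspace to the previous one, and its norm
  never grows.\<close>

lemma flat_chain:
  assumes flat: "\<And>k. flat y (s / 2 ^ k) (a k) (W k) (c k) (\<alpha> k)"
    and \<alpha>: "\<And>k. \<alpha> k < \<alpha>0" and sum: "\<And>k. (\<Sum>j<k. \<alpha> j) \<le> \<epsilon>" and \<epsilon>: "4 * K0 * \<epsilon> \<le> 1"
  shows "\<bar>c k - c 0\<bar> \<le> 4 * K0 * \<epsilon> * c 0"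
    and "v \<in> W k \<Longrightarrow> norm (v - orthoproj (W 0) v) \<le> 4 * K0 * \<epsilon> * norm v"
proof -
  define \<theta> where "\<theta> j = K0 * (\<alpha> j + \<alpha> (Suc j))" for j
  have s: "s > 0" using flat[of 0] by (simp add: flat_def)
  have \<alpha>p: "\<alpha> j > 0" for j using flat[of j] by (simp add: flat_def)
  have \<theta>0: "\<theta> j \<ge> 0" for j using K0_pos \<alpha>p[of j] \<alpha>p[of "Suc j"] by (simp add: \<theta>_def)
  have c0: "c j \<ge> 0" for j using flat[of j] flat_approx_nonneg by (auto simp: flat_def)
  have fs: "finspan (W j)" for j
    using flat[of j] flat_plane.fs[OF flat_approx_plane] by (auto simp: flat_def)
  have step: "\<bar>c j - c (Suc j)\<bar> \<le> \<theta> j * c j"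
    "v \<in> W (Suc j) \<Longrightarrow> norm (v - orthoproj (W j) v) \<le> \<theta> j * norm v" for j v
  proof -
    have "s / 2 ^ Suc j \<le> s / 2 ^ j" using s by (simp add: field_simps)
    moreover have "s / 2 ^ j \<le> 2 * (s / 2 ^ Suc j)" by simp
    ultimately show "\<bar>c j - c (Suc j)\<bar> \<le> \<theta> j * c j"
      "v \<in> W (Suc j) \<Longrightarrow> norm (v - orthoproj (W j) v) \<le> \<theta> j * norm v"
      unfolding \<theta>_def by (rule flat_step[OF flat[of j] flat[of "Suc j"] \<alpha> \<alpha>])+
  qed
  have \<theta>sum: "(\<Sum>j<k. \<theta> j) \<le> 2 * K0 * \<epsilon>" for k
  proof -
    have "(\<Sum>j<k. \<alpha> (Suc j)) \<le> (\<Sum>j<Suc k. \<alpha> j)"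
      using \<alpha>p[of 0] by (simp add: sum.lessThan_Suc_shift del: sum.lessThan_Suc)
    then have "(\<Sum>j<k. \<alpha> j) + (\<Sum>j<k. \<alpha> (Suc j)) \<le> 2 * \<epsilon>" using sum[of k] sum[of "Suc k"] by linarith
    then have "K0 * ((\<Sum>j<k. \<alpha> j) + (\<Sum>j<k. \<alpha> (Suc j))) \<le> K0 * (2 * \<epsilon>)"
      using K0_pos by (intro mult_left_mono) auto
    moreover have "(\<Sum>j<k. \<theta> j) = K0 * ((\<Sum>j<k. \<alpha> j) + (\<Sum>j<k. \<alpha> (Suc j)))"
      by (simp only: \<theta>_def sum.distrib sum_distrib_left[symmetric])
    ultimately show ?thesis by simp
  qed
  have "\<bar>c k - c 0\<bar> \<le> 2 * (\<Sum>j<k. \<theta> j) * c 0"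
  proof (induction k)
    case (Suc k)
    have "2 * (\<Sum>j<k. \<theta> j) \<le> 1" using \<theta>sum[of k] \<epsilon> by simp
    then have "2 * (\<Sum>j<k. \<theta> j) * c 0 \<le> 1 * c 0" using c0 by (intro mult_right_mono) auto
    then have "c k \<le> 2 * c 0" using Suc by simp
    then have "\<theta> k * c k \<le> \<theta> k * (2 * c 0)" using \<theta>0 by (intro mult_left_mono) auto
    then show ?case using step(1)[of k] Suc by (simp add: algebra_simps)
  qed simp
  also have "\<dots> \<le> 2 * (2 * K0 * \<epsilon>) * c 0" using \<theta>sum c0 by (intro mult_right_mono mult_left_mono) auto
  finally show "\<bar>c k - c 0\<bar> \<le> 4 * K0 * \<epsilon> * c 0" by simp
  have "norm (v - orthoproj (W 0) v) \<le> (\<Sum>j<k. \<theta> j) * norm v" if "v \<in> W k" for v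
    using that
  proof (induction k arbitrary: v)
    case 0
    then show ?case using orthoproj_id[OF fs] by simp
  next
    case (Suc k)
    let ?u = "orthoproj (W k) v"
    have u: "?u \<in> W k" "norm ?u \<le> norm v" using orthoproj_in[OF fs] norm_orthoproj_le(1)[OF fs] by auto
    have "norm (v - orthoproj (W 0) v) \<le> norm (v - orthoproj (W 0) ?u)"
      by (rule norm_diff_orthoproj_le[OF fs orthoproj_in[OF fs]])
    also have "\<dots> \<le> norm (v - ?u) + norm (?u - orthoproj (W 0) ?u)"
      using norm_triangle_ineq[of "v - ?u" "?u - orthoproj (W 0) ?u"] by simp
    also have "\<dots> \<le> \<theta> k * norm v + (\<Sum>j<k. \<theta> j) * norm ?u"
      using step(2)[OF Suc.prems] Suc.IH[OF u(1)] by (rule add_mono)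
    also have "\<dots> \<le> \<theta> k * norm v + (\<Sum>j<k. \<theta> j) * norm v"
      using u(2) \<theta>0 by (intro add_left_mono mult_left_mono sum_nonneg) auto
    finally show ?case by (simp add: algebra_simps)
  qed
  moreover have "(\<Sum>j<k. \<theta> j) * norm v \<le> 4 * K0 * \<epsilon> * norm v" for v :: fin_seq
  proof (rule mult_right_mono)
    have "0 \<le> (\<Sum>j<k. \<theta> j)" using \<theta>0 by (rule sum_nonneg)
    then show "(\<Sum>j<k. \<theta> j) \<le> 4 * K0 * \<epsilon>" using \<theta>sum[of k] by linarith
  qed simp
  ultimately show "v \<in> W k \<Longrightarrow> norm (v - orthoproj (W 0) v) \<le> 4 * K0 * \<epsilon> * norm v"
    by (meson order.trans)
qed

text \<open>The condition on \<open>k\<close> puts the plane within \<open>\<delta> * t\<close> of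
  \<open>y\<close>. In the cutoff error, \<open>s \<le> 4 * t\<close> gives a factor 4 and, with the
  lower bound on \<open>c\<close>, the factor \<open>4 * C * 4 ^ d\<close>; the condition on
  \<open>\<delta>\<^sup>2\<close> leaves \<delta> after the division by the cutoff width.\<close>

lemma flat_density:
  assumes flat: "flat y s a W c \<alpha>" and \<alpha>: "\<alpha> < \<alpha>0" "\<alpha> < (1/2) ^ (k + 1) / C ^ (k + 2)"
    and k: "k \<ge> 1" "1 / 2 ^ k \<le> \<delta> / 4" and \<delta>: "0 < \<delta>" "2 * \<delta> < 1"
    and \<alpha>\<delta>: "16 * C * 4 ^ d * \<alpha> \<le> \<delta>\<^sup>2" and t: "s / 4 \<le> t" "t * (1 + \<delta>) \<le> s"
  shows "m y t \<le> ((1 + \<delta>) ^ d + \<delta>) * (c * t ^ d)" "((1 - 2 * \<delta>) ^ d - \<delta>) * (c * t ^ d) \<le> m y t"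
proof -
  have s: "s > 0" and y: "y \<in> S" and fl: "flat_approx d M y s a W c (\<alpha> * s * m y s)" and \<alpha>p: "\<alpha> > 0"
    using flat by (auto simp: flat_def)
  have t0: "t > 0" using t s by simp
  have C0: "C > 0" using C by simp
  have c0: "c \<ge> 0" using flat_approx_nonneg[OF fl] .
  have "plane_dist a W y < s / 2 ^ k"
    using y s by (intro flat_near_support[OF flat _ _ \<alpha>(2) k(1)]) auto
  also have "\<dots> = s * (1 / 2 ^ k)" by simp
  also have "\<dots> \<le> (4 * t) * (\<delta> / 4)" using t k(2) s t0 \<delta> by (intro mult_mono) auto
  finally have near: "plane_dist a W y \<le> \<delta> * t" by (simp add: mult.commute)
  have "\<alpha> * s * m y s / (\<delta> * t) \<le> \<delta> * (c * t ^ d)"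
  proof -
    have "m y s \<le> 4 * C * (c * s ^ d)"
      using flat_const_bounds(1)[OF flat \<alpha>(1)] C0 by (simp add: pos_divide_le_eq mult.commute)
    also have "\<dots> \<le> 4 * C * (c * (4 * t) ^ d)"
      using t s c0 C0 by (intro mult_left_mono power_mono) auto
    finally have "\<alpha> * s * m y s \<le> \<alpha> * (4 * t) * (4 * C * (c * (4 * t) ^ d))"
      using t s \<alpha>p by (intro mult_mono mult_left_mono) auto
    also have "\<dots> = (16 * C * 4 ^ d * \<alpha>) * (t * (c * t ^ d))" by (simp add: power_mult_distrib)
    also have "\<dots> \<le> \<delta>\<^sup>2 * (t * (c * t ^ d))" using \<alpha>\<delta> t0 c0 by (intro mult_right_mono) auto
    also have "\<dots> = (\<delta> * (c * t ^ d)) * (\<delta> * t)" by (simp add: power2_eq_square)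
    finally show ?thesis using \<delta> t0 by (simp add: pos_divide_le_eq)
  qed
  then show "m y t \<le> ((1 + \<delta>) ^ d + \<delta>) * (c * t ^ d)" "((1 - 2 * \<delta>) ^ d - \<delta>) * (c * t ^ d) \<le> m y t"
  proof -
    have eq: "c * (t * X) ^ d = X ^ d * (c * t ^ d)" for X
      by (simp only: power_mult_distrib mult_ac)
    show "m y t \<le> ((1 + \<delta>) ^ d + \<delta>) * (c * t ^ d)" "((1 - 2 * \<delta>) ^ d - \<delta>) * (c * t ^ d) \<le> m y t"
      using flat_ball_measure[OF ball_finite_M fl t0 \<delta> t(2) near] \<open>\<alpha> * s * m y s / (\<delta> * t) \<le> \<delta> * (c * t ^ d)\<close>
      unfolding eq distrib_right left_diff_distrib by linarith+
  qed
qed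

end

section \<open>From the coefficients to flat approximations\<close>

lemma scale_measure_eq_density: "scale_measure r M = density M (\<lambda>_. r)"
  by (rule measure_eqI) (auto simp: emeasure_density_const)

lemma integral_scale_measure:
  fixes f :: "'a \<Rightarrow> real"
  assumes "r \<ge> 0" "f \<in> borel_measurable M"
  shows "(\<integral>x. f x \<partial>scale_measure (ennreal r) M) = r * (\<integral>x. f x \<partial>M)"
  unfolding scale_measure_eq_density using assms by (subst integral_density) auto

text \<open>A Radon measure lives on the space \<open>Rn n\<close>; its push-forward to the whole
  sequence space is a Borel measure to which the preceding sections apply.\<close>

definition ambient :: "fin_seq measure \<Rightarrow> fin_seq measure" where
  "ambient \<mu> = distr \<mu> borel (\<lambda>x. x)"

context
  fixes n :: nat and \<mu> :: "fin_seq measure"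
  assumes \<mu>: "radon_measure n \<mu>"
begin

lemma sets_radon: "sets \<mu> = sets (restrict_space borel (Rn n))" and space_radon: "space \<mu> = Rn n"
  using \<mu> by (auto simp: radon_measure_def)

lemma Rn_borel: "Rn n \<in> sets borel"
  using closed_Rn by simp

lemma measurable_radon: "f \<in> borel_measurable borel \<Longrightarrow> f \<in> borel_measurable \<mu>"
  unfolding measurable_cong_sets[OF sets_radon refl] by (rule measurable_restrict_space1)

lemma id_measurable_radon: "(\<lambda>x. x) \<in> \<mu> \<rightarrow>\<^sub>M borel"
  by (rule measurable_radon) simp

lemma sets_radon_iff: "A \<in> sets \<mu> \<longleftrightarrow> A \<in> sets borel \<and> A \<subseteq> Rn n"
  unfolding sets_radon sets_restrict_space_iff[of "Rn n" borel, simplified, OF Rn_borel] by auto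

lemma sets_ambient: "sets (ambient \<mu>) = sets borel"
  by (simp add: ambient_def)

lemma emeasure_ambient: "A \<in> sets borel \<Longrightarrow> emeasure (ambient \<mu>) A = emeasure \<mu> (A \<inter> Rn n)"
  unfolding ambient_def by (subst emeasure_distr[OF id_measurable_radon]) (auto simp: space_radon vimage_def Int_def)

lemma emeasure_ambient_ball: "emeasure (ambient \<mu>) (ball x r) = emeasure \<mu> (Rn_ball n x r)"
  by (simp add: emeasure_ambient Rn_ball_def)

lemma integral_ambient:
  fixes f :: "fin_seq \<Rightarrow> real"
  shows "f \<in> borel_measurable borel \<Longrightarrow> (\<integral>x. f x \<partial>ambient \<mu>) = (\<integral>x. f x \<partial>\<mu>)"
  unfolding ambient_def by (rule integral_distr[OF id_measurable_radon])

lemma integral_rescaled: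
  fixes \<psi> :: "fin_seq \<Rightarrow> real"
  assumes \<psi>: "\<psi> \<in> borel_measurable borel" and z: "z \<in> Rn n" and t: "t > 0"
    and fin: "0 < emeasure \<mu> (Rn_ball n z t)" "emeasure \<mu> (Rn_ball n z t) < \<infinity>"
  shows "(\<integral>x. \<psi> x \<partial>rescaled n \<mu> z t) = (\<integral>x. \<psi> ((x - z) /\<^sub>R t) \<partial>ambient \<mu>) / measure (ambient \<mu>) (ball z t)"
proof -
  define m where "m = measure (ambient \<mu>) (ball z t)"
  have em: "emeasure \<mu> (Rn_ball n z t) = ennreal m"
    unfolding m_def measure_def emeasure_ambient_ball using fin(2) by simp
  have m: "m > 0" using fin(1) unfolding em by simp
  have inv: "inverse (emeasure \<mu> (Rn_ball n z t)) = ennreal (inverse m)"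
    unfolding em by (rule inverse_ennreal[OF m])
  have gb: "(\<lambda>y. (y - z) /\<^sub>R t) \<in> borel_measurable borel"
    by (intro borel_measurable_continuous_onI continuous_intros)
  have g: "(\<lambda>y. (y - z) /\<^sub>R t) \<in> \<mu> \<rightarrow>\<^sub>M \<mu>"
  proof -
    have "(y - z) /\<^sub>R t \<in> Rn n" if "y \<in> Rn n" for y
      using subspace_mul[OF subspace_Rn subspace_diff[OF subspace_Rn that z]] .
    then have "(\<lambda>y. (y - z) /\<^sub>R t) \<in> \<mu> \<rightarrow>\<^sub>M restrict_space borel (Rn n)"
      by (intro measurable_restrict_space2 measurable_radon[OF gb]) (auto simp: space_radon)
    then show ?thesis unfolding measurable_cong_sets[OF refl sets_radon] .
  qed
  have \<psi>\<mu>: "\<psi> \<in> borel_measurable \<mu>" by (rule measurable_radon[OF \<psi>])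
  have "(\<integral>x. \<psi> x \<partial>rescaled n \<mu> z t) = inverse m * (\<integral>x. \<psi> x \<partial>distr \<mu> \<mu> (\<lambda>y. (y - z) /\<^sub>R t))"
    unfolding rescaled_def inv using m \<psi>\<mu> by (intro integral_scale_measure) auto
  also have "(\<integral>x. \<psi> x \<partial>distr \<mu> \<mu> (\<lambda>y. (y - z) /\<^sub>R t)) = (\<integral>x. \<psi> ((x - z) /\<^sub>R t) \<partial>\<mu>)"
    by (rule integral_distr[OF g \<psi>\<mu>])
  also have "\<dots> = (\<integral>x. \<psi> ((x - z) /\<^sub>R t) \<partial>ambient \<mu>)"
    by (rule integral_ambient[symmetric]) (rule measurable_compose[OF gb \<psi>])
  finally show ?thesis by (simp add: m_def divide_inverse mult.commute)
qed

end

text \<open>Meeting the ball of radius 1/2 makes the plane contain a plane ball of that radius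
  inside the unit ball, so the normalizing mass is positive. Since the plane lies in
  \<open>Rn n\<close>, restricting \<open>hausdorff_on\<close> to \<open>Rn n\<close> loses
  nothing.\<close>

lemma integral_plane_measure:
  fixes \<psi> :: "fin_seq \<Rightarrow> real"
  assumes W: "flat_plane d W" and V: "(+) a ` W \<subseteq> Rn n" "(+) a ` W \<inter> Rn_ball n 0 (1/2) \<noteq> {}"
    and \<psi>: "\<psi> \<in> borel_measurable borel"
  defines "\<kappa> \<equiv> measure (hausdorff_on d ((+) a ` W)) (ball 0 1)"
  shows "\<kappa> > 0" "(\<integral>x. \<psi> x \<partial>plane_measure d n ((+) a ` W)) = (\<integral>x. \<psi> x \<partial>hausdorff_on d ((+) a ` W)) / \<kappa>"
proof -
  interpret flat_plane d a W by fact
  obtain p where "p \<in> P \<inter> Rn_ball n 0 (1/2)" using V(2) by blast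
  then have p: "p \<in> P" "dist 0 p < 1 / 2" by (simp_all add: Rn_ball_def)
  have "ball p (1/2) \<subseteq> ball 0 1"
  proof
    fix z assume "z \<in> ball p (1/2)"
    then show "z \<in> ball 0 1" using dist_triangle[of 0 z p] p(2) by simp
  qed
  from measure_ball_mono[OF this] have "(1/2) ^ d \<le> \<kappa>"
    using measure_ball_on[OF p(1), of "1/2"] by (simp add: \<kappa>_def)
  then show \<kappa>: "\<kappa> > 0" using zero_less_power[of "1/2 :: real" d] by linarith
  have "P \<inter> Rn_ball n 0 1 = ball 0 1 \<inter> P" using V(1) by (auto simp: Rn_ball_def)
  then have "hausdorff d (P \<inter> Rn_ball n 0 1) = ennreal \<kappa>"
    using emeasure_ball_fin[of 0 1]
    by (simp add: \<kappa>_def emeasure_hausdorff_on[OF d, symmetric] emeasure_eq_ennreal_measure less_top)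
  then have inv: "inverse (hausdorff d (P \<inter> Rn_ball n 0 1)) = ennreal (inverse \<kappa>)"
    using inverse_ennreal[OF \<kappa>] by simp
  let ?H = "measure_of (Rn n) (sets (restrict_space borel (Rn n))) (\<lambda>A. hausdorff d (A \<inter> P))"
  have R: "Rn n \<in> sets borel" using closed_Rn by simp
  have sR: "A \<in> sets (restrict_space borel (Rn n)) \<Longrightarrow> A \<in> sets borel" for A
    using R by (simp add: sets_restrict_space_iff)
  have H: "?H = restrict_space HP (Rn n)"
    unfolding restrict_space_def[of HP]
  proof -
    have e: "(\<inter>) (Rn n) ` sets HP = sets (restrict_space borel (Rn n))" by (simp add: sets_restrict_space)
    have "sigma_sets (Rn n) (sets (restrict_space borel (Rn n))) = sets (restrict_space borel (Rn n))"
      using sets.sigma_sets_eq[of "restrict_space borel (Rn n)"] by (simp add: space_restrict_space)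
    then show "?H = measure_of (Rn n \<inter> space HP) ((\<inter>) (Rn n) ` sets HP) (emeasure HP)"
      unfolding e space_hausdorff_on Int_UNIV_right
      using sets.space_closed[of "restrict_space borel (Rn n)"]
      by (intro measure_of_eq) (auto simp: emeasure_hausdorff_on[OF d] space_restrict_space dest: sR)
  qed
  have \<psi>H: "\<psi> \<in> borel_measurable (restrict_space HP (Rn n))"
    by (intro measurable_restrict_space1 measurable_N \<psi>)
  have "(\<integral>x. \<psi> x \<partial>plane_measure d n P) = inverse \<kappa> * (\<integral>x. \<psi> x \<partial>restrict_space HP (Rn n))"
    unfolding plane_measure_def inv H using \<kappa> \<psi>H by (intro integral_scale_measure) auto
  also have "(\<integral>x. \<psi> x \<partial>restrict_space HP (Rn n)) = (\<integral>x. indicator (Rn n) x *\<^sub>R \<psi> x \<partial>HP)"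
    using R by (intro integral_restrict_space) auto
  also have "\<dots> = (\<integral>x. \<psi> x \<partial>HP)"
  proof (rule integral_cong_AE)
    show "AE x in HP. indicator (Rn n) x *\<^sub>R \<psi> x = \<psi> x"
      using AE_plane by eventually_elim (use V(1) in auto)
    show "(\<lambda>x. indicator (Rn n) x *\<^sub>R \<psi> x) \<in> borel_measurable HP"
      using measurable_N[OF \<psi>] R by (intro borel_measurable_scaleR borel_measurable_indicator) auto
  qed (rule measurable_N[OF \<psi>])
  finally show "(\<integral>x. \<psi> x \<partial>plane_measure d n P) = (\<integral>x. \<psi> x \<partial>HP) / \<kappa>"
    by (simp add: divide_inverse mult.commute)
qed

lemma integral_hausdorff_on_affine:
  fixes \<phi> :: "fin_seq \<Rightarrow> real"
  assumes d: "d \<ge> 1" and t: "t > 0" and \<phi>: "\<phi> \<in> borel_measurable borel"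
  shows "(\<integral>x. \<phi> (z + t *\<^sub>R x) \<partial>hausdorff_on d V) = (\<integral>x. \<phi> x \<partial>hausdorff_on d ((\<lambda>x. z + t *\<^sub>R x) ` V)) / t ^ d"
proof -
  let ?F = "\<lambda>x. z + t *\<^sub>R x"
  have F: "?F \<in> borel_measurable borel" by (intro borel_measurable_continuous_onI continuous_intros)
  have FV: "?F \<in> borel_measurable (hausdorff_on d V)"
    using F by (subst measurable_cong_sets[OF sets_hausdorff_on refl])
  have eq: "distr (hausdorff_on d V) borel ?F = scale_measure (ennreal (1 / t ^ d)) (hausdorff_on d (?F ` V))"
  proof (rule measure_eqI)
    fix A assume "A \<in> sets (distr (hausdorff_on d V) borel ?F)"
    then have A: "A \<in> sets borel" by simp
    have vA: "?F -` A \<in> sets borel" using measurable_sets[OF F A] by simp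
    have "A \<inter> ?F ` V = ?F ` (?F -` A \<inter> V)" by auto
    moreover have "hausdorff d (?F ` (?F -` A \<inter> V)) = ennreal (t ^ d) * hausdorff d (?F -` A \<inter> V)"
      by (rule hausdorff_similarity[OF t]) (use t in \<open>simp add: dist_norm flip: scaleR_diff_right\<close>)
    ultimately have "ennreal (1 / t ^ d) * hausdorff d (A \<inter> ?F ` V)
        = (ennreal (1 / t ^ d) * ennreal (t ^ d)) * hausdorff d (?F -` A \<inter> V)"
      by (simp only: mult.assoc)
    also have "ennreal (1 / t ^ d) * ennreal (t ^ d) = ennreal (1 / t ^ d * t ^ d)"
      using t by (intro ennreal_mult[symmetric]) auto
    also have "1 / t ^ d * t ^ d = 1" using t by simp
    finally show "emeasure (distr (hausdorff_on d V) borel ?F) A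
        = emeasure (scale_measure (ennreal (1 / t ^ d)) (hausdorff_on d (?F ` V))) A"
      using A vA by (simp add: emeasure_distr[OF FV] emeasure_hausdorff_on[OF d])
  qed simp
  have "(\<integral>x. \<phi> (?F x) \<partial>hausdorff_on d V) = (\<integral>x. \<phi> x \<partial>distr (hausdorff_on d V) borel ?F)"
    by (rule integral_distr[OF FV \<phi>, symmetric])
  also have "\<dots> = 1 / t ^ d * (\<integral>x. \<phi> x \<partial>hausdorff_on d (?F ` V))"
    unfolding eq using t \<phi> by (intro integral_scale_measure) (auto simp: measurable_cong_sets[OF sets_hausdorff_on refl])
  finally show ?thesis by simp
qed

text \<open>A test function \<phi> for the ball corresponds to
  \<open>\<phi> (z + t *\<^sub>R x) / t\<close>, which is again 1-Lipschitz; the division by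
  \<open>t\<close> becomes the factor \<open>t\<close> of the error. The density \<open>c\<close>
  collects the mass of the ball, the normalization of the plane measure and the scaling
  \<open>t ^ d\<close>.\<close>

lemma alpha_imp_flat_approx:
  assumes d: "d \<ge> 1" and \<mu>: "radon_measure n \<mu>" and z: "z \<in> Rn n" and t: "t > 0"
    and fin: "0 < emeasure \<mu> (Rn_ball n z t)" "emeasure \<mu> (Rn_ball n z t) < \<infinity>"
    and \<alpha>: "alpha d n \<mu> z t < ennreal \<alpha>"
  shows "\<exists>a W c. W \<subseteq> Rn n \<and>
    flat_approx d (ambient \<mu>) z t a W c (\<alpha> * t * measure (ambient \<mu>) (ball z t))"
proof -
  define m where "m = measure (ambient \<mu>) (ball z t)"
  have em: "emeasure \<mu> (Rn_ball n z t) = ennreal m"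
    unfolding m_def measure_def emeasure_ambient_ball[OF \<mu>] using fin(2) by simp
  have m: "m > 0" using fin(1) unfolding em by simp
  obtain V where V: "V \<in> planes d n" "W1 n (rescaled n \<mu> z t) (plane_measure d n V) < ennreal \<alpha>"
    using \<alpha> unfolding alpha_def INF_less_iff by blast
  obtain a W where WV: "subspace W" "dim W = d" "V = (+) a ` W"
    and VR: "V \<subseteq> Rn n" "V \<inter> Rn_ball n 0 (1/2) \<noteq> {}"
    using V(1) unfolding planes_def by blast
  have fp: "flat_plane d W" by standard (use d WV in auto)
  interpret flat_plane d a W by (rule fp)
  have aR: "a \<in> Rn n" using VR(1) WV(3) subspace_0[OF WV(1)] by force
  have WR: "W \<subseteq> Rn n"
  proof
    fix w assume "w \<in> W"
    then have "a + w \<in> Rn n" using VR(1) WV(3) by blast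
    then have "(a + w) - a \<in> Rn n" using aR by (intro subspace_diff[OF subspace_Rn])
    then show "w \<in> Rn n" by simp
  qed
  define \<kappa> where "\<kappa> = measure HP (ball 0 1)"
  have \<kappa>: "\<kappa> > 0" unfolding \<kappa>_def
    by (rule integral_plane_measure(1)[OF fp _ _ borel_measurable_const]) (use VR WV(3) in auto)
  define c where "c = m / (\<kappa> * t ^ d)"
  have img: "(\<lambda>x. z + t *\<^sub>R x) ` V = (+) (z + t *\<^sub>R a) ` W"
  proof
    show "(\<lambda>x. z + t *\<^sub>R x) ` V \<subseteq> (+) (z + t *\<^sub>R a) ` W"
    proof
      fix y assume "y \<in> (\<lambda>x. z + t *\<^sub>R x) ` V"
      then obtain w where w: "w \<in> W" "y = z + t *\<^sub>R (a + w)" unfolding WV(3) by blast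
      then have "y = (z + t *\<^sub>R a) + t *\<^sub>R w" by (simp add: scaleR_add_right)
      then show "y \<in> (+) (z + t *\<^sub>R a) ` W" using subspace_mul[OF WV(1) w(1)] by blast
    qed
    show "(+) (z + t *\<^sub>R a) ` W \<subseteq> (\<lambda>x. z + t *\<^sub>R x) ` V"
    proof
      fix y assume "y \<in> (+) (z + t *\<^sub>R a) ` W"
      then obtain w where w: "w \<in> W" "y = (z + t *\<^sub>R a) + w" by blast
      then have "y = z + t *\<^sub>R (a + w /\<^sub>R t)" using t by (simp add: scaleR_add_right)
      moreover have "a + w /\<^sub>R t \<in> V" unfolding WV(3) using subspace_mul[OF WV(1) w(1)] by blast
      ultimately show "y \<in> (\<lambda>x. z + t *\<^sub>R x) ` V" by blast
    qed
  qed
  have "flat_approx d (ambient \<mu>) z t (z + t *\<^sub>R a) W c (\<alpha> * t * m)"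
    unfolding flat_approx_def
  proof (intro conjI allI impI)
    show "flat_plane d W" by (rule fp)
    show "0 \<le> c" using m \<kappa> t by (simp add: c_def)
    fix \<phi> assume \<phi>: "test_fun z t \<phi>"
    have \<phi>m: "\<phi> \<in> borel_measurable borel" by (rule test_fun_measurable[OF \<phi>])
    have \<phi>lip: "1-lipschitz_on UNIV \<phi>" using \<phi> by (simp add: test_fun_def)
    define \<psi> where "\<psi> x = \<phi> (z + t *\<^sub>R x) / t" for x
    have \<psi>m: "\<psi> \<in> borel_measurable borel"
      unfolding \<psi>_def
      by (intro borel_measurable_divide borel_measurable_const measurable_compose[OF _ \<phi>m]
          borel_measurable_continuous_onI continuous_intros)
    have "1-lipschitz_on (Rn n) \<psi>"
    proof (rule lipschitz_onI)
      fix x y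
      have "\<bar>\<phi> (z + t *\<^sub>R x) - \<phi> (z + t *\<^sub>R y)\<bar> \<le> norm (t *\<^sub>R (x - y))"
        using lipschitz_onD[OF \<phi>lip, of "z + t *\<^sub>R x" "z + t *\<^sub>R y"]
        by (simp add: dist_norm scaleR_diff_right)
      then show "dist (\<psi> x) (\<psi> y) \<le> 1 * dist x y"
        using t by (simp add: \<psi>_def dist_norm pos_divide_le_eq mult.commute flip: diff_divide_distrib)
    qed simp
    moreover have "\<forall>x\<in>Rn n - Rn_ball n 0 1. \<psi> x = 0"
    proof
      fix x assume "x \<in> Rn n - Rn_ball n 0 1"
      then have "1 \<le> norm x" by (auto simp: Rn_ball_def)
      then have "t * 1 \<le> t * norm x" using t by (intro mult_left_mono) auto
      then have "z + t *\<^sub>R x \<notin> ball z t" using t by (simp add: dist_norm)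
      then show "\<psi> x = 0" using \<phi> by (simp add: \<psi>_def test_fun_def)
    qed
    ultimately have "ennreal \<bar>(\<integral>x. \<psi> x \<partial>rescaled n \<mu> z t) - (\<integral>x. \<psi> x \<partial>plane_measure d n V)\<bar>
        \<le> W1 n (rescaled n \<mu> z t) (plane_measure d n V)"
      unfolding W1_def by (intro SUP_upper) blast
    then have "ennreal \<bar>(\<integral>x. \<psi> x \<partial>rescaled n \<mu> z t) - (\<integral>x. \<psi> x \<partial>plane_measure d n V)\<bar> < ennreal \<alpha>"
      using V(2) by (rule le_less_trans)
    then have le: "\<bar>(\<integral>x. \<psi> x \<partial>rescaled n \<mu> z t) - (\<integral>x. \<psi> x \<partial>plane_measure d n V)\<bar> < \<alpha>"
      by (simp add: ennreal_less_iff)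
    have I1: "(\<integral>x. \<psi> x \<partial>rescaled n \<mu> z t) = (\<integral>x. \<phi> x \<partial>ambient \<mu>) / t / m"
    proof -
      have "\<psi> ((x - z) /\<^sub>R t) = \<phi> x / t" for x using t by (simp add: \<psi>_def)
      then show ?thesis
        unfolding integral_rescaled[OF \<mu> \<psi>m z t fin] m_def by simp
    qed
    have I2: "(\<integral>x. \<psi> x \<partial>plane_measure d n V) = (\<integral>x. \<phi> x \<partial>hausdorff_on d ((+) (z + t *\<^sub>R a) ` W)) / t ^ d / t / \<kappa>"
    proof -
      have "(\<integral>x. \<psi> x \<partial>plane_measure d n V) = (\<integral>x. \<psi> x \<partial>HP) / \<kappa>"
        unfolding WV(3) \<kappa>_def by (rule integral_plane_measure(2)[OF fp _ _ \<psi>m]) (use VR WV(3) in auto)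
      also have "(\<integral>x. \<psi> x \<partial>HP) = (\<integral>x. \<phi> (z + t *\<^sub>R x) \<partial>hausdorff_on d V) / t"
        by (simp add: \<psi>_def WV(3))
      also have "(\<integral>x. \<phi> (z + t *\<^sub>R x) \<partial>hausdorff_on d V) = (\<integral>x. \<phi> x \<partial>hausdorff_on d ((+) (z + t *\<^sub>R a) ` W)) / t ^ d"
        unfolding integral_hausdorff_on_affine[OF d t \<phi>m] img ..
      finally show ?thesis .
    qed
    define X Y where "X = (\<integral>x. \<phi> x \<partial>ambient \<mu>)" and "Y = (\<integral>x. \<phi> x \<partial>hausdorff_on d ((+) (z + t *\<^sub>R a) ` W))"
    have "(t * m) * \<bar>X / t / m - Y / t ^ d / t / \<kappa>\<bar> \<le> (t * m) * \<alpha>"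
      using le t m unfolding I1 I2 X_def Y_def by (intro mult_left_mono) auto
    moreover have "(t * m) * \<bar>X / t / m - Y / t ^ d / t / \<kappa>\<bar> = \<bar>(t * m) * (X / t / m - Y / t ^ d / t / \<kappa>)\<bar>"
      using t m by (simp add: abs_mult)
    moreover have "(t * m) * (X / t / m - Y / t ^ d / t / \<kappa>) = X - c * Y"
      using t m \<kappa> by (simp add: c_def field_simps)
    ultimately show "\<bar>(\<integral>z. \<phi> z \<partial>ambient \<mu>) - c * (\<integral>z. \<phi> z \<partial>hausdorff_on d ((+) (z + t *\<^sub>R a) ` W))\<bar> \<le> \<alpha> * t * m"
      by (simp add: X_def Y_def mult_ac)
  qed
  then show ?thesis using WR unfolding m_def by blast
qed

section \<open>The set of good points\<close>

lemma dyadic_scale: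
  assumes "0 < \<tau>" "\<tau> \<le> s / 2"
  shows "\<exists>j. s / 2 ^ j / 4 \<le> \<tau> \<and> \<tau> \<le> s / 2 ^ j / (2::real)"
proof -
  have "\<exists>j. s / 2 ^ j / 4 \<le> \<tau>"
  proof -
    obtain j where "s / (4 * \<tau>) < 2 ^ j" using real_arch_pow[of 2 "s / (4 * \<tau>)"] by auto
    then have "s / 2 ^ j / 4 \<le> \<tau>" using assms(1) by (simp add: field_simps)
    then show ?thesis by blast
  qed
  define j where "j = (LEAST j. s / 2 ^ j / 4 \<le> \<tau>)"
  have j: "s / 2 ^ j / 4 \<le> \<tau>" unfolding j_def by (rule LeastI_ex) fact
  show ?thesis
  proof (cases j)
    case 0
    then show ?thesis using j assms by (intro exI[of _ 0]) simp
  next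
    case (Suc i)
    have "\<not> s / 2 ^ i / 4 \<le> \<tau>" using not_less_Least[of i "\<lambda>j. s / 2 ^ j / 4 \<le> \<tau>"] Suc by (simp add: j_def)
    then have "\<tau> \<le> s / 2 ^ j / 2" using Suc by simp
    then show ?thesis using j by blast
  qed
qed

context doubling_support
begin

text \<open>The flat measure of index 0 is a parameter so that chains at different points can be
  required to start from the same one.\<close>

definition chain :: "fin_seq \<Rightarrow> real \<Rightarrow> fin_seq \<Rightarrow> fin_seq set \<Rightarrow> real \<Rightarrow> real \<Rightarrow> bool" where
  "chain y s a0 W0 c0 E \<longleftrightarrow> (\<exists>a W c \<alpha>. a 0 = a0 \<and> W 0 = W0 \<and> c 0 = c0 \<and>
     (\<forall>k. flat y (s / 2 ^ k) (a k) (W k) (c k) (\<alpha> k)) \<and> (\<forall>k. (\<Sum>j<k. \<alpha> j) \<le> E))"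

text \<open>The inequality with \<open>K0\<close> bounds the drift of planes and densities along a
  chain by \<delta>, the one with \<open>\<delta>\<^sup>2\<close> the cutoff error in
  \<open>flat_density\<close>, and the one with \<open>k\<close> puts support points within
  \<open>s * \<delta> / 4\<close> of the plane.\<close>

definition small :: "real \<Rightarrow> real \<Rightarrow> bool" where
  "small \<delta> E \<longleftrightarrow> 0 < \<delta> \<and> \<delta> \<le> 1 / 6 \<and> E < \<alpha>0 \<and> 16 * C * 4 ^ d * E \<le> \<delta>\<^sup>2 \<and> 4 * K0 * E \<le> \<delta> \<and>
     (\<exists>k\<ge>1. 1 / 2 ^ k \<le> \<delta> / 4 \<and> E < (1/2) ^ (k + 1) / C ^ (k + 2))"

lemma chainE:
  assumes "chain y s a0 W0 c0 E" "small \<delta> E"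
  obtains a W c \<alpha> where "a 0 = a0" "W 0 = W0" "c 0 = c0"
    "\<And>k. flat y (s / 2 ^ k) (a k) (W k) (c k) (\<alpha> k)" "\<And>k. \<alpha> k \<le> E"
    "\<And>k. \<bar>c k - c0\<bar> \<le> \<delta> * c0" "\<And>k v. v \<in> W k \<Longrightarrow> norm (v - orthoproj W0 v) \<le> \<delta> * norm v"
proof -
  obtain a W c \<alpha> where *: "a 0 = a0" "W 0 = W0" "c 0 = c0"
    "\<And>k. flat y (s / 2 ^ k) (a k) (W k) (c k) (\<alpha> k)" "\<And>k. (\<Sum>j<k. \<alpha> j) \<le> E"
    using assms(1) unfolding chain_def by blast
  have \<alpha>p: "\<alpha> k > 0" for k using *(4)[of k] by (simp add: flat_def)
  have \<alpha>E: "\<alpha> k \<le> E" for k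
  proof -
    have "\<alpha> k \<le> (\<Sum>j<Suc k. \<alpha> j)" using \<alpha>p by (intro member_le_sum) (auto intro: less_imp_le)
    then show ?thesis using *(5)[of "Suc k"] by simp
  qed
  have E: "E < \<alpha>0" "4 * K0 * E \<le> \<delta>" "\<delta> \<le> 1" using assms(2) by (auto simp: small_def)
  have \<alpha>0: "\<alpha> k < \<alpha>0" for k using \<alpha>E[of k] E by simp
  have KE: "4 * K0 * E \<le> 1" using E by simp
  have c0: "c 0 \<ge> 0" using *(4)[of 0] flat_approx_nonneg by (auto simp: flat_def)
  note ch = flat_chain[OF *(4) \<alpha>0 *(5) KE]
  show thesis
  proof (rule that[OF *(1-4) \<alpha>E])
    show "\<bar>c k - c0\<bar> \<le> \<delta> * c0" for k
      using ch(1)[of k] mult_right_mono[OF E(2) c0] unfolding *(3) by linarith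
    show "norm (v - orthoproj W0 v) \<le> \<delta> * norm v" if "v \<in> W k" for k v
      using ch(2)[OF that] mult_right_mono[OF E(2) norm_ge_zero[of v]] unfolding *(2) by linarith
  qed
qed

lemma flat_near_small:
  assumes "flat y s a W c \<alpha>" "\<alpha> \<le> E" "small \<delta> E" "z \<in> S" "dist y z \<le> s / 2"
  shows "plane_dist a W z \<le> s * \<delta> / 4"
proof -
  obtain k where k: "k \<ge> 1" "1 / 2 ^ k \<le> \<delta> / 4" "E < (1/2) ^ (k + 1) / C ^ (k + 2)"
    using assms(3) unfolding small_def by blast
  have s: "s > 0" using assms(1) by (simp add: flat_def)
  have "plane_dist a W z < s / 2 ^ k"
    using assms k by (intro flat_near_support[OF assms(1)]) auto
  also have "s / 2 ^ k = s * (1 / 2 ^ k)" by simp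
  also have "\<dots> \<le> s * (\<delta> / 4)" using k s by (intro mult_left_mono) auto
  finally show ?thesis by simp
qed

lemma flat_density_small:
  assumes flat: "flat y s a W c \<alpha>" and E: "\<alpha> \<le> E" "small \<delta> E" and t: "s / 4 \<le> t" "t * (1 + \<delta>) \<le> s"
  shows "m y t \<le> ((1 + \<delta>) ^ d + \<delta>) * (c * t ^ d)" "((1 - 2 * \<delta>) ^ d - \<delta>) * (c * t ^ d) \<le> m y t"
proof -
  obtain k where k: "k \<ge> 1" "1 / 2 ^ k \<le> \<delta> / 4" "E < (1/2) ^ (k + 1) / C ^ (k + 2)"
    using E(2) unfolding small_def by blast
  have sm: "0 < \<delta>" "2 * \<delta> < 1" "E < \<alpha>0" "16 * C * 4 ^ d * E \<le> \<delta>\<^sup>2" using E(2) by (auto simp: small_def)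
  have "16 * C * 4 ^ d * \<alpha> \<le> 16 * C * 4 ^ d * E" using E C by (intro mult_left_mono) auto
  then have "16 * C * 4 ^ d * \<alpha> \<le> \<delta>\<^sup>2" using sm by linarith
  then show "m y t \<le> ((1 + \<delta>) ^ d + \<delta>) * (c * t ^ d)" "((1 - 2 * \<delta>) ^ d - \<delta>) * (c * t ^ d) \<le> m y t"
    using flat_density[OF flat _ _ k(1,2) sm(1,2) _ t] E sm k(3) by linarith+
qed

text \<open>Every radius \<open>t \<le> s / 2\<close> has a dyadic scale between
  \<open>2 * t\<close> and \<open>4 * t\<close>, so there is room for the factor
  \<open>1 + \<delta>\<close>. At that scale the density differs from \<open>c0\<close> by at most
  \<open>\<delta> * c0\<close>.\<close>

lemma chain_density:
  assumes ch: "chain y s a0 W0 c0 E" "small \<delta> E" and t: "0 < t" "t \<le> s / 2"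
    and L: "0 \<le> (1 - 2 * \<delta>) ^ d - \<delta>"
  shows "m y t \<le> ((1 + \<delta>) ^ d + \<delta>) * (1 + \<delta>) * c0 * t ^ d"
    and "((1 - 2 * \<delta>) ^ d - \<delta>) * (1 - \<delta>) * c0 * t ^ d \<le> m y t"
proof -
  obtain a W c \<alpha> where *: "\<And>k. flat y (s / 2 ^ k) (a k) (W k) (c k) (\<alpha> k)" "\<And>k. \<alpha> k \<le> E"
    "\<And>k. \<bar>c k - c0\<bar> \<le> \<delta> * c0"
    using chainE[OF ch] by metis
  obtain j where j: "s / 2 ^ j / 4 \<le> t" "t \<le> s / 2 ^ j / 2" using dyadic_scale[OF t] by blast
  have \<delta>: "0 < \<delta>" "\<delta> \<le> 1" using ch(2) by (auto simp: small_def)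
  have "t * (1 + \<delta>) \<le> (s / 2 ^ j / 2) * 2" using j t \<delta> by (intro mult_mono) auto
  then have t2: "t * (1 + \<delta>) \<le> s / 2 ^ j" by simp
  note fd = flat_density_small[OF *(1)[of j] *(2) ch(2) j(1) t2]
  have cj: "c j \<le> (1 + \<delta>) * c0" "(1 - \<delta>) * c0 \<le> c j" using *(3)[of j] by (auto simp: abs_le_iff algebra_simps)
  have "((1 + \<delta>) ^ d + \<delta>) * (c j * t ^ d) \<le> ((1 + \<delta>) ^ d + \<delta>) * ((1 + \<delta>) * c0 * t ^ d)"
    using cj t \<delta> by (intro mult_left_mono mult_right_mono) auto
  then show "m y t \<le> ((1 + \<delta>) ^ d + \<delta>) * (1 + \<delta>) * c0 * t ^ d" using fd(1) unfolding mult.assoc by linarith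
  have "((1 - 2 * \<delta>) ^ d - \<delta>) * ((1 - \<delta>) * c0 * t ^ d) \<le> ((1 - 2 * \<delta>) ^ d - \<delta>) * (c j * t ^ d)"
    using cj t L by (intro mult_left_mono mult_right_mono) auto
  then show "((1 - 2 * \<delta>) ^ d - \<delta>) * (1 - \<delta>) * c0 * t ^ d \<le> m y t" using fd(2) unfolding mult.assoc by linarith
qed

text \<open>At the dyadic scale comparable with \<open>dist y z\<close> the plane of the chain at
  \<open>y\<close> passes close to both points, because \<open>z\<close> lies in the support as
  well. This costs \<open>2 * \<delta>\<close>, and the tilt of that plane against \<open>W0\<close>
  one more \<delta>. For points farther apart than \<open>s / 2\<close> the common plane of index 0
  is used; each chain shows that it is close to its own point.\<close>

lemma chain_cone:
  assumes ch: "chain y s a0 W0 c0 E" "chain z s a0 W0 c0 E" and sm: "small \<delta> E"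
  shows "norm ((y - z) - orthoproj W0 (y - z)) \<le> 3 * \<delta> * dist y z"
proof -
  obtain a W c \<alpha> where *: "a 0 = a0" "W 0 = W0" "\<And>k. flat y (s / 2 ^ k) (a k) (W k) (c k) (\<alpha> k)" "\<And>k. \<alpha> k \<le> E"
    "\<And>k v. v \<in> W k \<Longrightarrow> norm (v - orthoproj W0 v) \<le> \<delta> * norm v"
    using chainE[OF ch(1) sm] by metis
  obtain a' W' c' \<alpha>' where **: "a' 0 = a0" "W' 0 = W0" "\<And>k. flat z (s / 2 ^ k) (a' k) (W' k) (c' k) (\<alpha>' k)" "\<And>k. \<alpha>' k \<le> E"
    using chainE[OF ch(2) sm] by metis
  have \<delta>: "0 < \<delta>" using sm by (simp add: small_def)
  have yS: "y \<in> S" and zS: "z \<in> S" and s: "s > 0" using *(3)[of 0] **(3)[of 0] by (auto simp: flat_def)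
  have fs: "finspan (W k)" for k
    using *(3)[of k] flat_plane.fs[OF flat_approx_plane] by (auto simp: flat_def)
  have diff: "norm ((y - z) - orthoproj X (y - z)) \<le> plane_dist b X y + plane_dist b X z" if "finspan X" for b X
  proof -
    have "(y - z) - orthoproj X (y - z) = ((y - b) - orthoproj X (y - b)) - ((z - b) - orthoproj X (z - b))"
      using linear_diff[OF linear_orthoproj[OF that], of "y - b" "z - b"] by (simp add: algebra_simps)
    then show ?thesis unfolding plane_dist_eq by (metis norm_triangle_ineq4)
  qed
  consider "y = z" | "0 < dist y z" "dist y z \<le> s / 2" | "dist y z > s / 2" by fastforce
  then show ?thesis
  proof cases
    case 1
    then show ?thesis using linear_0[OF linear_orthoproj[OF fs[of 0]]] *(2) by simp
  next
    case 3
    have "plane_dist a0 W0 y \<le> s * \<delta> / 4"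
      using flat_near_small[OF *(3)[of 0] *(4) sm yS] s *(1,2) by simp
    moreover have "plane_dist a0 W0 z \<le> s * \<delta> / 4"
      using flat_near_small[OF **(3)[of 0] **(4) sm zS] s **(1,2) by simp
    ultimately have "norm ((y - z) - orthoproj W0 (y - z)) \<le> s / 2 * \<delta>"
      using diff[OF fs[of 0], of a0] *(2) by simp
    also have "\<dots> \<le> dist y z * \<delta>" using 3 \<delta> by (intro mult_right_mono) auto
    also have "\<dots> \<le> 3 * \<delta> * dist y z" using \<delta> by simp
    finally show ?thesis .
  next
    case 2
    obtain j where j: "s / 2 ^ j / 4 \<le> dist y z" "dist y z \<le> s / 2 ^ j / 2" using dyadic_scale[OF 2] by blast
    let ?v = "orthoproj (W j) (y - z)"
    have v: "?v \<in> W j" "norm ?v \<le> dist y z"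
      using orthoproj_in[OF fs] norm_orthoproj_le(1)[OF fs, of j "y - z"] by (auto simp: dist_norm)
    have sj: "s / 2 ^ j > 0" using s by simp
    have p1: "plane_dist (a j) (W j) y \<le> s / 2 ^ j * \<delta> / 4"
      using sj by (intro flat_near_small[OF *(3) *(4) sm yS]) simp
    have p2: "plane_dist (a j) (W j) z \<le> s / 2 ^ j * \<delta> / 4"
      by (rule flat_near_small[OF *(3) *(4) sm zS j(2)])
    have "norm ((y - z) - ?v) \<le> s / 2 ^ j * \<delta> / 4 + s / 2 ^ j * \<delta> / 4"
      by (rule order.trans[OF diff[OF fs[of j], of "a j"] add_mono[OF p1 p2]])
    also have "\<dots> = 2 * ((s / 2 ^ j / 4) * \<delta>)" by simp
    also have "\<dots> \<le> 2 * (dist y z * \<delta>)" using j(1) \<delta> by (intro mult_left_mono mult_right_mono) auto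
    finally have 1: "norm ((y - z) - ?v) \<le> 2 * (dist y z * \<delta>)" .
    have "norm (?v - orthoproj W0 ?v) \<le> \<delta> * norm ?v" by (rule *(5)[OF v(1)])
    also have "\<dots> \<le> \<delta> * dist y z" using v(2) \<delta> by (intro mult_left_mono) auto
    finally have 2: "norm (?v - orthoproj W0 ?v) \<le> \<delta> * dist y z" .
    have fs0: "finspan W0" using fs[of 0] *(2) by simp
    have "norm ((y - z) - orthoproj W0 (y - z)) \<le> norm ((y - z) - orthoproj W0 ?v)"
      by (rule norm_diff_orthoproj_le[OF fs0 orthoproj_in[OF fs0]])
    also have "\<dots> \<le> norm ((y - z) - ?v) + norm (?v - orthoproj W0 ?v)"
      using norm_triangle_ineq[of "(y - z) - ?v" "?v - orthoproj W0 ?v"] by simp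
    also have "\<dots> \<le> 2 * (dist y z * \<delta>) + \<delta> * dist y z" using 1 2 by (rule add_mono)
    finally show ?thesis by (simp add: algebra_simps)
  qed
qed

end

section \<open>From the cone condition to a Lipschitz graph\<close>

lemma closed_orthogonal_comp_Rn: "closed (V\<^sup>\<bottom> \<inter> Rn n)"
proof -
  have "V\<^sup>\<bottom> = (\<Inter>w\<in>V. {x. w \<bullet> x = 0})" by (auto simp: orthogonal_comp_def orthogonal_def)
  moreover have "closed {x. w \<bullet> x = 0}" for w :: fin_seq
    by (intro closed_Collect_eq continuous_intros)
  ultimately have "closed (V\<^sup>\<bottom>)" by (simp add: closed_INT)
  then show ?thesis using closed_Rn by (rule closed_Int)
qed

text \<open>Splitting \<open>dist y z\<close> into its parts along and across \<open>V\<close> and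
  absorbing the latter, possible because \<open>3 * \<delta> \<le> 1 / 2\<close>, gives slope
  \<open>6 * \<delta>\<close>. So \<open>A\<close> is a graph over its projection, and
  \<open>kirszbraun_extension\<close> extends the map to \<open>V\<close> without loss and with
  values orthogonal to \<open>V\<close>.\<close>

lemma cone_imp_lipschitz_graph:
  assumes d: "d \<ge> 1" and V: "subspace V" "dim V = d" "V \<subseteq> Rn n" and A: "A \<subseteq> Rn n"
    and \<delta>: "0 < \<delta>" "\<delta> \<le> 1 / 6"
    and cone: "\<And>y z. y \<in> A \<Longrightarrow> z \<in> A \<Longrightarrow> norm ((y - z) - orthoproj V (y - z)) \<le> 3 * \<delta> * dist y z"
  shows "\<exists>f. f ` V \<subseteq> V\<^sup>\<bottom> \<inter> Rn n \<and> (6 * \<delta>)-lipschitz_on V f \<and> A \<subseteq> (\<lambda>x. x + f x) ` V"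
proof -
  have fs: "finspan V" by (rule finspan_of_dim[OF V(1,2) d])
  let ?\<pi> = "orthoproj V"
  have lin: "?\<pi> (y - z) = ?\<pi> y - ?\<pi> z" for y z by (rule linear_diff[OF linear_orthoproj[OF fs]])
  have lip: "dist (y - ?\<pi> y) (z - ?\<pi> z) \<le> 6 * \<delta> * dist (?\<pi> y) (?\<pi> z)" if "y \<in> A" "z \<in> A" for y z
  proof -
    let ?T = "(y - z) - ?\<pi> (y - z)"
    have "norm ?T \<le> 3 * \<delta> * dist y z" by (rule cone[OF that])
    also have "\<dots> \<le> 3 * \<delta> * (norm (?\<pi> (y - z)) + norm ?T)"
      using \<delta> norm_triangle_ineq[of "?\<pi> (y - z)" ?T] by (intro mult_left_mono) (auto simp: dist_norm)
    also have "\<dots> \<le> 3 * \<delta> * norm (?\<pi> (y - z)) + 1 / 2 * norm ?T"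
      using \<delta> mult_right_mono[of "3 * \<delta>" "1 / 2" "norm ?T"] by (simp add: distrib_left)
    finally have "norm ?T \<le> 6 * \<delta> * norm (?\<pi> (y - z))" by simp
    then show ?thesis by (simp add: dist_norm lin algebra_simps)
  qed
  define g where "g v = (SOME y. y \<in> A \<and> ?\<pi> y = v)" for v
  have g: "g v \<in> A" "?\<pi> (g v) = v" if "v \<in> ?\<pi> ` A" for v
    using someI_ex[of "\<lambda>y. y \<in> A \<and> ?\<pi> y = v"] that unfolding g_def by auto
  define f0 where "f0 v = g v - v" for v
  have f0: "f0 v = g v - ?\<pi> (g v)" if "v \<in> ?\<pi> ` A" for v using g(2)[OF that] by (simp add: f0_def)
  let ?T = "V\<^sup>\<bottom> \<inter> Rn n"
  have perp: "y - ?\<pi> y \<in> ?T" if "y \<in> Rn n" for y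
  proof -
    have "?\<pi> y \<in> Rn n" using orthoproj_in[OF fs] V(3) by blast
    then have "y - ?\<pi> y \<in> Rn n" using that by (intro subspace_diff[OF subspace_Rn])
    moreover have "y - ?\<pi> y \<in> V\<^sup>\<bottom>"
      using orthoproj_orth[OF fs, of _ y] by (auto simp: orthogonal_comp_def orthogonal_def inner_commute)
    ultimately show ?thesis by blast
  qed
  have "\<exists>f. (6 * \<delta>)-lipschitz_on V f \<and> f ` V \<subseteq> ?T \<and> (\<forall>v\<in>?\<pi> ` A. f v = f0 v)"
  proof (rule kirszbraun_extension)
    show "(6 * \<delta>)-lipschitz_on (?\<pi> ` A) f0"
    proof (rule lipschitz_onI)
      fix u v assume "u \<in> ?\<pi> ` A" "v \<in> ?\<pi> ` A"
      then show "dist (f0 u) (f0 v) \<le> 6 * \<delta> * dist u v"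
        using lip[of "g u" "g v"] g f0 by simp
    qed (use \<delta> in simp)
    show "f0 ` ?\<pi> ` A \<subseteq> ?T"
    proof
      fix w assume "w \<in> f0 ` ?\<pi> ` A"
      then obtain v where v: "v \<in> ?\<pi> ` A" "w = f0 v" by blast
      then show "w \<in> ?T" using perp[of "g v"] g(1)[OF v(1)] A f0[OF v(1)] by auto
    qed
    show "?\<pi> ` A \<subseteq> V" using orthoproj_in[OF fs] by blast
    have "subspace ?T" by (intro subspace_inter subspace_orthogonal_comp subspace_Rn)
    then show "convex ?T" "?T \<noteq> {}" using subspace_imp_convex subspace_0 by blast+
    show "compact (cball y r \<inter> ?T)" for y r
    proof -
      have "cball y r \<inter> ?T = (cball y r \<inter> Rn n) \<inter> ?T" by blast
      then show ?thesis using compact_Int_closed[OF compact_cball_Rn closed_orthogonal_comp_Rn] by metis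
    qed
  qed (use \<delta> in simp)
  then obtain f where f: "(6 * \<delta>)-lipschitz_on V f" "f ` V \<subseteq> ?T" "\<And>v. v \<in> ?\<pi> ` A \<Longrightarrow> f v = f0 v" by blast
  have "A \<subseteq> (\<lambda>x. x + f x) ` V"
  proof
    fix y assume y: "y \<in> A"
    let ?v = "?\<pi> y"
    have v: "?v \<in> ?\<pi> ` A" using y by blast
    have "dist (y - ?v) (g ?v - ?\<pi> (g ?v)) \<le> 6 * \<delta> * dist ?v (?\<pi> (g ?v))" by (rule lip[OF y g(1)[OF v]])
    then have "f0 ?v = y - ?v" using g(2)[OF v] f0[OF v] by simp
    then have "y = ?v + f ?v" using f(3)[OF v] by simp
    then show "y \<in> (\<lambda>x. x + f x) ` V" using orthoproj_in[OF fs] by blast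
  qed
  then show ?thesis using f by blast
qed

section \<open>Comparison of the measure with Hausdorff measure on subsets of
  \<open>A\<close>\<close>

lemma measure_density_indicator:
  assumes "B \<in> sets M" "X \<in> sets M" "X \<subseteq> B"
  shows "measure (density M (indicator B)) X = measure M X"
  unfolding measure_def using emeasure_restricted[OF assms(1,2)] assms(3) by (simp add: Int_absorb1)

context doubling_support
begin

text \<open>Small balls centred on \<open>A\<close> have measure close to \<open>c0 * t ^ d\<close>
  for \<open>M\<close> and close to \<open>t ^ d\<close> for Hausdorff measure on the graph, so the
  covering lemma applies in both directions. The ball estimates are for open balls and the covering
  uses closed ones; enclosing a closed ball in an open one of radius
  \<open>t * (1 + \<delta>)\<close> accounts for the factor
  \<open>(1 + \<delta>) ^ d\<close>.\<close>

lemma chain_hausdorff_comparison: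
  assumes r: "r > 0" and A: "A \<subseteq> ball x r" and ch: "\<And>y. y \<in> A \<Longrightarrow> chain y (r / 4) a0 W0 c0 E"
    and sm: "small \<delta> E" and c0: "c0 > 0" and Lpos: "(1 - 2 * \<delta>) ^ d - \<delta> > 0"
    and V: "subspace V" "dim V = d" and f: "f ` V \<subseteq> V\<^sup>\<bottom>" "g-lipschitz_on V f"
    and AG: "A \<subseteq> (\<lambda>x. x + f x) ` V" and Z: "Z \<in> sets borel" "Z \<subseteq> A"
  defines "L \<equiv> ((1 - 2 * \<delta>) ^ d - \<delta>) * (1 - \<delta>)" and "U \<equiv> ((1 + \<delta>) ^ d + \<delta>) * (1 + \<delta>)"
  shows "hausdorff d Z < \<infinity>"
    and "measure M Z \<le> (U * c0 * ((1 + \<delta>) * (1 + g)) ^ d) * enn2real (hausdorff d Z)"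
    and "enn2real (hausdorff d Z) \<le> (((1 + \<delta>) * (1 + g)) ^ d / (L * c0)) * measure M Z"
proof -
  let ?G = "(\<lambda>x. x + f x) ` V"
  have \<delta>: "0 < \<delta>" "\<delta> \<le> 1 / 6" using sm by (auto simp: small_def)
  have g: "g \<ge> 0" using f(2) lipschitz_on_nonneg by blast
  have L: "L > 0" using Lpos \<delta> by (simp add: L_def)
  have U: "U > 0" using \<delta> by (simp add: U_def add_pos_pos)
  have M_up: "m y t \<le> U * c0 * t ^ d" and M_low: "L * c0 * t ^ d \<le> m y t"
    if "y \<in> A" "0 < t" "t \<le> r / 8" for y t
    unfolding U_def L_def using that Lpos by (auto intro!: chain_density[OF ch sm])
  define N where "N = hausdorff_on d ?G"
  have sN: "sets N = sets borel" by (simp add: N_def)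
  have N_up: "emeasure N (ball y t) \<le> ennreal (((1 + g) * t) ^ d)"
    and N_low: "ennreal ((t / (1 + g)) ^ d) \<le> emeasure N (ball y t)" if y: "y \<in> A" and t: "t > 0" for y t
  proof -
    obtain v where "v \<in> V" "y = v + f v" using AG y by blast
    then show "emeasure N (ball y t) \<le> ennreal (((1 + g) * t) ^ d)" "ennreal ((t / (1 + g)) ^ d) \<le> emeasure N (ball y t)"
      using hausdorff_graph_ball[OF d V f _ t, of v] by (simp_all add: N_def emeasure_hausdorff_on[OF d])
  qed
  have ZN: "emeasure N Z = hausdorff d Z"
    using Z AG by (simp add: N_def emeasure_hausdorff_on[OF d] Int_absorb2 subset_trans)
  have "hausdorff d Z < \<infinity> \<and> measure M Z \<le> (U * c0 * ((1 + \<delta>) * (1 + g)) ^ d) * measure N Z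
      \<and> measure N Z \<le> (((1 + \<delta>) * (1 + g)) ^ d / (L * c0)) * measure M Z"
  proof (cases "Z = {}")
    case True
    then show ?thesis by (simp add: hausdorff_empty[OF d])
  next
    case False
    then obtain y0 where y0: "y0 \<in> A" using Z by blast
    let ?B = "ball x (2 * r)"
    have "?B \<subseteq> ball y0 (3 * r)"
    proof
      fix u assume "u \<in> ?B"
      moreover have "dist x y0 < r" using y0 A by auto
      ultimately show "u \<in> ball y0 (3 * r)" using dist_triangle[of y0 u x] by (simp add: dist_commute)
    qed
    then have "emeasure N ?B \<le> emeasure N (ball y0 (3 * r))" by (rule emeasure_mono) (simp add: sN)
    also have "\<dots> < \<infinity>" using N_up[OF y0, of "3 * r"] r by (auto intro: le_less_trans)
    finally have NB: "emeasure N ?B < \<infinity>" .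
    have ZB: "Z \<subseteq> ?B" using Z A r by (force simp: subset_eq)
    have "emeasure N Z \<le> emeasure N ?B" by (rule emeasure_mono[OF ZB]) (simp add: sN)
    then have hZ: "hausdorff d Z < \<infinity>" using NB ZN by (auto intro: le_less_trans)
    have N_fin: "emeasure N X < \<infinity>" if "X \<subseteq> ?B" for X
      using emeasure_mono[OF that, of N] NB by (auto simp: sN intro: le_less_trans)
    have N_ball: "measure N (ball y t) \<le> ((1 + g) * t) ^ d" "(t / (1 + g)) ^ d \<le> measure N (ball y t)"
      if "y \<in> A" "0 < t" "ball y t \<subseteq> ?B" for y t
    proof -
      have e: "emeasure N (ball y t) = ennreal (measure N (ball y t))"
        using N_fin[OF that(3)] by (intro emeasure_eq_ennreal_measure) auto
      show "measure N (ball y t) \<le> ((1 + g) * t) ^ d" "(t / (1 + g)) ^ d \<le> measure N (ball y t)"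
        using N_up[OF that(1,2)] N_low[OF that(1,2)] that(2) g unfolding e by (simp_all add: ennreal_le_iff)
    qed
    have N_mono: "measure N X \<le> measure N Y" if "X \<subseteq> Y" "Y \<subseteq> ?B" "X \<in> sets borel" "Y \<in> sets borel" for X Y
      using that N_fin[of Y] by (intro measure_mono_fmeasurable) (auto simp: sN fmeasurable_def)
    have M_mono: "measure M X \<le> measure M Y" if "X \<subseteq> Y" "Y \<subseteq> ?B" "X \<in> sets borel" "Y \<in> sets borel" for X Y
    proof (rule measure_mono_fmeasurable[OF that(1)])
      have "emeasure M Y \<le> emeasure M ?B" by (rule emeasure_mono) (use that in \<open>auto simp: sets_N\<close>)
      then have "emeasure M Y < \<infinity>" using fin_N by (rule le_less_trans)
      then show "Y \<in> fmeasurable M" using that by (auto simp: sets_N fmeasurable_def)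
    qed (use that in \<open>simp add: sets_N\<close>)
    have inB: "ball y t \<subseteq> ?B" "cball y t \<subseteq> ?B" if "y \<in> A" "t \<le> r / 8" for y t
    proof -
      have "dist x u < 2 * r" if "dist y u \<le> r / 8" for u
      proof -
        have "dist x y < r" using \<open>y \<in> A\<close> A by auto
        then show ?thesis using dist_triangle[of x u y] that r by (simp add: dist_commute)
      qed
      then show "ball y t \<subseteq> ?B" "cball y t \<subseteq> ?B" using that(2) by (auto simp: subset_eq)
    qed
    have cb: "ball y t \<subseteq> cball y t" "cball y t \<subseteq> ball y (t * (1 + \<delta>))" if "t > 0" for y :: fin_seq and t
    proof -
      have "t < t * (1 + \<delta>)" using that \<delta> by (simp add: distrib_left)
      then show "cball y t \<subseteq> ball y (t * (1 + \<delta>))" by (auto simp: subset_eq)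
    qed (rule ball_subset_cball)
    \<comment> \<open>Chains of scale \<open>r / 4\<close> control radii up to \<open>r / 8\<close>.
      The bound \<open>r / 32\<close> on the radii of the covering is such that threefold balls,
      further enlarged by \<open>1 + \<delta> \<le> 7 / 6\<close>, remain below it.\<close>
    have small_t: "t * (1 + \<delta>) \<le> r / 8" "t \<le> r / 8" if "0 < t" "t \<le> 3 * (r / 32)" for t
    proof -
      have "t * (1 + \<delta>) \<le> (3 * (r / 32)) * (7 / 6)" using that \<delta> by (intro mult_mono) auto
      then show "t * (1 + \<delta>) \<le> r / 8" using r by simp
      show "t \<le> r / 8" using that r by simp
    qed
    have M_c: "measure M (cball y t) \<le> U * c0 * (t * (1 + \<delta>)) ^ d" "L * c0 * t ^ d \<le> measure M (cball y t)"
      and N_c: "measure N (cball y t) \<le> ((1 + g) * (t * (1 + \<delta>))) ^ d" "(t / (1 + g)) ^ d \<le> measure N (cball y t)"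
      if y: "y \<in> A" and t: "0 < t" "t \<le> 3 * (r / 32)" for y t
    proof -
      note st = small_t[OF t]
      have t1: "0 < t * (1 + \<delta>)" using t \<delta> by simp
      have "measure M (cball y t) \<le> m y (t * (1 + \<delta>))"
        by (rule M_mono[OF cb(2)[OF t(1)] inB(1)[OF y st(1)]]) auto
      then show "measure M (cball y t) \<le> U * c0 * (t * (1 + \<delta>)) ^ d" using M_up[OF y t1 st(1)] by linarith
      have "m y t \<le> measure M (cball y t)"
        by (rule M_mono[OF cb(1)[OF t(1)] inB(2)[OF y st(2)]]) auto
      then show "L * c0 * t ^ d \<le> measure M (cball y t)" using M_low[OF y t(1) st(2)] by linarith
      have "measure N (cball y t) \<le> measure N (ball y (t * (1 + \<delta>)))"
        by (rule N_mono[OF cb(2)[OF t(1)] inB(1)[OF y st(1)]]) auto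
      then show "measure N (cball y t) \<le> ((1 + g) * (t * (1 + \<delta>))) ^ d"
        using N_ball(1)[OF y t1 inB(1)[OF y st(1)]] by linarith
      have "measure N (ball y t) \<le> measure N (cball y t)"
        by (rule N_mono[OF cb(1)[OF t(1)] inB(2)[OF y st(2)]]) auto
      then show "(t / (1 + g)) ^ d \<le> measure N (cball y t)"
        using N_ball(2)[OF y t(1) inB(1)[OF y st(2)]] by linarith
    qed
    \<comment> \<open>The covering lemma is for finite measures, so both are cut off to a ball that
      contains all balls in play.\<close>
    let ?M = "density M (indicator ?B)" and ?N = "density N (indicator ?B)"
    have sB: "?B \<in> sets M" "?B \<in> sets N" by (simp_all add: sets_N sN)
    have Meq: "measure ?M X = measure M X" and Neq: "measure ?N X = measure N X"
      if "X \<in> sets borel" "X \<subseteq> ?B" for X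
      using that sB by (auto intro!: measure_density_indicator simp: sets_N sN)
    have fM: "emeasure ?M UNIV < \<infinity>" "emeasure ?N UNIV < \<infinity>"
      using emeasure_restricted[OF sB(1), of UNIV] emeasure_restricted[OF sB(2), of UNIV] fin_N[of x "2 * r"] NB
      by (simp_all add: sets_N sN)
    have ss: "sets ?M = sets borel" "sets ?N = sets borel" by (simp_all add: sets_N sN)
    have t32: "r / 32 > 0" using r by simp
    have cB: "cball y t \<subseteq> ?B" "cball y (3 * t) \<subseteq> ?B" if "y \<in> Z" "t < r / 32" for y t
    proof -
      have "y \<in> A" using that(1) Z(2) by blast
      then show "cball y t \<subseteq> ?B" "cball y (3 * t) \<subseteq> ?B" using that(2) r by (simp_all add: inB(2))
    qed
    let ?k1 = "U * c0 * ((1 + \<delta>) * (1 + g)) ^ d" and ?k2 = "((1 + \<delta>) * (1 + g)) ^ d / (L * c0)"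
    have Lc: "L * c0 > 0" using L c0 by simp
    have "measure ?M Z \<le> ?k1 * measure ?N Z"
    proof (rule measure_le_of_cball_measure_le[OF ss fM Z(1) t32, where \<Lambda> = "U * (3 * (1 + \<delta>)) ^ d / L"])
      show "?k1 \<ge> 0" using U c0 \<delta> g by simp
      fix y t assume y: "y \<in> Z" and t: "0 < t" "t < r / 32"
      have yA: "y \<in> A" using y Z by blast
      have "measure M (cball y t) \<le> U * c0 * (t * (1 + \<delta>)) ^ d" using M_c(1)[OF yA t(1)] t by simp
      also have "\<dots> = ?k1 * (t / (1 + g)) ^ d"
        using g by (simp add: power_mult_distrib power_divide)
      also have "\<dots> \<le> ?k1 * measure N (cball y t)"
        using N_c(2)[OF yA t(1)] t U c0 \<delta> g by (intro mult_left_mono) auto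
      finally show "measure ?M (cball y t) \<le> ?k1 * measure ?N (cball y t)"
        using cB[OF y t(2)] by (simp add: Meq Neq)
      have "measure M (cball y (3 * t)) \<le> U * c0 * ((3 * t) * (1 + \<delta>)) ^ d" using M_c(1)[OF yA, of "3 * t"] t by simp
      also have "\<dots> = (U * (3 * (1 + \<delta>)) ^ d / L) * (L * c0 * t ^ d)"
      proof -
        have "((3 * t) * (1 + \<delta>)) ^ d = (3 * (1 + \<delta>)) ^ d * t ^ d" by (simp only: power_mult_distrib mult_ac)
        then show ?thesis using L by simp
      qed
      also have "\<dots> \<le> (U * (3 * (1 + \<delta>)) ^ d / L) * measure M (cball y t)"
        using M_c(2)[OF yA t(1)] t U L \<delta> by (intro mult_left_mono) auto
      finally show "measure ?M (cball y (3 * t)) \<le> (U * (3 * (1 + \<delta>)) ^ d / L) * measure ?M (cball y t)"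
        using cB[OF y t(2)] by (simp add: Meq)
    qed
    moreover have "measure ?N Z \<le> ?k2 * measure ?M Z"
    proof (rule measure_le_of_cball_measure_le[OF ss(2,1) fM(2,1) Z(1) t32, where \<Lambda> = "(3 * (1 + g) * (1 + g) * (1 + \<delta>)) ^ d"])
      show "?k2 \<ge> 0" using Lc \<delta> g by simp
      fix y t assume y: "y \<in> Z" and t: "0 < t" "t < r / 32"
      have yA: "y \<in> A" using y Z by blast
      have "measure N (cball y t) \<le> ((1 + g) * (t * (1 + \<delta>))) ^ d" using N_c(1)[OF yA t(1)] t by simp
      also have "\<dots> = ?k2 * (L * c0 * t ^ d)"
        using L c0 by (simp add: power_mult_distrib)
      also have "\<dots> \<le> ?k2 * measure M (cball y t)"
        using M_c(2)[OF yA t(1)] t Lc \<delta> g by (intro mult_left_mono) auto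
      finally show "measure ?N (cball y t) \<le> ?k2 * measure ?M (cball y t)"
        using cB[OF y t(2)] by (simp add: Meq Neq)
      have "measure N (cball y (3 * t)) \<le> ((1 + g) * ((3 * t) * (1 + \<delta>))) ^ d" using N_c(1)[OF yA, of "3 * t"] t by simp
      also have "\<dots> = (3 * (1 + g) * (1 + g) * (1 + \<delta>)) ^ d * (t / (1 + g)) ^ d"
      proof -
        have "(3 * (1 + g) * (1 + g) * (1 + \<delta>)) * (t / (1 + g)) = (1 + g) * ((3 * t) * (1 + \<delta>))"
          using g by simp
        then show ?thesis by (simp only: power_mult_distrib[symmetric])
      qed
      also have "\<dots> \<le> (3 * (1 + g) * (1 + g) * (1 + \<delta>)) ^ d * measure N (cball y t)"
        using N_c(2)[OF yA t(1)] t g \<delta> by (intro mult_left_mono) auto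
      finally show "measure ?N (cball y (3 * t)) \<le> (3 * (1 + g) * (1 + g) * (1 + \<delta>)) ^ d * measure ?N (cball y t)"
        using cB[OF y t(2)] by (simp add: Neq)
    qed
    ultimately show ?thesis using hZ by (simp add: Meq[OF Z(1) ZB] Neq[OF Z(1) ZB])
  qed
  then show "hausdorff d Z < \<infinity>"
    "measure M Z \<le> (U * c0 * ((1 + \<delta>) * (1 + g)) ^ d) * enn2real (hausdorff d Z)"
    "enn2real (hausdorff d Z) \<le> (((1 + \<delta>) * (1 + g)) ^ d / (L * c0)) * measure M Z"
    unfolding ZN[symmetric] measure_def by auto
qed

end

section \<open>Selection of the good points\<close>

locale radon_doubling =
  fixes n d :: nat and C :: real and \<mu> :: "fin_seq measure" and x0 :: fin_seq
  assumes d: "d \<ge> 1" and C: "C \<ge> 1" and \<mu>: "radon_measure n \<mu>" and dblmu: "doubling n C \<mu>"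
    and x0: "x0 \<in> msupport n \<mu>"
begin

abbreviation "M \<equiv> ambient \<mu>"
abbreviation "S \<equiv> msupport n \<mu>"

lemma ball_pos: "y \<in> S \<Longrightarrow> s > 0 \<Longrightarrow> 0 < emeasure M (ball y s)"
  by (simp add: msupport_def emeasure_ambient_ball[OF \<mu>])

lemma ball_dbl: "y \<in> S \<Longrightarrow> s > 0 \<Longrightarrow> emeasure M (ball y (2 * s)) \<le> ennreal C * emeasure M (ball y s)"
  using dblmu by (simp add: doubling_def emeasure_ambient_ball[OF \<mu>])

lemma S_Rn: "S \<subseteq> Rn n"
  by (auto simp: msupport_def)

text \<open>Local finiteness gives one ball of finite measure about \<open>x0\<close>, and doubling
  carries finiteness to its dilates, which exhaust the space.\<close>

lemma ball_fin: "emeasure M (ball y s) < \<infinity>"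
proof -
  obtain r0 where r0: "r0 > 0" "emeasure M (ball x0 r0) < \<infinity>"
    using \<mu> x0 by (auto simp: radon_measure_def msupport_def emeasure_ambient_ball[OF \<mu>])
  have fin: "emeasure M (ball x0 (2 ^ k * r0)) < \<infinity>" for k
  proof (induction k)
    case (Suc k)
    have "emeasure M (ball x0 (2 * (2 ^ k * r0))) \<le> ennreal C * emeasure M (ball x0 (2 ^ k * r0))"
      using r0 by (intro ball_dbl x0) auto
    also have "\<dots> < \<infinity>" using Suc by (simp add: ennreal_mult_less_top)
    finally show ?case by (simp add: mult.assoc)
  qed (use r0 in simp)
  obtain k where "(dist x0 y + s) / r0 < 2 ^ k" using real_arch_pow[of 2 "(dist x0 y + s) / r0"] by auto
  then have k: "dist x0 y + s < 2 ^ k * r0" using r0(1) by (simp add: pos_divide_less_eq)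
  have "ball y s \<subseteq> ball x0 (2 ^ k * r0)"
  proof
    fix u assume "u \<in> ball y s"
    then show "u \<in> ball x0 (2 ^ k * r0)" using dist_triangle[of x0 u y] k by simp
  qed
  then have "emeasure M (ball y s) \<le> emeasure M (ball x0 (2 ^ k * r0))"
    by (rule emeasure_mono) (simp add: sets_ambient[OF \<mu>])
  then show ?thesis using fin by (rule le_less_trans)
qed

lemma emeasure_ball_eq: "emeasure M (ball y s) = ennreal (measure M (ball y s))"
  using ball_fin[of y s] by (intro emeasure_eq_ennreal_measure) auto

sublocale doubling_support M C S d
proof
  show "sets M = sets borel" by (rule sets_ambient[OF \<mu>])
  show "emeasure M (ball y s) < \<infinity>" for y s by (rule ball_fin)
  show "measure M (ball y s) > 0" if "y \<in> S" "s > 0" for y s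
    using ball_pos[OF that] unfolding emeasure_ball_eq by simp
  show "measure M (ball y (2 * s)) \<le> C * measure M (ball y s)" if "y \<in> S" "s > 0" for y s
    using ball_dbl[OF that] C unfolding emeasure_ball_eq by (simp flip: ennreal_mult)
qed (use C d in auto)

text \<open>Off the support, \<open>Rn n\<close> is covered by open balls of measure 0. Their union
  is open, and by the Lindelof property countably many of them cover it.\<close>

lemma S_borel: "S \<in> sets borel" and AE_S: "AE y in \<mu>. y \<in> S"
proof -
  define \<F> where "\<F> = {ball y r | y r. emeasure M (ball y r) = 0 \<and> r > 0}"
  obtain \<F>' where F': "\<F>' \<subseteq> \<F>" "countable \<F>'" "\<Union>\<F>' = \<Union>\<F>"
    using Lindelof[of \<F>] unfolding \<F>_def by auto
  have S_eq: "S = Rn n - \<Union>\<F>"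
  proof (intro equalityI subsetI)
    fix y assume y: "y \<in> S"
    have "y \<notin> \<Union>\<F>"
    proof
      assume "y \<in> \<Union>\<F>"
      then obtain z r where z: "y \<in> ball z r" "emeasure M (ball z r) = 0" by (auto simp: \<F>_def)
      have "ball y (r - dist z y) \<subseteq> ball z r"
      proof
        fix u assume "u \<in> ball y (r - dist z y)"
        then show "u \<in> ball z r" using dist_triangle[of z u y] by simp
      qed
      then have "emeasure M (ball y (r - dist z y)) \<le> 0"
        using emeasure_mono[of _ "ball z r" M] z(2) by (simp add: sets_ambient[OF \<mu>])
      moreover have "0 < emeasure M (ball y (r - dist z y))" using z(1) by (intro ball_pos[OF y]) simp
      ultimately show False by simp
    qed
    then show "y \<in> Rn n - \<Union>\<F>" using S_Rn y by blast
  next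
    fix y assume y: "y \<in> Rn n - \<Union>\<F>"
    have "emeasure M (ball y r) > 0" if "r > 0" for r
    proof (rule ccontr)
      assume "\<not> ?thesis"
      then have "ball y r \<in> \<F>" using that by (auto simp: \<F>_def)
      then show False using y that by force
    qed
    then show "y \<in> S" using y by (simp add: msupport_def emeasure_ambient_ball[OF \<mu>])
  qed
  have "open (\<Union>\<F>)" by (auto simp: \<F>_def)
  then show "S \<in> sets borel" unfolding S_eq using Rn_borel[OF \<mu>] by auto
  have "\<Union>\<F>' \<in> null_sets M"
  proof -
    have "B \<in> null_sets M" if "B \<in> \<F>'" for B
    proof -
      have "B \<in> \<F>" using that F'(1) by blast
      then obtain y r where "B = ball y r" "emeasure M (ball y r) = 0" unfolding \<F>_def by blast
      then show ?thesis by (simp add: null_sets_def sets_ambient[OF \<mu>])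
    qed
    then have "(\<Union>B\<in>\<F>'. B) \<in> null_sets M" by (intro null_sets_UN' F'(2))
    then show ?thesis by simp
  qed
  then have "emeasure \<mu> (\<Union>\<F> \<inter> Rn n) = 0"
    using F'(3) emeasure_ambient[OF \<mu>, of "\<Union>\<F>"] by (auto simp: sets_ambient[OF \<mu>] null_sets_def)
  moreover have "\<Union>\<F> \<inter> Rn n \<in> sets \<mu>"
    using \<open>open (\<Union>\<F>)\<close> Rn_borel[OF \<mu>] by (auto simp: sets_radon_iff[OF \<mu>])
  ultimately have "\<Union>\<F> \<inter> Rn n \<in> null_sets \<mu>" by auto
  then show "AE y in \<mu>. y \<in> S"
    by (rule AE_I') (auto simp: S_eq space_radon[OF \<mu>])
qed

lemma alpha_flat:
  assumes z: "z \<in> S" "t > 0" "alpha d n \<mu> z t < ennreal \<alpha>"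
  shows "\<exists>a W c. W \<subseteq> Rn n \<and> flat_approx d M z t a W c (\<alpha> * t * measure M (ball z t))"
  using z S_Rn ball_pos[OF z(1,2)] ball_fin[of z t]
  by (intro alpha_imp_flat_approx[OF d \<mu>]) (auto simp: emeasure_ambient_ball[OF \<mu>])

end

text \<open>
  Replacing \<open>\<alpha>\<close> by its infimum over a neighbourhood in space and scale makes it upper
  semicontinuous, so that no measurability of \<open>\<alpha>\<close> itself is needed.
\<close>
locale radon_doubling_ball = radon_doubling n d C \<mu> x for n d C \<mu> x +
  fixes r :: real
  assumes r: "r > 0"
begin

definition G :: "nat \<Rightarrow> fin_seq \<Rightarrow> ennreal" where
  "G k y = (INF p\<in>{(z, t). z \<in> S \<and> dist z y < r / 2 ^ k / 8 \<and> r / 2 ^ Suc k < t \<and> t \<le> r / 2 ^ k}.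
     alpha d n \<mu> (fst p) (snd p))"

text \<open>Radii above \<open>3 * r / 2\<close> about centres near \<open>x\<close> give balls that
  contain all balls needed in \<open>top_flat\<close>; radii below \<open>2 * r\<close> stay within
  the range of the integral.\<close>

definition top_alpha :: ennreal where
  "top_alpha = (INF p\<in>{(z, t). z \<in> S \<and> dist z x < r / 8 \<and> 3 * r / 2 < t \<and> t < 2 * r}.
     alpha d n \<mu> (fst p) (snd p))"

definition J :: "fin_seq \<Rightarrow> ennreal" where
  "J y = (\<integral>\<^sup>+ t \<in> {0<..<2 * r}. alpha d n \<mu> y t / ennreal t \<partial>lborel)"

lemma G_measurable: "G k \<in> borel_measurable borel"
proof (rule borel_measurableI_less)
  fix a :: ennreal
  have "{y. G k y < a} = (\<Union>p\<in>{(z, t). z \<in> S \<and> r / 2 ^ Suc k < t \<and> t \<le> r / 2 ^ k \<and> alpha d n \<mu> z t < a}.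
      ball (fst p) (r / 2 ^ k / 8))"
    by (auto simp: G_def INF_less_iff)
  also have "open \<dots>" by blast
  finally have "open {y. G k y < a}" .
  then show "{y \<in> space borel. G k y < a} \<in> sets borel" by simp
qed

lemma divide_ennreal_pos: "t > 0 \<Longrightarrow> X / ennreal t = X * ennreal (1 / t)"
  by (simp add: divide_ennreal_def inverse_ennreal inverse_eq_divide)

text \<open>On the dyadic interval \<open>I k\<close> the integrand is at least
  \<open>G k y / (r / 2 ^ k)\<close>, since \<open>(y, t)\<close> itself competes in the infimum.
  The length of \<open>I k\<close> is half of \<open>r / 2 ^ k\<close>.\<close>

lemma sum_G_le_J:
  assumes y: "y \<in> S"
  shows "(\<Sum>k. G k y) * ennreal (1 / 2) \<le> J y"
proof -
  define I where "I k = {r / 2 ^ Suc k<..r / 2 ^ k}" for k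
  have dec: "r / 2 ^ k \<le> r / 2 ^ j" if "j \<le> k" for j k
    using r that by (intro divide_left_mono power_increasing) auto
  have disj: "disjoint_family I"
  proof -
    have "I j \<inter> I k = {}" if "j < k" for j k
      using dec[of "Suc j" k] that by (auto simp: I_def)
    then show ?thesis unfolding disjoint_family_on_def by (metis Int_commute nat_neq_iff)
  qed
  have "(\<Sum>k. G k y) * ennreal (1 / 2) = (\<Sum>k. G k y * ennreal (1 / (r / 2 ^ k)) * emeasure lborel (I k))"
  proof -
    have "ennreal (1 / (r / 2 ^ k)) * emeasure lborel (I k) = ennreal (1 / 2)" for k
    proof -
      have "emeasure lborel (I k) = ennreal (r / 2 ^ k / 2)"
        unfolding I_def using r by (subst emeasure_lborel_Ioc) (auto simp: field_simps)
      then have "ennreal (1 / (r / 2 ^ k)) * emeasure lborel (I k) = ennreal ((1 / (r / 2 ^ k)) * (r / 2 ^ k / 2))"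
        using r by (simp only:) (intro ennreal_mult[symmetric]; simp)
      also have "(1 / (r / 2 ^ k)) * (r / 2 ^ k / 2) = 1 / 2" using r by simp
      finally show ?thesis .
    qed
    then show ?thesis by (simp add: mult.assoc ennreal_suminf_multc)
  qed
  also have "\<dots> = (\<Sum>k. \<integral>\<^sup>+ t. G k y * ennreal (1 / (r / 2 ^ k)) * indicator (I k) t \<partial>lborel)"
    by (subst nn_integral_cmult_indicator) (auto simp: I_def)
  also have "\<dots> = (\<integral>\<^sup>+ t. (\<Sum>k. G k y * ennreal (1 / (r / 2 ^ k)) * indicator (I k) t) \<partial>lborel)"
    by (rule nn_integral_suminf[symmetric]) (auto simp: I_def)
  also have "\<dots> \<le> J y"
    unfolding J_def
  proof (rule nn_integral_mono)
    fix t :: real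
    show "(\<Sum>k. G k y * ennreal (1 / (r / 2 ^ k)) * indicator (I k) t) \<le> alpha d n \<mu> y t / ennreal t * indicator {0<..<2 * r} t"
    proof (cases "\<exists>k. t \<in> I k")
      case True
      then obtain k where k: "t \<in> I k" by blast
      have t: "0 < t" "t < 2 * r" "r / 2 ^ Suc k < t" "t \<le> r / 2 ^ k"
      proof -
        have "0 < r / 2 ^ Suc k" using r by simp
        then show "0 < t" "r / 2 ^ Suc k < t" "t \<le> r / 2 ^ k" using k by (auto simp: I_def)
        then show "t < 2 * r" using dec[of 0 k] r by simp
      qed
      have "G k y \<le> alpha d n \<mu> y t"
        unfolding G_def by (rule INF_lower2[of "(y, t)"]) (use y t r in auto)
      moreover have "1 / (r / 2 ^ k) \<le> 1 / t" using t by (intro divide_left_mono) auto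
      ultimately have "G k y * ennreal (1 / (r / 2 ^ k)) \<le> alpha d n \<mu> y t * ennreal (1 / t)"
        by (intro mult_mono ennreal_leI) auto
      then show ?thesis
        unfolding suminf_cmult_indicator[OF disj k] using t by (simp add: divide_ennreal_pos)
    qed simp
  qed
  finally show ?thesis .
qed

lemma top_alpha_le_J:
  assumes y: "y \<in> S" "dist y x < r / 8"
  shows "top_alpha * ennreal (1 / 4) \<le> J y"
proof -
  have "top_alpha * ennreal (1 / 4) = top_alpha * ennreal (1 / (2 * r)) * emeasure lborel {3 * r / 2<..<2 * r}"
  proof -
    have "ennreal (1 / (2 * r)) * emeasure lborel {3 * r / 2<..<2 * r} = ennreal ((1 / (2 * r)) * (r / 2))"
      using r by (subst emeasure_lborel_Ioo) (auto simp: ennreal_mult'[symmetric] field_simps)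
    also have "(1 / (2 * r)) * (r / 2) = 1 / 4" using r by simp
    finally show ?thesis by (simp add: mult.assoc)
  qed
  also have "\<dots> = (\<integral>\<^sup>+ t. top_alpha * ennreal (1 / (2 * r)) * indicator {3 * r / 2<..<2 * r} t \<partial>lborel)"
    by (subst nn_integral_cmult_indicator) auto
  also have "\<dots> \<le> J y"
    unfolding J_def
  proof (rule nn_integral_mono)
    fix t :: real
    show "top_alpha * ennreal (1 / (2 * r)) * indicator {3 * r / 2<..<2 * r} t
        \<le> alpha d n \<mu> y t / ennreal t * indicator {0<..<2 * r} t"
    proof (cases "t \<in> {3 * r / 2<..<2 * r}")
      case True
      then have t: "0 < t" "3 * r / 2 < t" "t < 2 * r" using r by auto
      have "top_alpha \<le> alpha d n \<mu> y t"
        unfolding top_alpha_def by (rule INF_lower2[of "(y, t)"]) (use y t in auto)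
      moreover have "1 / (2 * r) \<le> 1 / t" using t by (intro divide_left_mono) auto
      ultimately have "top_alpha * ennreal (1 / (2 * r)) \<le> alpha d n \<mu> y t * ennreal (1 / t)"
        by (intro mult_mono ennreal_leI) auto
      then show ?thesis using t by (simp add: divide_ennreal_pos)
    qed simp
  qed
  finally show ?thesis .
qed

context
  fixes C1 :: real
  assumes C1: "C1 \<ge> 0"
    and hyp: "(\<integral>\<^sup>+ y \<in> Rn_ball n x (2 * r). J y \<partial>\<mu>) \<le> ennreal C1 * emeasure \<mu> (Rn_ball n x r)"
begin

text \<open>Chebyshev's inequality by monotonicity of the integral alone: only a constant times an
  indicator is evaluated, so the argument does not ask whether \<open>J\<close> is
  measurable.\<close>

lemma emeasure_le_of_J_ge:
  assumes E: "E \<in> sets \<mu>" "E \<subseteq> Rn_ball n x (2 * r)" and J: "\<And>y. y \<in> S \<Longrightarrow> y \<in> E \<Longrightarrow> c \<le> J y"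
  shows "c * emeasure \<mu> E \<le> ennreal C1 * emeasure \<mu> (Rn_ball n x r)"
proof -
  have "c * emeasure \<mu> E = (\<integral>\<^sup>+ y. c * indicator E y \<partial>\<mu>)"
    using E(1) by (subst nn_integral_cmult_indicator) auto
  also have "\<dots> \<le> (\<integral>\<^sup>+ y \<in> Rn_ball n x (2 * r). J y \<partial>\<mu>)"
  proof (rule nn_integral_mono_AE)
    show "AE y in \<mu>. c * indicator E y \<le> J y * indicator (Rn_ball n x (2 * r)) y"
      using AE_S
    proof eventually_elim
      case (elim y)
      then show ?case using J[of y] E(2) by (auto simp: indicator_def)
    qed
  qed
  also note hyp
  finally show ?thesis .
qed

lemma sets_Rn_ball: "Rn_ball n y s \<in> sets \<mu>"
  using Rn_borel[OF \<mu>] by (auto simp: sets_radon_iff[OF \<mu>] Rn_ball_def)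

lemma sum_G_measurable: "(\<lambda>y. \<Sum>k. G k y) \<in> borel_measurable borel"
  using G_measurable by measurable

lemma exceptional_set:
  assumes \<epsilon>: "\<epsilon> > 0"
  defines "E \<equiv> {y \<in> Rn_ball n x r. ennreal \<epsilon> < (\<Sum>k. G k y)}"
  shows "E \<in> sets \<mu>" "emeasure \<mu> E \<le> ennreal (2 * C1 / \<epsilon>) * emeasure \<mu> (Rn_ball n x r)"
proof -
  have "{y. ennreal \<epsilon> < (\<Sum>k. G k y)} \<in> sets borel"
    using measurable_sets[OF sum_G_measurable, of "{ennreal \<epsilon><..}"] by (simp add: vimage_def)
  then show E: "E \<in> sets \<mu>"
    using Rn_borel[OF \<mu>] by (auto simp: E_def sets_radon_iff[OF \<mu>] Rn_ball_def Collect_conj_eq)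
  have "ennreal (\<epsilon> / 2) * emeasure \<mu> E \<le> ennreal C1 * emeasure \<mu> (Rn_ball n x r)"
  proof (rule emeasure_le_of_J_ge[OF E])
    show "E \<subseteq> Rn_ball n x (2 * r)" using r by (auto simp: E_def Rn_ball_def)
    fix y assume y: "y \<in> S" "y \<in> E"
    have "ennreal (\<epsilon> / 2) = ennreal \<epsilon> * ennreal (1 / 2)"
      using \<epsilon> by (subst ennreal_mult[symmetric]) auto
    also have "\<dots> \<le> (\<Sum>k. G k y) * ennreal (1 / 2)" using y by (intro mult_right_mono) (auto simp: E_def)
    also have "\<dots> \<le> J y" by (rule sum_G_le_J[OF y(1)])
    finally show "ennreal (\<epsilon> / 2) \<le> J y" .
  qed
  then have "ennreal (2 / \<epsilon>) * (ennreal (\<epsilon> / 2) * emeasure \<mu> E) \<le> ennreal (2 / \<epsilon>) * (ennreal C1 * emeasure \<mu> (Rn_ball n x r))"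
    by (rule mult_left_mono) simp
  also have "\<dots> = ennreal (2 * C1 / \<epsilon>) * emeasure \<mu> (Rn_ball n x r)"
    using \<epsilon> C1 by (simp add: mult.assoc[symmetric] flip: ennreal_mult)
  also have "ennreal (2 / \<epsilon>) * (ennreal (\<epsilon> / 2) * emeasure \<mu> E) = emeasure \<mu> E"
    using \<epsilon> by (simp add: mult.assoc[symmetric] flip: ennreal_mult)
  finally show "emeasure \<mu> E \<le> ennreal (2 * C1 / \<epsilon>) * emeasure \<mu> (Rn_ball n x r)" .
qed

text \<open>\<open>J\<close> is at least \<open>top_alpha / 4\<close> at the support points of
  \<open>B(x, r / 8)\<close>, and three doublings compare the mass of this ball with that of
  \<open>B(x, r)\<close>.\<close>

lemma top_alpha_le: "top_alpha \<le> ennreal (4 * C1 * C ^ 3)"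
proof -
  let ?m = "m x (r / 8)"
  have mp: "?m > 0" using pos[OF x0] r by simp
  have em: "emeasure \<mu> (Rn_ball n x s) = ennreal (m x s)" for s
    using emeasure_ball_eq by (simp add: emeasure_ambient_ball[OF \<mu>])
  have "(top_alpha * ennreal (1 / 4)) * emeasure \<mu> (Rn_ball n x (r / 8)) \<le> ennreal C1 * emeasure \<mu> (Rn_ball n x r)"
  proof (rule emeasure_le_of_J_ge[OF sets_Rn_ball])
    show "Rn_ball n x (r / 8) \<subseteq> Rn_ball n x (2 * r)" using r by (auto simp: Rn_ball_def)
    show "top_alpha * ennreal (1 / 4) \<le> J y" if "y \<in> S" "y \<in> Rn_ball n x (r / 8)" for y
      using that by (intro top_alpha_le_J) (auto simp: Rn_ball_def dist_commute)
  qed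
  also have "\<dots> \<le> ennreal (C1 * (C ^ 3 * ?m))"
    unfolding em using C1 dbl_pow[OF x0, of "r / 8" 3] r by (simp add: ennreal_mult'[symmetric] ennreal_leI mult_left_mono)
  finally have "top_alpha * (ennreal (1 / 4) * ennreal ?m) \<le> ennreal (C1 * (C ^ 3 * ?m))"
    unfolding em by (simp add: mult.assoc)
  then have "top_alpha * (ennreal (1 / 4) * ennreal ?m) * ennreal (4 / ?m) \<le> ennreal (C1 * (C ^ 3 * ?m)) * ennreal (4 / ?m)"
    by (rule mult_right_mono) simp
  also have "ennreal (C1 * (C ^ 3 * ?m)) * ennreal (4 / ?m) = ennreal (C1 * (C ^ 3 * ?m) * (4 / ?m))"
    using C1 C mp by (intro ennreal_mult[symmetric]) auto
  also have "C1 * (C ^ 3 * ?m) * (4 / ?m) = 4 * C1 * C ^ 3" using mp by simp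
  also have "top_alpha * (ennreal (1 / 4) * ennreal ?m) * ennreal (4 / ?m) = top_alpha"
  proof -
    have "ennreal (1 / 4) * ennreal ?m * ennreal (4 / ?m) = ennreal (1 / 4 * ?m * (4 / ?m))"
      using mp by (simp only: ennreal_mult'[symmetric] ennreal_mult''[symmetric] less_imp_le zero_le_divide_1_iff zero_le_numeral measure_nonneg)
    also have "1 / 4 * ?m * (4 / ?m) = 1" using mp by simp
    finally show ?thesis by (simp add: mult.assoc)
  qed
  finally show ?thesis .
qed

end

end

section \<open>Flat approximations at the top scale and at good points\<close>

context radon_doubling_ball
begin

text \<open>One ball near the top scale serves two purposes: radius \<open>5 * r / 4\<close> about
  \<open>x\<close> fixes the density of the given ball, and radius \<open>r / 4\<close> about each
  \<open>y\<close> starts its chain. The factors are the ratios of radii,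
  \<open>(5 * r / 2) / (5 * r / 4)\<close> and \<open>2 * r / (r / 4)\<close>, times one and four
  doublings.\<close>

lemma top_flat:
  assumes \<epsilon>: "\<epsilon> > 0" and top: "top_alpha < ennreal \<epsilon>"
  shows "\<exists>a W c. W \<subseteq> Rn n \<and> flat x (5 * r / 4) a W c (2 * C * \<epsilon>) \<and>
    (\<forall>y\<in>S. dist x y < r \<longrightarrow> flat y (r / 4) a W c (8 * C ^ 4 * \<epsilon>))"
proof -
  obtain z t where z: "z \<in> S" "dist z x < r / 8" "3 * r / 2 < t" "t < 2 * r" "alpha d n \<mu> z t < ennreal \<epsilon>"
    using top unfolding top_alpha_def INF_less_iff by auto
  have t0: "t > 0" using z(3) r by simp
  obtain a W c where W: "W \<subseteq> Rn n" and fl: "flat_approx d M z t a W c (\<epsilon> * t * m z t)"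
    using alpha_flat[OF z(1) t0 z(5)] by blast
  have sub: "ball y s \<subseteq> ball z t" if "dist x y + s \<le> 11 * r / 8" for y s
  proof
    fix u assume "u \<in> ball y s"
    then have "dist x u < 11 * r / 8" using dist_triangle[of x u y] that by simp
    then show "u \<in> ball z t" using dist_triangle[of z u x] z(2,3) by simp
  qed
  have mz: "m z t \<le> m y s" if "17 * r / 8 + dist x y \<le> s" for y s
  proof (rule measure_ball_mono, rule subsetI)
    fix u assume "u \<in> ball z t"
    then have "dist x u < 17 * r / 8" using dist_triangle[of x u z] z(2,4) by (simp add: dist_commute)
    then show "u \<in> ball y s" using dist_triangle[of y u x] that by (simp add: dist_commute)
  qed
  have "flat_approx d M x (5 * r / 4) a W c ((2 * C * \<epsilon>) * (5 * r / 4) * m x (5 * r / 4))"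
  proof (rule flat_approx_mono[OF fl])
    show "ball x (5 * r / 4) \<subseteq> ball z t" by (rule sub) (use r in simp)
    have "m z t \<le> m x (2 * (5 * r / 4))" by (rule mz) (use r in simp)
    also have "\<dots> \<le> C * m x (5 * r / 4)" by (rule dbl[OF x0]) (use r in simp)
    finally have "(\<epsilon> * t) * m z t \<le> (\<epsilon> * (5 * r / 2)) * (C * m x (5 * r / 4))"
      using z(4) \<epsilon> r t0 C by (intro mult_mono mult_left_mono) auto
    then show "\<epsilon> * t * m z t \<le> (2 * C * \<epsilon>) * (5 * r / 4) * m x (5 * r / 4)"
      by (simp add: mult_ac)
  qed
  then have 1: "flat x (5 * r / 4) a W c (2 * C * \<epsilon>)"
    using x0 r \<epsilon> C by (simp add: flat_def)
  have 2: "flat y (r / 4) a W c (8 * C ^ 4 * \<epsilon>)" if y: "y \<in> S" "dist x y < r" for y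
  proof -
    have "flat_approx d M y (r / 4) a W c ((8 * C ^ 4 * \<epsilon>) * (r / 4) * m y (r / 4))"
    proof (rule flat_approx_mono[OF fl])
      show "ball y (r / 4) \<subseteq> ball z t" by (rule sub) (use y r in simp)
      have "m z t \<le> m y (2 ^ 4 * (r / 4))" by (rule mz) (use y r in simp)
      also have "\<dots> \<le> C ^ 4 * m y (r / 4)" by (rule dbl_pow[OF y(1)]) (use r in simp)
      finally have "(\<epsilon> * t) * m z t \<le> (\<epsilon> * (2 * r)) * (C ^ 4 * m y (r / 4))"
        using z(4) \<epsilon> r t0 C by (intro mult_mono mult_left_mono) auto
      then show "\<epsilon> * t * m z t \<le> (8 * C ^ 4 * \<epsilon>) * (r / 4) * m y (r / 4)"
        by (simp add: mult_ac)
    qed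
    then show ?thesis using y r \<epsilon> C by (simp add: flat_def)
  qed
  show ?thesis using 1 2 W by blast
qed

text \<open>With \<tau> as below, \<open>\<tau> / 4 + \<tau> / 8 < t\<close> keeps the ball about
  \<open>y\<close> inside the approximated one. Three doublings from \<open>\<tau> / 4\<close> reach
  \<open>2 * \<tau>\<close>, which covers it, and the ratio of radii gives the factor 4.\<close>

lemma good_point_flat:
  assumes y: "y \<in> S" and e: "e > 0" and G: "G k y < ennreal e"
  shows "\<exists>a W c. flat y (r / 4 / 2 ^ k) a W c (4 * C ^ 3 * e)"
proof -
  obtain z t where z: "z \<in> S" "dist z y < r / 2 ^ k / 8" "r / 2 ^ Suc k < t" "t \<le> r / 2 ^ k" "alpha d n \<mu> z t < ennreal e"
    using G unfolding G_def INF_less_iff by auto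
  define \<tau> where "\<tau> = r / 2 ^ k"
  have \<tau>: "\<tau> > 0" "dist z y < \<tau> / 8" "\<tau> / 2 < t" "t \<le> \<tau>" "r / 4 / 2 ^ k = \<tau> / 4"
    using z r by (auto simp: \<tau>_def)
  have t0: "t > 0" using \<tau> by simp
  obtain a W c where fl: "flat_approx d M z t a W c (e * t * m z t)"
    using alpha_flat[OF z(1) t0 z(5)] by blast
  have "flat_approx d M y (\<tau> / 4) a W c ((4 * C ^ 3 * e) * (\<tau> / 4) * m y (\<tau> / 4))"
  proof (rule flat_approx_mono[OF fl])
    show "ball y (\<tau> / 4) \<subseteq> ball z t"
    proof
      fix u assume "u \<in> ball y (\<tau> / 4)"
      then show "u \<in> ball z t" using dist_triangle[of z u y] \<tau> by simp
    qed
    have "ball z t \<subseteq> ball y (2 ^ 3 * (\<tau> / 4))"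
    proof
      fix u assume "u \<in> ball z t"
      then show "u \<in> ball y (2 ^ 3 * (\<tau> / 4))" using dist_triangle[of y u z] \<tau> by (simp add: dist_commute)
    qed
    then have "m z t \<le> m y (2 ^ 3 * (\<tau> / 4))" by (rule measure_ball_mono)
    also have "\<dots> \<le> C ^ 3 * m y (\<tau> / 4)" by (rule dbl_pow[OF y]) (use \<tau> in simp)
    finally have "(e * t) * m z t \<le> (e * \<tau>) * (C ^ 3 * m y (\<tau> / 4))"
      using \<tau> e t0 C by (intro mult_mono mult_left_mono) auto
    then show "e * t * m z t \<le> (4 * C ^ 3 * e) * (\<tau> / 4) * m y (\<tau> / 4)"
      by (simp add: mult_ac)
  qed
  then have "flat y (r / 4 / 2 ^ k) a W c (4 * C ^ 3 * e)"
    unfolding \<tau>(5) using y \<tau> e C by (simp add: flat_def)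
  then show ?thesis by blast
qed

lemma good_point_chain:
  assumes y: "y \<in> S" and \<epsilon>: "\<epsilon> > 0" and G: "(\<Sum>k. G k y) \<le> ennreal \<epsilon>"
    and top: "flat y (r / 4) a0 W0 c0 (8 * C ^ 4 * \<epsilon>)" and E: "16 * C ^ 4 * \<epsilon> \<le> E"
  shows "chain y (r / 4) a0 W0 c0 E"
proof -
  have fin: "G k y < top" for k
    using ennreal_suminf_lessD[OF le_less_trans[OF G ennreal_less_top]] .
  \<comment> \<open>\<open>G\<close> is an infimum, so a strict excess is needed to select a ball.
    The geometric excess adds only \<epsilon> to the sum.\<close>
  define e where "e k = enn2real (G k y) + \<epsilon> * (1/2) ^ Suc k" for k
  have e0: "e k > 0" for k using \<epsilon> by (simp add: e_def add_nonneg_pos)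
  have Ge: "G k y < ennreal (e k)" for k
  proof -
    have "G k y = ennreal (enn2real (G k y))" using fin[of k] by simp
    also have "\<dots> < ennreal (e k)" using \<epsilon> by (subst ennreal_less_iff) (auto simp: e_def)
    finally show ?thesis .
  qed
  have sum_e: "(\<Sum>k<N. e k) \<le> 2 * \<epsilon>" for N
  proof -
    have "ennreal (\<Sum>k<N. enn2real (G k y)) = (\<Sum>k<N. ennreal (enn2real (G k y)))"
      by (rule sum_ennreal[symmetric]) simp
    also have "\<dots> = (\<Sum>k<N. G k y)" using fin by simp
    also have "\<dots> \<le> (\<Sum>k. G k y)" by (rule sum_le_suminf) auto
    also have "\<dots> \<le> ennreal \<epsilon>" by (rule G)
    finally have "(\<Sum>k<N. enn2real (G k y)) \<le> \<epsilon>" using \<epsilon> by (simp add: ennreal_le_iff)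
    moreover have "(\<Sum>k<N. \<epsilon> * (1/2) ^ Suc k) \<le> (\<Sum>k. \<epsilon> * (1/2) ^ Suc k)"
      using \<epsilon> by (intro sum_le_suminf sums_summable[OF sums_mult[OF power_half_series]]) auto
    moreover have "(\<Sum>k. \<epsilon> * (1/2) ^ Suc k) = \<epsilon>"
      using sums_unique[OF sums_mult[OF power_half_series, of \<epsilon>]] by simp
    ultimately show ?thesis unfolding e_def sum.distrib by linarith
  qed
  have "\<exists>a W c. flat y (r / 4 / 2 ^ k) a W c (4 * C ^ 3 * e k)" for k
    by (rule good_point_flat[OF y e0 Ge])
  then obtain a W c where fl: "\<And>k. flat y (r / 4 / 2 ^ k) (a k) (W k) (c k) (4 * C ^ 3 * e k)" by metis
  \<comment> \<open>Index 0 is replaced by the common flat measure. Its error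
    \<open>8 * C ^ 4 * \<epsilon>\<close>, together with \<open>4 * C ^ 3 * (2 * \<epsilon>)\<close>
    for the others, explains the bound \<open>16 * C ^ 4 * \<epsilon>\<close>.\<close>
  define a' W' c' \<alpha>' where "a' = (\<lambda>k. if k = 0 then a0 else a k)" and "W' = (\<lambda>k. if k = 0 then W0 else W k)"
    and "c' = (\<lambda>k. if k = 0 then c0 else c k)"
    and "\<alpha>' = (\<lambda>k. if k = 0 then 8 * C ^ 4 * \<epsilon> else 4 * C ^ 3 * e k)"
  have C3: "C ^ 3 \<le> C ^ 4" "C ^ 3 > 0" using C by (auto intro: power_increasing)
  have "(\<Sum>j<k. \<alpha>' j) \<le> E" for k
  proof -
    have "(\<Sum>j<k. \<alpha>' j) \<le> (\<Sum>j<k. (if j = 0 then 8 * C ^ 4 * \<epsilon> else 0) + 4 * C ^ 3 * e j)"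
      using C3 e0 by (intro sum_mono) (auto simp: \<alpha>'_def intro: less_imp_le)
    also have "\<dots> = (\<Sum>j<k. if j = 0 then 8 * C ^ 4 * \<epsilon> else 0) + 4 * C ^ 3 * (\<Sum>j<k. e j)"
      by (simp only: sum.distrib sum_distrib_left)
    also have "\<dots> \<le> 8 * C ^ 4 * \<epsilon> + 4 * C ^ 3 * (2 * \<epsilon>)"
    proof (rule add_mono)
      show "(\<Sum>j<k. if j = 0 then 8 * C ^ 4 * \<epsilon> else 0) \<le> 8 * C ^ 4 * \<epsilon>"
        using \<epsilon> C by (simp add: sum.delta)
      show "4 * C ^ 3 * (\<Sum>j<k. e j) \<le> 4 * C ^ 3 * (2 * \<epsilon>)" using sum_e C3 by (intro mult_left_mono) auto
    qed
    also have "\<dots> \<le> 8 * C ^ 4 * \<epsilon> + 4 * C ^ 4 * (2 * \<epsilon>)"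
      using C3 \<epsilon> by (intro add_left_mono mult_right_mono) auto
    finally show ?thesis using E by (simp add: mult_ac)
  qed
  moreover have "flat y (r / 4 / 2 ^ k) (a' k) (W' k) (c' k) (\<alpha>' k)" for k
    using fl[of k] top by (simp add: a'_def W'_def c'_def \<alpha>'_def)
  moreover have "a' 0 = a0" "W' 0 = W0" "c' 0 = c0" by (simp_all add: a'_def W'_def c'_def)
  ultimately show ?thesis unfolding chain_def by blast
qed

end

text \<open>At \<delta> = 0 both quotients and the lower density factor equal 1, so the strict
  inequalities persist for small positive \<delta> by continuity.\<close>

lemma exists_small_delta:
  fixes d :: nat and \<gamma> :: real
  assumes "0 < \<gamma>"
  shows "\<exists>\<delta>>0. \<delta> \<le> 1 / 6 \<and> 6 * \<delta> \<le> \<gamma> \<and> 0 < (1 - 2 * \<delta>) ^ d - \<delta> \<and>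
    ((1 + \<delta>) ^ d + \<delta>) * (1 + \<delta>) * ((1 + \<delta>) * (1 + 6 * \<delta>)) ^ d / ((1 - 2 * \<delta>) ^ d - \<delta>) \<le> 1 + \<gamma> \<and>
    1 - \<gamma> \<le> ((1 - 2 * \<delta>) ^ d - \<delta>) * (1 - \<delta>) / (((1 + \<delta>) * (1 + 6 * \<delta>)) ^ d * ((1 + \<delta>) ^ d + \<delta>))"
proof -
  have ev: "eventually (\<lambda>\<delta>. F \<delta> < b) (at_right (0::real))" if "isCont F 0" "F 0 < b" for F :: "real \<Rightarrow> real" and b
    using that order_tendstoD(2)[of F "F 0" "at_right 0" b]
    by (auto simp: isCont_def intro: tendsto_within_subset)
  have "eventually (\<lambda>\<delta>::real. 0 < \<delta>) (at_right 0)" by (rule eventually_at_right_less)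
  moreover have "eventually (\<lambda>\<delta>::real. \<delta> < 1 / 6) (at_right 0)" by (rule ev) auto
  moreover have "eventually (\<lambda>\<delta>::real. 6 * \<delta> < \<gamma>) (at_right 0)" by (rule ev) (use assms in auto)
  moreover have "eventually (\<lambda>\<delta>::real. - ((1 - 2 * \<delta>) ^ d - \<delta>) < 0) (at_right 0)" by (rule ev) auto
  moreover have "eventually (\<lambda>\<delta>. ((1 + \<delta>) ^ d + \<delta>) * (1 + \<delta>) * ((1 + \<delta>) * (1 + 6 * \<delta>)) ^ d / ((1 - 2 * \<delta>) ^ d - \<delta>) < 1 + \<gamma>) (at_right 0)"
    by (rule ev) (use assms in \<open>auto intro!: continuous_intros\<close>)
  moreover have "eventually (\<lambda>\<delta>. - (((1 - 2 * \<delta>) ^ d - \<delta>) * (1 - \<delta>) / (((1 + \<delta>) * (1 + 6 * \<delta>)) ^ d * ((1 + \<delta>) ^ d + \<delta>))) < - (1 - \<gamma>)) (at_right 0)"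
    by (rule ev) (use assms in \<open>auto intro!: continuous_intros\<close>)
  ultimately have "eventually (\<lambda>\<delta>. 0 < \<delta> \<and> \<delta> < 1 / 6 \<and> 6 * \<delta> < \<gamma> \<and> - ((1 - 2 * \<delta>) ^ d - \<delta>) < 0 \<and>
      ((1 + \<delta>) ^ d + \<delta>) * (1 + \<delta>) * ((1 + \<delta>) * (1 + 6 * \<delta>)) ^ d / ((1 - 2 * \<delta>) ^ d - \<delta>) < 1 + \<gamma> \<and>
      - (((1 - 2 * \<delta>) ^ d - \<delta>) * (1 - \<delta>) / (((1 + \<delta>) * (1 + 6 * \<delta>)) ^ d * ((1 + \<delta>) ^ d + \<delta>))) < - (1 - \<gamma>)) (at_right 0)"
    by eventually_elim blast
  then obtain \<delta> where "0 < \<delta> \<and> \<delta> < 1 / 6 \<and> 6 * \<delta> < \<gamma> \<and> - ((1 - 2 * \<delta>) ^ d - \<delta>) < 0 \<and>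
      ((1 + \<delta>) ^ d + \<delta>) * (1 + \<delta>) * ((1 + \<delta>) * (1 + 6 * \<delta>)) ^ d / ((1 - 2 * \<delta>) ^ d - \<delta>) < 1 + \<gamma> \<and>
      - (((1 - 2 * \<delta>) ^ d - \<delta>) * (1 - \<delta>) / (((1 + \<delta>) * (1 + 6 * \<delta>)) ^ d * ((1 + \<delta>) ^ d + \<delta>))) < - (1 - \<gamma>)"
    using eventually_happens'[of "at_right (0::real)"] trivial_limit_at_right_real by blast
  then show ?thesis by (intro exI[of _ \<delta>]) auto
qed

text \<open>The formulas are those of \<open>\<alpha>0\<close> and \<open>K0\<close>, written out
  because \<open>E\<close> must be fixed before any measure is given.\<close>

lemma exists_small_error:
  fixes d :: nat and C \<delta> :: real
  assumes C: "C \<ge> 1" and \<delta>: "0 < \<delta>"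
  shows "\<exists>E>0. E < (1/2) ^ 5 / C ^ 6 \<and> 16 * C * 4 ^ d * E \<le> \<delta>\<^sup>2 \<and>
     4 * (4 ^ (d + 1) * 8 * 2 ^ d * 385 * 16 ^ d * C ^ 3) * E \<le> \<delta> \<and>
     (\<exists>k\<ge>1. 1 / 2 ^ k \<le> \<delta> / 4 \<and> E < (1/2) ^ (k + 1) / C ^ (k + 2))"
proof -
  obtain k0 where k0: "4 / \<delta> < 2 ^ k0" using real_arch_pow[of 2 "4 / \<delta>"] by auto
  define k where "k = Suc k0"
  have "(2::real) ^ k0 \<le> 2 ^ k" by (simp add: k_def)
  then have "4 / \<delta> < 2 ^ k" using k0 by linarith
  then have k: "k \<ge> 1" "1 / 2 ^ k \<le> \<delta> / 4" using \<delta> by (simp_all add: k_def field_simps)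
  define a1 a2 a3 a4 where "a1 = (1/2) ^ 5 / C ^ 6" and "a2 = \<delta>\<^sup>2 / (16 * C * 4 ^ d)"
    and "a3 = \<delta> / (4 * (4 ^ (d + 1) * 8 * 2 ^ d * 385 * 16 ^ d * C ^ 3))"
    and "a4 = (1/2) ^ (k + 1) / C ^ (k + 2)"
  have p: "a1 > 0" "a2 > 0" "a3 > 0" "a4 > 0" using C \<delta> by (auto simp: a1_def a2_def a3_def a4_def)
  define E where "E = min (min a1 a2) (min a3 a4) / 2"
  have E: "0 < E" "E < a1" "E \<le> a2" "E \<le> a3" "E < a4" using p by (auto simp: E_def)
  have "16 * C * 4 ^ d * E \<le> \<delta>\<^sup>2"
    using E(3) C by (simp add: a2_def pos_le_divide_eq mult.commute)
  moreover have "4 * (4 ^ (d + 1) * 8 * 2 ^ d * 385 * 16 ^ d * C ^ 3) * E \<le> \<delta>"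
  proof -
    have "4 * (4 ^ (d + 1) * 8 * 2 ^ d * 385 * 16 ^ d * C ^ 3) > 0" using C by simp
    then show ?thesis using E(4) unfolding a3_def by (subst (asm) pos_le_divide_eq) (simp_all only: mult.commute)
  qed
  ultimately show ?thesis using E k unfolding a1_def a4_def by blast
qed

section \<open>Construction of \<open>A\<close> and choice of the final constant\<close>

context radon_doubling_ball
begin

text \<open>The density \<open>c0\<close> relates \<open>Z\<close> to its Hausdorff measure and also
  the mass of the whole ball to \<open>r ^ d\<close>. It cancels in the quotient, which leaves the
  two expressions in \<delta> bounded in the hypotheses.\<close>

lemma rectifiable_piece:
  fixes \<delta> \<gamma> E \<epsilon> C1 :: real
  defines "L' \<equiv> (1 - 2 * \<delta>) ^ d - \<delta>" and "U' \<equiv> (1 + \<delta>) ^ d + \<delta>" and "P \<equiv> ((1 + \<delta>) * (1 + 6 * \<delta>)) ^ d"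
  assumes \<gamma>: "0 < \<gamma>" "\<gamma> < 1"
    and \<delta>: "6 * \<delta> \<le> \<gamma>" "0 < L'" "U' * (1 + \<delta>) * P / L' \<le> 1 + \<gamma>" "1 - \<gamma> \<le> L' * (1 - \<delta>) / (P * U')"
    and E: "E > 0" "small \<delta> E" and \<epsilon>: "\<epsilon> > 0" "16 * C ^ 4 * \<epsilon> \<le> E"
    and C1: "0 < C1" "2 * C1 \<le> \<epsilon> * \<gamma>" "4 * C1 * C ^ 3 < \<epsilon>"
    and hyp: "(\<integral>\<^sup>+ y \<in> Rn_ball n x (2 * r). J y \<partial>\<mu>) \<le> ennreal C1 * emeasure \<mu> (Rn_ball n x r)"
  shows "\<exists>A \<in> sets \<mu>. A \<subseteq> Rn_ball n x r \<and>
       emeasure \<mu> (Rn_ball n x r - A) \<le> ennreal \<gamma> * emeasure \<mu> (Rn_ball n x r) \<and>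
       (\<exists>G. lipschitz_graph d n \<gamma> G \<and> A \<subseteq> G) \<and>
       (\<forall>Z \<in> sets \<mu>. Z \<subseteq> A \<longrightarrow>
          ennreal (1 - \<gamma>) * (hausdorff d Z / ennreal (r ^ d))
            \<le> emeasure \<mu> Z / emeasure \<mu> (Rn_ball n x r) \<and>
          emeasure \<mu> Z / emeasure \<mu> (Rn_ball n x r)
            \<le> ennreal (1 + \<gamma>) * (hausdorff d Z / ennreal (r ^ d)))"
proof -
  let ?B = "Rn_ball n x r"
  define mB where "mB = m x r"
  have mB: "mB > 0" unfolding mB_def by (rule pos[OF x0 r])
  have emB: "emeasure \<mu> ?B = ennreal mB"
    unfolding mB_def emeasure_ball_eq[symmetric] emeasure_ambient_ball[OF \<mu>] ..
  have \<delta>0: "0 < \<delta>" "\<delta> \<le> 1 / 6" using E(2) by (auto simp: small_def)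
  have C10: "C1 \<ge> 0" using C1 by simp
  have U': "U' > 0" using \<delta>0 by (simp add: U'_def add_pos_pos)
  have P: "P > 0" using \<delta>0 by (simp add: P_def)
  have "top_alpha < ennreal \<epsilon>"
    using top_alpha_le[OF C10 hyp] C1(3) by (rule le_less_trans[OF _ ennreal_lessI[OF \<epsilon>(1)]])
  then obtain a0 W0 c0 where W0: "W0 \<subseteq> Rn n" and fx: "flat x (5 * r / 4) a0 W0 c0 (2 * C * \<epsilon>)"
    and fy: "\<And>y. y \<in> S \<Longrightarrow> dist x y < r \<Longrightarrow> flat y (r / 4) a0 W0 c0 (8 * C ^ 4 * \<epsilon>)"
    using top_flat[OF \<epsilon>(1)] by blast
  have "C ^ 1 \<le> C ^ 4" using C by (intro power_increasing) auto
  then have "2 * C * \<epsilon> \<le> 16 * C ^ 4 * \<epsilon>" using C \<epsilon> by (intro mult_right_mono) auto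
  then have CE: "2 * C * \<epsilon> \<le> E" using \<epsilon>(2) by linarith
  \<comment> \<open>Radius \<open>5 * r / 4\<close> leaves the room for the factor
    \<open>1 + \<delta>\<close> that is needed to estimate the mass of the given ball
    itself.\<close>
  have "r * (1 + \<delta>) \<le> r * (5 / 4)" using \<delta>0 r by (intro mult_left_mono) auto
  then have "mB \<le> U' * (c0 * r ^ d)" "L' * (c0 * r ^ d) \<le> mB"
    unfolding mB_def U'_def L'_def using r
    by (intro flat_density_small[OF fx CE E(2)]; simp)+
  note mB_bounds = this
  have c0: "c0 > 0"
  proof -
    have "0 < U' * (c0 * r ^ d)" using mB mB_bounds(1) by linarith
    then show ?thesis using U' r by (simp add: zero_less_mult_iff)
  qed
  have W: "subspace W0" "dim W0 = d"
    using fx flat_approx_plane by (auto simp: flat_def flat_plane_def)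
  define Ex where "Ex = {y \<in> ?B. ennreal \<epsilon> < (\<Sum>k. G k y)}"
  have Ex: "Ex \<in> sets \<mu>" "emeasure \<mu> Ex \<le> ennreal (2 * C1 / \<epsilon>) * emeasure \<mu> ?B"
    unfolding Ex_def by (rule exceptional_set[OF C10 hyp \<epsilon>(1)])+
  define A where "A = (?B \<inter> S) - Ex"
  have sB: "?B \<in> sets \<mu>" by (rule sets_Rn_ball[OF C10 hyp])
  have sS: "S \<in> sets \<mu>" using S_borel S_Rn by (simp add: sets_radon_iff[OF \<mu>])
  have A: "A \<in> sets \<mu>" unfolding A_def using sB sS Ex(1) by auto
  have AB: "A \<subseteq> ball x r" "A \<subseteq> ?B" "A \<subseteq> Rn n" by (auto simp: A_def Rn_ball_def)
  have chA: "chain y (r / 4) a0 W0 c0 E" if y: "y \<in> A" for y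
  proof -
    have yS: "y \<in> S" "dist x y < r" using y by (auto simp: A_def Rn_ball_def)
    have "(\<Sum>k. G k y) \<le> ennreal \<epsilon>" using y by (auto simp: A_def Ex_def not_less)
    then show ?thesis by (rule good_point_chain[OF yS(1) \<epsilon>(1) _ fy[OF yS] \<epsilon>(2)])
  qed
  have meas: "emeasure \<mu> (?B - A) \<le> ennreal \<gamma> * emeasure \<mu> ?B"
  proof -
    have "emeasure \<mu> (?B - A) \<le> emeasure \<mu> Ex"
    proof (rule emeasure_mono_AE)
      show "AE y in \<mu>. y \<in> ?B - A \<longrightarrow> y \<in> Ex" using AE_S by eventually_elim (auto simp: A_def)
    qed (rule Ex(1))
    also have "\<dots> \<le> ennreal (2 * C1 / \<epsilon>) * emeasure \<mu> ?B" by (rule Ex(2))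
    also have "\<dots> \<le> ennreal \<gamma> * emeasure \<mu> ?B"
      using C1(2) \<epsilon>(1) by (intro mult_right_mono ennreal_leI) (auto simp: pos_divide_le_eq mult.commute)
    finally show ?thesis .
  qed
  obtain f where f: "f ` W0 \<subseteq> W0\<^sup>\<bottom> \<inter> Rn n" "(6 * \<delta>)-lipschitz_on W0 f" "A \<subseteq> (\<lambda>x. x + f x) ` W0"
    using cone_imp_lipschitz_graph[OF d W W0 AB(3) \<delta>0 chain_cone[OF chA chA E(2)]] by blast
  have graph: "lipschitz_graph d n \<gamma> ((\<lambda>x. x + f x) ` W0)"
    unfolding lipschitz_graph_def using W W0 f(1) lipschitz_on_mono[OF f(2) order_refl \<delta>(1)] by blast
  have "ennreal (1 - \<gamma>) * (hausdorff d Z / ennreal (r ^ d)) \<le> emeasure \<mu> Z / emeasure \<mu> ?B \<and>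
      emeasure \<mu> Z / emeasure \<mu> ?B \<le> ennreal (1 + \<gamma>) * (hausdorff d Z / ennreal (r ^ d))"
    if Z: "Z \<in> sets \<mu>" "Z \<subseteq> A" for Z
  proof -
    have Zb: "Z \<in> sets borel" "Z \<subseteq> Rn n" using Z(1) by (simp_all add: sets_radon_iff[OF \<mu>])
    define h where "h = enn2real (hausdorff d Z)"
    define mZ where "mZ = measure M Z"
    have f': "f ` W0 \<subseteq> W0\<^sup>\<bottom>" using f(1) by blast
    note cmp = chain_hausdorff_comparison[OF r AB(1) chA E(2) c0 \<delta>(2)[unfolded L'_def] W f' f(2,3) Zb(1) Z(2),
        folded L'_def U'_def P_def h_def mZ_def]
    have hZ: "hausdorff d Z = ennreal h" using cmp(1) by (simp add: h_def)
    have "emeasure M Z \<le> emeasure M (ball x r)"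
      using Z(2) AB(1) by (intro emeasure_mono) (auto simp: sets_ambient[OF \<mu>])
    then have "emeasure M Z < \<infinity>" using ball_fin by (rule le_less_trans)
    then have "emeasure M Z = ennreal mZ" unfolding mZ_def by (intro emeasure_eq_ennreal_measure) auto
    then have eZ: "emeasure \<mu> Z = ennreal mZ" using emeasure_ambient[OF \<mu> Zb(1)] Zb(2) by (simp add: Int_absorb2)
    have h0: "h \<ge> 0" "mZ \<ge> 0" by (simp_all add: h_def mZ_def)
    have rd: "r ^ d > 0" using r by simp
    have cr: "c0 * r ^ d > 0" using c0 rd by simp
    have "mZ / mB \<le> (U' * (1 + \<delta>) * c0 * P * h) / (L' * (c0 * r ^ d))"
      using cmp(2) mB_bounds(2) \<delta>(2) cr h0 by (intro frac_le) auto
    also have "\<dots> = (U' * (1 + \<delta>) * P / L') * (h / r ^ d)"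
      using c0 by simp
    also have "\<dots> \<le> (1 + \<gamma>) * (h / r ^ d)"
      using \<delta>(3) h0 rd by (intro mult_right_mono) auto
    finally have upper: "mZ / mB \<le> (1 + \<gamma>) * (h / r ^ d)" .
    have "(1 - \<gamma>) * (h / r ^ d) \<le> (L' * (1 - \<delta>) / (P * U')) * (h / r ^ d)"
      using \<delta>(4) h0 rd by (intro mult_right_mono) auto
    also have "\<dots> \<le> (L' * (1 - \<delta>) / (P * U')) * ((P / (L' * (1 - \<delta>) * c0) * mZ) / r ^ d)"
      using cmp(3) \<delta>(2) \<delta>0 P U' rd by (intro mult_left_mono divide_right_mono) auto
    also have "\<dots> = mZ / (U' * (c0 * r ^ d))"
      using \<delta>(2) \<delta>0 P by simp
    also have "\<dots> \<le> mZ / mB"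
      using mB_bounds(1) mB h0 by (intro divide_left_mono) auto
    finally have lower: "(1 - \<gamma>) * (h / r ^ d) \<le> mZ / mB" .
    have e1: "hausdorff d Z / ennreal (r ^ d) = ennreal (h / r ^ d)"
      unfolding hZ using h0 rd by (simp add: divide_ennreal)
    have e2: "emeasure \<mu> Z / emeasure \<mu> ?B = ennreal (mZ / mB)"
      unfolding eZ emB using h0 mB by (simp add: divide_ennreal)
    have hr: "h / r ^ d \<ge> 0" using h0 rd by simp
    have "ennreal (1 - \<gamma>) * ennreal (h / r ^ d) = ennreal ((1 - \<gamma>) * (h / r ^ d))"
      "ennreal (1 + \<gamma>) * ennreal (h / r ^ d) = ennreal ((1 + \<gamma>) * (h / r ^ d))"
      using \<gamma> hr by (simp_all only: ennreal_mult''[symmetric])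
    then show ?thesis unfolding e1 e2 using lower upper by (simp only: ennreal_leI)
  qed
  then show ?thesis using A AB(2) meas graph f(3) by blast
qed

end

theorem theorem1p8:
  fixes d :: nat and C\<^sub>\<delta> \<gamma> :: real
  assumes "d \<ge> 1" and "C\<^sub>\<delta> \<ge> 1" and "0 < \<gamma>" and "\<gamma> < 1"
  shows "\<exists>C\<^sub>1>0. \<forall>n\<ge>d. \<forall>\<mu> :: fin_seq measure. \<forall>x. \<forall>r>0.
    radon_measure n \<mu> \<longrightarrow> doubling n C\<^sub>\<delta> \<mu> \<longrightarrow> x \<in> msupport n \<mu> \<longrightarrow>
    (\<integral>\<^sup>+ y \<in> Rn_ball n x (2 * r).
        (\<integral>\<^sup>+ t \<in> {0<..<2 * r}. alpha d n \<mu> y t / ennreal t \<partial>lborel) \<partial>\<mu>)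
      \<le> ennreal C\<^sub>1 * emeasure \<mu> (Rn_ball n x r) \<longrightarrow>
    (\<exists>A \<in> sets \<mu>. A \<subseteq> Rn_ball n x r \<and>
       emeasure \<mu> (Rn_ball n x r - A) \<le> ennreal \<gamma> * emeasure \<mu> (Rn_ball n x r) \<and>
       (\<exists>G. lipschitz_graph d n \<gamma> G \<and> A \<subseteq> G) \<and>
       (\<forall>Z \<in> sets \<mu>. Z \<subseteq> A \<longrightarrow>
          ennreal (1 - \<gamma>) * (hausdorff d Z / ennreal (r ^ d))
            \<le> emeasure \<mu> Z / emeasure \<mu> (Rn_ball n x r) \<and>
          emeasure \<mu> Z / emeasure \<mu> (Rn_ball n x r)
            \<le> ennreal (1 + \<gamma>) * (hausdorff d Z / ennreal (r ^ d))))"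
proof -
  obtain \<delta> where \<delta>: "\<delta> > 0" "\<delta> \<le> 1 / 6" "6 * \<delta> \<le> \<gamma>" "0 < (1 - 2 * \<delta>) ^ d - \<delta>"
    "((1 + \<delta>) ^ d + \<delta>) * (1 + \<delta>) * ((1 + \<delta>) * (1 + 6 * \<delta>)) ^ d / ((1 - 2 * \<delta>) ^ d - \<delta>) \<le> 1 + \<gamma>"
    "1 - \<gamma> \<le> ((1 - 2 * \<delta>) ^ d - \<delta>) * (1 - \<delta>) / (((1 + \<delta>) * (1 + 6 * \<delta>)) ^ d * ((1 + \<delta>) ^ d + \<delta>))"
    using exists_small_delta[OF assms(3), of d] by blast
  obtain E where E: "E > 0" "E < (1/2) ^ 5 / C\<^sub>\<delta> ^ 6" "16 * C\<^sub>\<delta> * 4 ^ d * E \<le> \<delta>\<^sup>2"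
     "4 * (4 ^ (d + 1) * 8 * 2 ^ d * 385 * 16 ^ d * C\<^sub>\<delta> ^ 3) * E \<le> \<delta>"
     "\<exists>k\<ge>1. 1 / 2 ^ k \<le> \<delta> / 4 \<and> E < (1/2) ^ (k + 1) / C\<^sub>\<delta> ^ (k + 2)"
    using exists_small_error[OF assms(2) \<delta>(1), of d] by blast
  \<comment> \<open>This \<epsilon> makes the error sum of a good point's chain at most
    \<open>E\<close>. In \<open>C1\<close> the first entry bounds the exceptional mass,
    \<open>2 * C1 / \<epsilon> \<le> \<gamma>\<close>; the second gives
    \<open>top_alpha < \<epsilon>\<close>, with 8 in place of 4 for strictness.\<close>
  define \<epsilon> where "\<epsilon> = E / (16 * C\<^sub>\<delta> ^ 4)"
  define C1 where "C1 = min (\<epsilon> * \<gamma> / 2) (\<epsilon> / (8 * C\<^sub>\<delta> ^ 3))"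
  have Cp: "C\<^sub>\<delta> ^ 4 > 0" "C\<^sub>\<delta> ^ 3 > 0" using assms(2) by simp_all
  have \<epsilon>: "\<epsilon> > 0" "16 * C\<^sub>\<delta> ^ 4 * \<epsilon> \<le> E" using E(1) Cp by (simp_all add: \<epsilon>_def)
  have C1: "0 < C1" "2 * C1 \<le> \<epsilon> * \<gamma>" using \<epsilon>(1) Cp assms(3) by (auto simp: C1_def)
  have "C1 \<le> \<epsilon> / (8 * C\<^sub>\<delta> ^ 3)" by (simp add: C1_def)
  then have "C1 * (8 * C\<^sub>\<delta> ^ 3) \<le> \<epsilon>" using Cp by (simp only: pos_le_divide_eq mult_pos_pos zero_less_numeral)
  then have C1': "4 * C1 * C\<^sub>\<delta> ^ 3 < \<epsilon>" using \<epsilon>(1) by (simp add: mult_ac)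
  show ?thesis
  proof (intro exI[of _ C1] conjI allI impI)
    fix n \<mu> x and r :: real
    assume r: "0 < r" and \<mu>: "radon_measure n \<mu>" "doubling n C\<^sub>\<delta> \<mu>" "x \<in> msupport n \<mu>"
      and hyp: "(\<integral>\<^sup>+ y \<in> Rn_ball n x (2 * r).
        (\<integral>\<^sup>+ t \<in> {0<..<2 * r}. alpha d n \<mu> y t / ennreal t \<partial>lborel) \<partial>\<mu>)
      \<le> ennreal C1 * emeasure \<mu> (Rn_ball n x r)"
    interpret radon_doubling_ball n d C\<^sub>\<delta> \<mu> x r
      by unfold_locales (use assms r \<mu> in auto)
    have sm: "small \<delta> E"
      unfolding small_def \<alpha>0_def K0_def using \<delta>(1,2) E by blast
    show "\<exists>A \<in> sets \<mu>. A \<subseteq> Rn_ball n x r \<and>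
       emeasure \<mu> (Rn_ball n x r - A) \<le> ennreal \<gamma> * emeasure \<mu> (Rn_ball n x r) \<and>
       (\<exists>G. lipschitz_graph d n \<gamma> G \<and> A \<subseteq> G) \<and>
       (\<forall>Z \<in> sets \<mu>. Z \<subseteq> A \<longrightarrow>
          ennreal (1 - \<gamma>) * (hausdorff d Z / ennreal (r ^ d))
            \<le> emeasure \<mu> Z / emeasure \<mu> (Rn_ball n x r) \<and>
          emeasure \<mu> Z / emeasure \<mu> (Rn_ball n x r)
            \<le> ennreal (1 + \<gamma>) * (hausdorff d Z / ennreal (r ^ d)))"
      by (rule rectifiable_piece[OF assms(3,4) \<delta>(3-6) E(1) sm \<epsilon> C1 C1' hyp[folded J_def]])
  qed (rule C1(1))
qed

end
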